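(* For every irrational $\alpha>0$ there exists a continuous function $\psi:\mathbb{T}^2\to\mathbb{R}$ such that the flow $(\Psi_t)_{t\in\mathbb{R}}$ on $\mathbb{R}^3$ corresponding to the system $$x'=-2\pi y+2\pi\alpha xz+\frac{(1-x^2-y^2+z^2)x}{2\sqrt{x^2+y^2}}F(x,y,z),$$ $$y'=2\pi x+2\pi\alpha yz+\frac{(1-x^2-y^2+z^2)y}{2\sqrt{x^2+y^2}}F(x,y,z),$$ $$z'=\pi\alpha(1-x^2-y^2+z^2)-z\sqrt{x^2+y^2}\,F(x,y,z)$$ (where $F$ is determined by $\psi$ as in the context) is transitive, i.e. has a dense orbit, and for each $s_-,s_+\in\{-,+\}$ the set of points whose $\omega$-limit set is equal to $A_{s_+}$ and whose $\alpha$-limit set is equal to $A_{s_-}$ is dense in $\mathbb{R}^3$. Moreover, for almost every $\alpha$ (with $\psi$ suitably chosen) the Hausdorff dimension of each such set is no smaller than $5/2$.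
   Context: $\mathbb{T}=\mathbb{R}/\mathbb{Z}$. Let $\mathbb{S}_0=\{(x,y,z):x^2+y^2=1,z=0\}$, $\mathbb{R}_0=\{(x,y,z):x=y=0\}$, $A_+:=\mathbb{S}_0$, $A_-:=\mathbb{R}_0$. For $(x,y,z)\in\mathbb{R}^3\setminus(\mathbb{S}_0\cup\mathbb{R}_0)$ put $\omega(x,y,z)=\frac{1}{2\pi}\arg(x^2+y^2+z^2-1-2zi)\in\mathbb{T}$, $\theta(x,y)=\frac1{2\pi}\arg(x+yi)\in\mathbb{T}$, and $$F(x,y,z)=\ln\sqrt{\frac{(\sqrt{x^2+y^2}+1)^2+z^2}{(\sqrt{x^2+y^2}-1)^2+z^2}}\cdot\psi\bigl(\omega(x,y,z),\theta(x,y)\bigr).$$ The right-hand side of the system extends continuously to all of $\mathbb{R}^3$, where on $\mathbb{S}_0\cup\mathbb{R}_0$ it equals $(-2\pi y+2\pi\alpha xz,\ 2\pi x+2\pi\alpha yz,\ \pi\alpha(1-x^2-y^2+z^2))$; the system is understood with this extension. Solutions exist and are unique; they are defined for all $t\in\mathbb{R}$ except for those on the invariant line $\mathbb{R}_0$, where the flow is only a local flow. *)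

theory Defs
  imports "HOL-Analysis.Analysis"
begin

section \<open>The circle \<open>\<real>/\<int>\<close> with the quotient topology\<close>

quotient_type circle = real / "\<lambda>s t. s - t \<in> \<int>"
  morphisms rep_circle to_circle
proof (rule equivpI)
  show "reflp (\<lambda>s t :: real. s - t \<in> \<int>)"
    by (simp add: reflp_def)
  show "symp (\<lambda>s t :: real. s - t \<in> \<int>)"
    by (metis (mono_tags, lifting) Ints_minus minus_diff_eq sympI)
  show "transp (\<lambda>s t :: real. s - t \<in> \<int>)"
    by (rule transpI) (metis Ints_add diff_add_cancel add_diff_eq)
qed

instantiation circle :: topological_space
begin

definition open_circle :: "circle set \<Rightarrow> bool" where
  "open_circle U \<longleftrightarrow> open (to_circle -` U)"

instance
proof
  show "open (UNIV :: circle set)"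
    by (simp add: open_circle_def)
  show "open (S \<inter> T)" if "open S" "open T" for S T :: "circle set"
    using that by (simp add: open_circle_def open_Int)
  show "open (\<Union> K)" if "\<forall>S\<in>K. open S" for K :: "circle set set"
    using that by (auto simp: open_circle_def vimage_Union)
qed

end

section \<open>Local flows of autonomous differential equations\<close>

definition solution_on ::
    "('a::real_normed_vector \<Rightarrow> 'a) \<Rightarrow> real set \<Rightarrow> (real \<Rightarrow> 'a) \<Rightarrow> 'a \<Rightarrow> bool" where
  "solution_on V I u p \<longleftrightarrow> open I \<and> is_interval I \<and> 0 \<in> I \<and> u 0 = p \<and>
     (\<forall>t\<in>I. (u has_vector_derivative V (u t)) (at t))"

text \<open>The maximal interval of existence of the solution starting at \<open>p\<close>.\<close>

definition flow_dom :: "('a::real_normed_vector \<Rightarrow> 'a) \<Rightarrow> 'a \<Rightarrow> real set" where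
  "flow_dom V p = {t. \<exists>I u. solution_on V I u p \<and> t \<in> I}"

text \<open>The definite description is meaningful for \<open>t \<in> flow_dom V p\<close> when
  solutions of the initial value problem are unique.\<close>

definition flow :: "('a::real_normed_vector \<Rightarrow> 'a) \<Rightarrow> real \<Rightarrow> 'a \<Rightarrow> 'a" where
  "flow V t p = (THE q. \<exists>I u. solution_on V I u p \<and> t \<in> I \<and> q = u t)"

definition orbit :: "('a::real_normed_vector \<Rightarrow> 'a) \<Rightarrow> 'a \<Rightarrow> 'a set" where
  "orbit V p = (\<lambda>t. flow V t p) ` flow_dom V p"

definition transitive_flow :: "('a::real_normed_vector \<Rightarrow> 'a) \<Rightarrow> bool" where
  "transitive_flow V \<longleftrightarrow> (\<exists>p. closure (orbit V p) = UNIV)"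

text \<open>The limit sets are empty when the solution does not exist up to time
  \<open>\<infinity>\<close> (respectively \<open>-\<infinity>\<close>).\<close>

definition omega_limit_set :: "('a::real_normed_vector \<Rightarrow> 'a) \<Rightarrow> 'a \<Rightarrow> 'a set" where
  "omega_limit_set V p = {q. \<exists>\<tau> :: nat \<Rightarrow> real. (\<forall>n. \<tau> n \<in> flow_dom V p) \<and>
     filterlim \<tau> at_top sequentially \<and> (\<lambda>n. flow V (\<tau> n) p) \<longlonglongrightarrow> q}"

definition alpha_limit_set :: "('a::real_normed_vector \<Rightarrow> 'a) \<Rightarrow> 'a \<Rightarrow> 'a set" where
  "alpha_limit_set V p = {q. \<exists>\<tau> :: nat \<Rightarrow> real. (\<forall>n. \<tau> n \<in> flow_dom V p) \<and>
     filterlim \<tau> at_bot sequentially \<and> (\<lambda>n. flow V (\<tau> n) p) \<longlonglongrightarrow> q}"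

section \<open>Hausdorff dimension\<close>

text \<open>\<open>diameter\<close> is only meaningful for bounded sets, hence the boundedness
  requirement on the covering sets.\<close>

definition hausdorff_content :: "real \<Rightarrow> real \<Rightarrow> 'a::metric_space set \<Rightarrow> ennreal" where
  "hausdorff_content s \<delta> A =
     Inf {(\<Sum>i. ennreal (diameter (U i) powr s)) |U :: nat \<Rightarrow> 'a set.
            A \<subseteq> (\<Union>i. U i) \<and> (\<forall>i. bounded (U i) \<and> diameter (U i) \<le> \<delta>)}"

definition hausdorff_measure :: "real \<Rightarrow> 'a::metric_space set \<Rightarrow> ennreal" where
  "hausdorff_measure s A = (SUP \<delta>\<in>{0<..}. hausdorff_content s \<delta> A)"

text \<open>Only exponents \<open>s > 0\<close> are used, since \<open>0 powr 0 = 0\<close>; this does not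
  change the infimum.\<close>

definition hausdorff_dim :: "'a::metric_space set \<Rightarrow> ennreal" where
  "hausdorff_dim A = (INF s\<in>{s. 0 < s \<and> hausdorff_measure s A = 0}. ennreal s)"

section \<open>The system\<close>

type_synonym point = "real \<times> real \<times> real"

definition S0 :: "point set" where
  "S0 = {(x, y, z). x\<^sup>2 + y\<^sup>2 = 1 \<and> z = 0}"

definition R0 :: "point set" where
  "R0 = {(x, y, z). x = 0 \<and> y = 0}"

text \<open>The choice of the branch of the argument disappears modulo \<open>\<int>\<close>.\<close>

definition omega_coord :: "real \<Rightarrow> real \<Rightarrow> real \<Rightarrow> circle" where
  "omega_coord x y z = to_circle (Arg (Complex (x\<^sup>2 + y\<^sup>2 + z\<^sup>2 - 1) (- 2 * z)) / (2 * pi))"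

definition theta_coord :: "real \<Rightarrow> real \<Rightarrow> circle" where
  "theta_coord x y = to_circle (Arg (Complex x y) / (2 * pi))"

definition F :: "(circle \<times> circle \<Rightarrow> real) \<Rightarrow> real \<Rightarrow> real \<Rightarrow> real \<Rightarrow> real" where
  "F \<psi> x y z =
     ln (sqrt (((sqrt (x\<^sup>2 + y\<^sup>2) + 1)\<^sup>2 + z\<^sup>2) / ((sqrt (x\<^sup>2 + y\<^sup>2) - 1)\<^sup>2 + z\<^sup>2)))
       * \<psi> (omega_coord x y z, theta_coord x y)"

text \<open>The first branch is the continuous extension to \<open>S0 \<union> R0\<close> of the formula
  in the second one.\<close>

definition vector_field :: "real \<Rightarrow> (circle \<times> circle \<Rightarrow> real) \<Rightarrow> point \<Rightarrow> point" where
  "vector_field \<alpha> \<psi> = (\<lambda>(x, y, z).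
     if (x, y, z) \<in> S0 \<union> R0 then
       (- 2 * pi * y + 2 * pi * \<alpha> * x * z,
        2 * pi * x + 2 * pi * \<alpha> * y * z,
        pi * \<alpha> * (1 - x\<^sup>2 - y\<^sup>2 + z\<^sup>2))
     else
       (- 2 * pi * y + 2 * pi * \<alpha> * x * z
          + (1 - x\<^sup>2 - y\<^sup>2 + z\<^sup>2) * x / (2 * sqrt (x\<^sup>2 + y\<^sup>2)) * F \<psi> x y z,
        2 * pi * x + 2 * pi * \<alpha> * y * z
          + (1 - x\<^sup>2 - y\<^sup>2 + z\<^sup>2) * y / (2 * sqrt (x\<^sup>2 + y\<^sup>2)) * F \<psi> x y z,
        pi * \<alpha> * (1 - x\<^sup>2 - y\<^sup>2 + z\<^sup>2) - z * sqrt (x\<^sup>2 + y\<^sup>2) * F \<psi> x y z))"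

definition limit_class ::
    "('a::real_normed_vector \<Rightarrow> 'a) \<Rightarrow> 'a set \<Rightarrow> 'a set \<Rightarrow> 'a set" where
  "limit_class V A B = {p. omega_limit_set V p = A \<and> alpha_limit_set V p = B}"

end

theory Submission
  imports Defs "HOL-Real_Asymp.Real_Asymp"
begin

text \<open>In toroidal coordinates \<open>(\<omega>, \<theta>, \<tau>)\<close>, \<open>\<tau> > 0\<close>, on the complement of \<open>S0 \<union> R0\<close> the system
  becomes \<open>\<omega>' = \<alpha>\<close>, \<open>\<theta>' = 1\<close>, \<open>(ln \<tau>)' = \<psi>(\<omega>, \<theta>)\<close>: with \<open>h = ln \<tau>\<close> it is a skew product over an
  irrational flow, \<open>S0\<close> corresponds to \<open>h = \<infinity>\<close> and \<open>R0\<close> to \<open>h = -\<infinity>\<close>. Take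
  \<open>\<psi> = \<Sum>\<^sub>k 2\<pi> \<epsilon>\<^sub>k sin 2\<pi>(q\<^sub>k \<omega> - p\<^sub>k \<theta>)\<close> with \<open>\<epsilon>\<^sub>k = 1/((k+1)(k+2))\<close> and
  \<open>\<delta>\<^sub>k = q\<^sub>k \<alpha> - p\<^sub>k\<close> of order \<open>2\<^sup>-\<^sup>k\<close>. Along an orbit with initial phases \<open>q\<^sub>k \<omega> - p\<^sub>k \<theta> = \<phi>\<close> for
  all \<open>k\<close>, the change of \<open>h\<close> after time \<open>t\<close> is
  \<open>\<Sum>\<^sub>k \<epsilon>\<^sub>k/\<delta>\<^sub>k (cos 2\<pi>\<phi> - cos 2\<pi>(\<phi> + \<delta>\<^sub>k t))\<close>; for \<open>\<phi> = 0, 1/4, 1/2, 3/4\<close> it diverges as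
  \<open>t \<longrightarrow> \<plusminus>\<infinity>\<close> with the four possible combinations of signs, and errors \<open>O(2\<^sup>-\<^sup>k)\<close> in the phases change
  it by a bounded amount only. Such points are dense because base orbits are dense, and the
  intermediate value theorem between a point going to \<open>\<infinity>\<close> and one going to \<open>-\<infinity>\<close> yields
  transitivity, via Baire. As only the size of \<open>\<delta>\<^sub>k\<close> matters, \<open>q\<^sub>k\<close> may grow as fast as desired; then
  the admissible \<open>\<omega>\<close> contain a Cantor set carrying a Hoelder map of exponent \<open>1/2\<close> onto an interval.\<close>

section \<open>The cocycle\<close>

text \<open>The weights serve two opposing ends: they must be summable, for continuity of the
  driving function, yet leave divergent sums after division by the defects
  \<open>\<delta> k\<close>. For phase 0 all summands are nonnegative, so one resonant term of order
  \<open>2^k / k^2\<close> suffices at times of order \<open>2^k\<close>. For phase 1/4 the summands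
  change sign. At such a time the terms up to \<open>k\<close> already oscillate and are controlled
  only in absolute value, by a multiple of \<open>2^k / k^2\<close>; the later ones are still in
  their linear regime and add up to about \<open>t\<close> times the tail of the weights, that is
  \<open>2^k / k\<close>. The slow decay of the weights makes the tail win; for geometric weights
  both parts would be of the same order. The tolerance of order \<open>2^-k\<close> in the phases is
  the amount by which the base flow moves them in bounded time. Hence good base points form a set
  invariant under flow and integer translations, and one explicit good point yields a dense set of
  them. Goodness does not involve \<open>h\<close>. The number 5/2 is 1/2 + 1 + 1: a Cantor set in
  \<omega>, the flow direction, and \<open>h\<close>.\<close>

lemma kronecker_large:
  fixes \<beta> x \<epsilon> :: real
  assumes "\<beta> \<notin> \<rat>" "\<epsilon> > 0"
  obtains n :: nat and m :: int where "n \<ge> N" "\<bar>real n * \<beta> - of_int m - x\<bar> < \<epsilon>"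
proof -
  obtain k where k: "\<bar>frac (real k * \<beta>) - frac (x - real N * \<beta>)\<bar> < \<epsilon>"
    using Kronecker_approx_1_explicit[of \<beta> "frac (x - real N * \<beta>)" \<epsilon>] assms
    by (metis frac_ge_0 frac_lt_1 less_imp_le)
  show thesis
  \<comment> \<open>The multiple \<open>k\<close> approximates the target shifted back by
    \<open>N * \<beta>\<close>; adding \<open>N\<close> undoes the shift and makes the multiplier at
    least \<open>N\<close>.\<close>
  proof (rule that[of "N + k" "\<lfloor>real k * \<beta>\<rfloor> - \<lfloor>x - real N * \<beta>\<rfloor>"])
    show "\<bar>real (N + k) * \<beta> - of_int (\<lfloor>real k * \<beta>\<rfloor> - \<lfloor>x - real N * \<beta>\<rfloor>) - x\<bar> < \<epsilon>"
      using k by (simp add: frac_def algebra_simps)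
  qed simp
qed

lemma cos_int_shift: "cos (2 * pi * (x + of_int m)) = cos (2 * pi * x)"
  by (simp add: cos_add distrib_left)

lemma sin_int_shift: "sin (2 * pi * (x + of_int m)) = sin (2 * pi * x)"
  by (simp add: sin_add distrib_left)

text \<open>The telescoping difference of 1/(k+1) and 1/(k+2). The tail starting at \<open>m\<close>
  is larger than its first term by the factor \<open>m + 2\<close>, and this factor decides
  \<open>odd_sum_lower\<close>.\<close>

definition weight :: "nat \<Rightarrow> real" where
  "weight k = 1 / ((real k + 1) * (real k + 2))"

lemma weight_pos: "weight k > 0"
  by (simp add: weight_def)

lemma weight_tail_sums: "(\<lambda>k. weight (k + m)) sums (1 / (real m + 1))"
proof -
  have "(\<lambda>k. 1 / (real (k + m) + 1) - 1 / (real (Suc k + m) + 1)) sums (1 / (real (0 + m) + 1) - 0)"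
    by (rule telescope_sums') real_asymp
  moreover have "1 / (real (k + m) + 1) - 1 / (real (Suc k + m) + 1) = weight (k + m)" for k
    by (simp add: weight_def field_simps)
  ultimately show ?thesis by simp
qed

lemma summable_weight: "summable weight"
  using weight_tail_sums[of 0] by (auto simp: sums_iff)

text \<open>The terms grow almost geometrically, so the sum is comparable to its last term. The
  induction step needs \<open>weight (Suc k) / weight k = (k + 1) / (k + 3)\<close> to be at least
  3/5, which holds from \<open>k = 2\<close> on; the constant 100 absorbs the start.\<close>

lemma weighted_geometric_bound:
  "(\<Sum>j\<le>k. weight j * 2 ^ Suc j) \<le> 100 + 12 * 2 ^ k * weight k"
proof (induction k)
  case 0
  then show ?case by (simp add: weight_def)
next
  case (Suc k)
  show ?case
  proof (cases "k < 2")
    case True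
    then have "k = 0 \<or> k = 1" by auto
    then show ?thesis by (auto simp: weight_def)
  next
    case False
    have "12 * 2 ^ k * weight k + weight (Suc k) * 2 ^ Suc (Suc k) \<le> 12 * 2 ^ Suc k * weight (Suc k)"
    proof -
      have "12 * weight k + 4 * weight (Suc k) \<le> 24 * weight (Suc k)"
      proof -
        have "3 * ((2 + real k) * (3 + real k)) \<le> (real k + 2) * (5 * (real k + 1))"
          using False mult_left_mono[of "3 * (3 + real k)" "5 * (real k + 1)" "real k + 2"]
          by (simp add: algebra_simps)
        then show ?thesis
          using False by (simp add: weight_def divide_simps) (simp add: algebra_simps)
      qed
      then have "2 ^ k * (12 * weight k + 4 * weight (Suc k)) \<le> 2 ^ k * (24 * weight (Suc k))"
        by (intro mult_left_mono) auto
      then show ?thesis by (simp add: algebra_simps)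
    qed
    moreover have "(\<Sum>j\<le>Suc k. weight j * 2 ^ Suc j)
        = (\<Sum>j\<le>k. weight j * 2 ^ Suc j) + weight (Suc k) * 2 ^ Suc (Suc k)"
      by (rule sum.atMost_Suc)
    ultimately show ?thesis using Suc by linarith
  qed
qed

lemma abs_cos_diff_le: "\<bar>cos x - cos y\<bar> \<le> \<bar>x - y\<bar>" for x y :: real
proof -
  have "\<bar>cos x - cos y\<bar> = 2 * \<bar>sin ((x + y) / 2)\<bar> * \<bar>sin ((y - x) / 2)\<bar>"
    by (simp add: cos_diff_cos abs_mult)
  also have "\<dots> \<le> 2 * 1 * \<bar>(y - x) / 2\<bar>"
    by (intro mult_mono abs_sin_x_le_abs_x) auto
  finally show ?thesis by simp
qed

text \<open>Jordan's inequality with angles measured in full turns: by concavity the sine lies above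
  its chord on the first quarter turn.\<close>

lemma sin_ge_linear: "sin (2 * pi * y) \<ge> 4 * y" if "0 \<le> y" "y \<le> 1/4" for y :: real
proof -
  have "convex_on {0..pi} (\<lambda>x. - sin x)"
    by (rule f''_ge0_imp_convex[where f' = "\<lambda>x. - cos x" and f'' = sin])
      (auto intro!: derivative_eq_intros sin_ge_zero)
  then have "- sin ((1 - 4 * y) *\<^sub>R 0 + (4 * y) *\<^sub>R (pi / 2)) \<le> (1 - 4 * y) * (- sin 0) + (4 * y) * (- sin (pi / 2))"
    using that by (intro convex_onD) auto
  then show ?thesis by (simp add: mult.commute mult.left_commute)
qed

lemma one_minus_cos_ge: "1 - cos (2 * pi * y) \<ge> 1/8" if "1/8 \<le> y" "y \<le> 1/2" for y :: real
proof -
  have "cos (2 * pi * y) \<le> cos (pi / 4)"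
    using that by (intro cos_monotone_0_pi_le) (auto simp: field_simps)
  also have "\<dots> \<le> 7/8"
  proof -
    have "sqrt 2 \<le> 7/4" by (rule real_le_lsqrt) (auto simp: power2_eq_square)
    then show ?thesis by (simp add: cos_45)
  qed
  finally show ?thesis by simp
qed

lemma power_scale:
  fixes b r :: real
  assumes "b > 1" "r \<ge> 1"
  obtains L :: nat where "b ^ L \<le> r" "r < b ^ Suc L"
proof -
  define n where "n = (LEAST n. r < b ^ n)"
  have "\<exists>n. r < b ^ n" using real_arch_pow[OF assms(1)] by blast
  then have n: "r < b ^ n" unfolding n_def by (rule LeastI_ex)
  then obtain L where L: "n = Suc L" using assms(2) by (cases n) auto
  then have "\<not> r < b ^ L" using not_less_Least[of L "\<lambda>n. r < b ^ n"] n_def by auto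
  then show thesis using that[of L] n L by simp
qed

lemma dyadic_scale:
  fixes t :: real
  assumes "t \<ge> 1"
  obtains k :: nat where "2 ^ k \<le> 2 * t" "t \<le> 2 ^ k"
proof -
  obtain L where "2 ^ L \<le> t" "t < 2 ^ Suc L" using power_scale[of 2 t] assms by auto
  then show thesis using that[of "Suc L"] by simp
qed

text \<open>The residue 1 modulo 4 gives the base point \<open>(j/4, 0)\<close> the phase
  \<open>j/4\<close> modulo 1 for every \<open>k\<close> at once. The defects are positive, not
  merely small, so that the sines in \<open>odd_sum\<close> with small argument all have the sign of
  \<open>t\<close>.\<close>

locale cascade =
  fixes \<alpha> :: real and q p :: "nat \<Rightarrow> int"
  assumes alpha_pos: "\<alpha> > 0" and alpha_irrational: "\<alpha> \<notin> \<rat>"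
    and q_mod_4: "\<And>k. q k mod 4 = 1"
    and defect_lower: "\<And>k. (1/2) ^ Suc k \<le> of_int (q k) * \<alpha> - of_int (p k)"
    and defect_upper: "\<And>k. of_int (q k) * \<alpha> - of_int (p k) \<le> (1/2) ^ k"
begin

definition \<delta> :: "nat \<Rightarrow> real" where
  "\<delta> k = of_int (q k) * \<alpha> - of_int (p k)"

definition amp :: "nat \<Rightarrow> real" where
  "amp k = weight k / \<delta> k"

definition phase :: "nat \<Rightarrow> real \<Rightarrow> real \<Rightarrow> real" where
  "phase k \<omega> \<theta> = of_int (q k) * \<omega> - of_int (p k) * \<theta>"

definition psi_lift :: "real \<Rightarrow> real \<Rightarrow> real" where
  "psi_lift \<omega> \<theta> = (\<Sum>k. 2 * pi * weight k * sin (2 * pi * phase k \<omega> \<theta>))"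

text \<open>The time integral of the \<open>k\<close>-th summand of \<open>psi_lift\<close> along
  the base flow, which moves the \<open>k\<close>-th phase with speed \<open>\<delta> k\<close>;
  integrating produces the large factor \<open>1 / \<delta> k\<close> in \<open>amp\<close>.\<close>

definition wave :: "nat \<Rightarrow> real \<Rightarrow> real \<Rightarrow> real" where
  "wave k x t = amp k * (cos (2 * pi * x) - cos (2 * pi * (x + \<delta> k * t)))"

definition cocycle :: "real \<Rightarrow> real \<Rightarrow> real \<Rightarrow> real" where
  "cocycle t \<omega> \<theta> = (\<Sum>k. wave k (phase k \<omega> \<theta>) t)"

lemma delta_bounds: "(1/2) ^ Suc k \<le> \<delta> k" "\<delta> k \<le> (1/2) ^ k" "\<delta> k > 0"
  using defect_lower[of k] defect_upper[of k] less_le_trans[of 0 "(1/2) ^ Suc k" "\<delta> k"]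
  by (simp_all add: \<delta>_def)

lemma amp_delta: "amp k * \<delta> k = weight k"
  using delta_bounds[of k] by (simp add: amp_def)

lemma amp_pos: "amp k > 0"
  using delta_bounds weight_pos by (simp add: amp_def)

lemma amp_lower: "weight k * 2 ^ k \<le> amp k"
proof -
  have "weight k * 2 ^ k * \<delta> k \<le> weight k * 2 ^ k * (1/2) ^ k"
    using delta_bounds weight_pos[of k] by (intro mult_left_mono) auto
  also have "\<dots> = weight k" by (simp add: power_one_over)
  finally show ?thesis
    using delta_bounds by (simp add: amp_def pos_le_divide_eq)
qed

lemma amp_upper: "amp k \<le> weight k * 2 ^ Suc k"
proof -
  have "weight k = weight k * 2 ^ Suc k * (1/2) ^ Suc k" by (simp add: power_one_over)
  also have "\<dots> \<le> weight k * 2 ^ Suc k * \<delta> k"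
    using delta_bounds(1)[of k] weight_pos[of k] by (intro mult_left_mono) auto
  finally show ?thesis
    using delta_bounds by (simp add: amp_def pos_divide_le_eq)
qed

text \<open>The cosine difference carries a factor \<open>\<delta> k * t\<close>, which cancels the
  denominator of \<open>amp\<close>. So the series converges for each fixed time although the
  amplitudes are unbounded.\<close>

lemma wave_bound: "\<bar>wave k x t\<bar> \<le> 2 * pi * \<bar>t\<bar> * weight k"
proof -
  have "\<bar>wave k x t\<bar> = amp k * \<bar>cos (2 * pi * x) - cos (2 * pi * (x + \<delta> k * t))\<bar>"
    using amp_pos[of k] by (simp add: wave_def abs_mult)
  also have "\<dots> \<le> amp k * \<bar>2 * pi * x - 2 * pi * (x + \<delta> k * t)\<bar>"
    using amp_pos[of k] by (intro mult_left_mono abs_cos_diff_le) auto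
  also have "2 * pi * x - 2 * pi * (x + \<delta> k * t) = - (2 * pi * \<delta> k * t)" by (simp add: algebra_simps)
  also have "amp k * \<bar>- (2 * pi * \<delta> k * t)\<bar> = 2 * pi * \<bar>t\<bar> * (amp k * \<delta> k)"
    using delta_bounds(3)[of k] by (simp add: abs_mult)
  finally show ?thesis by (simp add: amp_delta)
qed

lemma summable_wave: "summable (\<lambda>k. wave k (x k) t)"
  by (rule summable_comparison_test'[where N = 0, OF summable_mult[OF summable_weight, of "2 * pi * \<bar>t\<bar>"]])
    (simp add: wave_bound)

lemma phase_add: "phase k (\<omega> + \<alpha> * t) (\<theta> + t) = phase k \<omega> \<theta> + \<delta> k * t"
  by (simp add: phase_def \<delta>_def algebra_simps)

lemma phase_shift:
  "phase k (\<omega> + of_int m) (\<theta> + of_int n) = phase k \<omega> \<theta> + of_int (q k * m - p k * n)"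
  by (simp add: phase_def algebra_simps)

lemma wave_shift: "wave k (x + of_int m) t = wave k x t"
proof -
  have "x + of_int m + \<delta> k * t = (x + \<delta> k * t) + of_int m" by simp
  then show ?thesis unfolding wave_def by (simp only: cos_int_shift)
qed

lemma psi_lift_shift: "psi_lift (\<omega> + of_int m) (\<theta> + of_int n) = psi_lift \<omega> \<theta>"
  unfolding psi_lift_def phase_shift sin_int_shift ..

lemma cocycle_0 [simp]: "cocycle 0 \<omega> \<theta> = 0"
  by (simp add: cocycle_def wave_def)

lemma continuous_psi_lift: "continuous_on UNIV (\<lambda>(\<omega>, \<theta>). psi_lift \<omega> \<theta>)"
proof -
  have "uniform_limit UNIV (\<lambda>n z. \<Sum>k<n. 2 * pi * weight k * sin (2 * pi * phase k (fst z) (snd z)))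
      (\<lambda>z. \<Sum>k. 2 * pi * weight k * sin (2 * pi * phase k (fst z) (snd z))) sequentially"
  proof (rule Weierstrass_m_test)
    show "summable (\<lambda>k. 2 * pi * weight k)" by (intro summable_mult summable_weight)
    show "norm (2 * pi * weight k * sin (2 * pi * phase k (fst z) (snd z))) \<le> 2 * pi * weight k" for k z
      using weight_pos[of k] by (simp add: abs_mult mult_le_cancel_left1)
  qed
  then show ?thesis
    unfolding psi_lift_def case_prod_beta
    by (rule uniform_limit_theorem[rotated])
      (auto intro!: always_eventually continuous_intros simp: phase_def)
qed

lemma continuous_cocycle: "continuous_on UNIV (\<lambda>(\<omega>, \<theta>). cocycle t \<omega> \<theta>)"
proof -
  have "uniform_limit UNIV (\<lambda>n z. \<Sum>k<n. wave k (phase k (fst z) (snd z)) t)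
      (\<lambda>z. \<Sum>k. wave k (phase k (fst z) (snd z)) t) sequentially"
    by (rule Weierstrass_m_test[OF _ summable_mult[OF summable_weight, of "2 * pi * \<bar>t\<bar>"]])
      (simp add: wave_bound)
  then show ?thesis
    unfolding cocycle_def case_prod_beta
    by (rule uniform_limit_theorem[rotated])
      (auto intro!: always_eventually continuous_intros simp: phase_def wave_def)
qed

lemma cocycle_has_derivative:
  "((\<lambda>t. cocycle t \<omega> \<theta>) has_field_derivative psi_lift (\<omega> + \<alpha> * t) (\<theta> + t)) (at t)"
  unfolding cocycle_def psi_lift_def phase_add
proof -
  note deriv = has_field_derivative_series'(2)[of UNIV "\<lambda>k. wave k (phase k \<omega> \<theta>)"
      "\<lambda>k t. 2 * pi * weight k * sin (2 * pi * (phase k \<omega> \<theta> + \<delta> k * t))" 0 t]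
  show "((\<lambda>t. \<Sum>k. wave k (phase k \<omega> \<theta>) t) has_field_derivative
      (\<Sum>k. 2 * pi * weight k * sin (2 * pi * (phase k \<omega> \<theta> + \<delta> k * t)))) (at t)"
  proof (rule deriv)
  fix k t
  have "((\<lambda>t. wave k (phase k \<omega> \<theta>) t) has_field_derivative
     amp k * (2 * pi * \<delta> k * sin (2 * pi * (phase k \<omega> \<theta> + \<delta> k * t)))) (at t)"
    unfolding wave_def by (auto intro!: derivative_eq_intros)
  moreover have "amp k * (2 * pi * \<delta> k * s) = 2 * pi * (amp k * \<delta> k) * s" for s by simp
  ultimately show "((\<lambda>t. wave k (phase k \<omega> \<theta>) t) has_field_derivative
     2 * pi * weight k * sin (2 * pi * (phase k \<omega> \<theta> + \<delta> k * t))) (at t within UNIV)"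
    by (simp add: amp_delta)
next
  have "uniform_limit UNIV
      (\<lambda>n t. \<Sum>i<n. 2 * pi * weight i * sin (2 * pi * (phase i \<omega> \<theta> + \<delta> i * t)))
      (\<lambda>t. \<Sum>i. 2 * pi * weight i * sin (2 * pi * (phase i \<omega> \<theta> + \<delta> i * t))) sequentially"
    by (rule Weierstrass_m_test[OF _ summable_mult[OF summable_weight, of "2 * pi"]])
      (use weight_pos in \<open>simp add: abs_mult mult_le_cancel_left1 less_imp_le\<close>)
  then show "uniformly_convergent_on UNIV
      (\<lambda>n t. \<Sum>i<n. 2 * pi * weight i * sin (2 * pi * (phase i \<omega> \<theta> + \<delta> i * t)))"
    by (auto simp: uniformly_convergent_on_def)
  qed (auto intro: summable_wave)
qed

section \<open>Divergence of the sums with exact phases\<close>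

definition even_sum :: "real \<Rightarrow> real" where "even_sum t = (\<Sum>k. wave k 0 t)"

definition odd_sum :: "real \<Rightarrow> real" where "odd_sum t = (\<Sum>k. wave k (1/4) t)"

lemma wave_even: "wave k 0 t = amp k * (1 - cos (2 * pi * (\<delta> k * t)))"
  by (simp add: wave_def)

lemma wave_odd: "wave k (1/4) t = amp k * sin (2 * pi * (\<delta> k * t))"
proof -
  have "cos (2 * pi * (1/4 + \<delta> k * t)) = - sin (2 * pi * (\<delta> k * t))"
    by (simp add: distrib_left cos_add)
  then show ?thesis by (simp add: wave_def)
qed

lemma wave_half: "wave k (1/2) t = - wave k 0 t"
  by (simp add: wave_def distrib_left cos_add)
    (simp add: algebra_simps)

lemma wave_three_quarters: "wave k (3/4) t = - wave k (1/4) t"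
proof -
  have "wave k (1/4 + 1/2) t = - wave k (1/4) t"
    by (simp only: wave_def distrib_left cos_add sin_add add.commute add.left_commute) (simp add: algebra_simps cos_add)
  then show ?thesis by simp
qed

text \<open>No summand is negative, so a single one bounds the sum. The index \<open>Suc k\<close>
  is resonant: its phase shift \<open>\<delta> (Suc k) * |t|\<close> lies between 1/8 and 1/2 turn,
  where one minus cosine is at least 1/8.\<close>

lemma even_sum_lower:
  assumes "2 ^ k \<le> 2 * \<bar>t\<bar>" "\<bar>t\<bar> \<le> 2 ^ k"
  shows "even_sum t \<ge> weight (Suc k) * 2 ^ Suc k / 8"
proof -
  have "\<delta> (Suc k) * \<bar>t\<bar> \<le> (1/2) ^ Suc k * 2 ^ k"
    using assms delta_bounds[of "Suc k"] by (intro mult_mono) auto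
  then have 1: "\<delta> (Suc k) * \<bar>t\<bar> \<le> 1/2" by (simp add: power_one_over)
  have "(1/2) ^ Suc (Suc k) * (2 ^ k / 2) \<le> \<delta> (Suc k) * \<bar>t\<bar>"
    using assms delta_bounds[of "Suc k"] by (intro mult_mono) auto
  then have 2: "\<delta> (Suc k) * \<bar>t\<bar> \<ge> 1/8" by (simp add: power_one_over)
  have "cos (2 * pi * (\<delta> (Suc k) * t)) = cos (2 * pi * (\<delta> (Suc k) * \<bar>t\<bar>))"
    by (cases "t \<ge> 0") auto
  then have "1 - cos (2 * pi * (\<delta> (Suc k) * t)) \<ge> 1/8"
    using one_minus_cos_ge[OF 2 1] by simp
  then have "weight (Suc k) * 2 ^ Suc k * (1/8) \<le> amp (Suc k) * (1 - cos (2 * pi * (\<delta> (Suc k) * t)))"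
    using amp_lower[of "Suc k"] weight_pos[of "Suc k"] amp_pos[of "Suc k"]
    by (intro mult_mono) auto
  also have "\<dots> = wave (Suc k) 0 t" by (simp add: wave_even)
  also have "\<dots> = (\<Sum>k\<in>{Suc k}. wave k 0 t)" by simp
  also have "\<dots> \<le> even_sum t"
    unfolding even_sum_def
    using amp_pos by (intro sum_le_suminf summable_wave) (auto simp: wave_even less_imp_le)
  finally show ?thesis by simp
qed

text \<open>Split at the scale of \<open>t\<close>. Terms up to \<open>k\<close> are bounded by
  their amplitudes. The term \<open>Suc k\<close> has phase shift at most half a turn, hence a
  nonnegative sine. From \<open>k + 2\<close> on the shift is at most a quarter turn, and Jordan's
  inequality gives at least \<open>4 * t * weight j\<close>, whose sum is known exactly and
  dominates the head for large \<open>k\<close>.\<close>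

lemma odd_sum_lower:
  assumes "2 ^ k \<le> 2 * t" "t \<le> 2 ^ k"
  shows "odd_sum t \<ge> 2 * 2 ^ k / (real k + 3) - (100 + 12 * 2 ^ k * weight k)"
proof -
  have t: "t > 0" using assms less_le_trans[of 0 "2 ^ k" "2 * t"] by simp
  have dt: "\<delta> (j + k) * t \<le> (1/2) ^ j" for j
  proof -
    have "\<delta> (j + k) * t \<le> (1/2) ^ (j + k) * 2 ^ k"
      using assms t delta_bounds[of "j + k"] by (intro mult_mono) auto
    then show ?thesis by (simp add: power_add power_one_over)
  qed
  let ?w = "\<lambda>j. wave j (1/4) t"
  have head: "(\<Sum>j\<le>k. ?w j) \<ge> - (100 + 12 * 2 ^ k * weight k)"
  proof -
    have "- (\<Sum>j\<le>k. ?w j) \<le> (\<Sum>j\<le>k. weight j * 2 ^ Suc j)"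
      unfolding sum_negf[symmetric]
    proof (rule sum_mono)
      fix j
      have "- ?w j = amp j * (- sin (2 * pi * (\<delta> j * t)))" by (simp add: wave_odd)
      also have "\<dots> \<le> amp j * 1"
        using amp_pos[of j] sin_ge_minus_one[of "2 * pi * (\<delta> j * t)"]
        by (intro mult_left_mono) linarith+
      also have "\<dots> \<le> weight j * 2 ^ Suc j" using amp_upper by simp
      finally show "- ?w j \<le> weight j * 2 ^ Suc j" .
    qed
    then show ?thesis using weighted_geometric_bound[of k] by linarith
  qed
  have middle: "?w (Suc k) \<ge> 0"
  proof -
    have "sin (2 * pi * (\<delta> (Suc k) * t)) \<ge> 0"
      using dt[of 1] t delta_bounds[of "Suc k"] by (intro sin_ge_zero) auto
    then show ?thesis using amp_pos[of "Suc k"] by (simp add: wave_odd)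
  qed
  have tail: "(\<Sum>j. ?w (j + (k + 2))) \<ge> 4 * t * (1 / (real (k + 2) + 1))"
  proof -
    have "4 * t * weight (j + (k + 2)) \<le> ?w (j + (k + 2))" for j
    proof -
      have "\<delta> (j + (k + 2)) * t \<le> (1/2) ^ (j + 2)" using dt[of "j + 2"] by (simp add: add_ac)
      also have "\<dots> \<le> 1/4" using power_le_one[of "1/2::real" j] by (simp add: power2_eq_square)
      finally have "4 * (\<delta> (j + (k + 2)) * t) \<le> sin (2 * pi * (\<delta> (j + (k + 2)) * t))"
        using t delta_bounds(3)[of "j + (k + 2)"] by (intro sin_ge_linear) auto
      then have "amp (j + (k + 2)) * (4 * (\<delta> (j + (k + 2)) * t)) \<le> ?w (j + (k + 2))"
        unfolding wave_odd using amp_pos[of "j + (k + 2)"] by (intro mult_left_mono) auto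
      moreover have "amp (j + (k + 2)) * (4 * (\<delta> (j + (k + 2)) * t)) = 4 * t * (amp (j + (k + 2)) * \<delta> (j + (k + 2)))"
        by simp
      ultimately show ?thesis by (simp only: amp_delta)
    qed
    moreover have sums: "(\<lambda>j. 4 * t * weight (j + (k + 2))) sums (4 * t * (1 / (real (k + 2) + 1)))"
      by (intro sums_mult weight_tail_sums)
    moreover have "summable (\<lambda>j. ?w (j + (k + 2)))"
      using summable_wave[of "\<lambda>_. 1/4" t] by (rule summable_ignore_initial_segment)
    ultimately have "(\<Sum>j. 4 * t * weight (j + (k + 2))) \<le> (\<Sum>j. ?w (j + (k + 2)))"
      using sums_summable by (intro suminf_le) blast+
    then show ?thesis unfolding sums_unique[OF sums] .
  qed
  have "odd_sum t = (\<Sum>j. ?w (j + (k + 2))) + (\<Sum>j<k + 2. ?w j)"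
    unfolding odd_sum_def using summable_wave[of "\<lambda>_. 1/4" t] by (rule suminf_split_initial_segment)
  also have "(\<Sum>j<k + 2. ?w j) = (\<Sum>j\<le>k. ?w j) + ?w (Suc k)"
  proof -
    have "{..<k + 2} = {..Suc k}" by auto
    then show ?thesis by (simp only: sum.atMost_Suc)
  qed
  finally have "odd_sum t \<ge> 4 * t * (1 / (real (k + 2) + 1)) - (100 + 12 * 2 ^ k * weight k)"
    using head middle tail by linarith
  moreover have "2 * 2 ^ k * (1 / (real (k + 2) + 1)) \<le> 4 * t * (1 / (real (k + 2) + 1))"
    using assms by (intro mult_right_mono) auto
  ultimately show ?thesis by (simp add: add.commute)
qed

lemma eventually_dyadic_scale:
  assumes "eventually P sequentially"
  shows "\<forall>\<^sub>F t in at_top. \<exists>k. P k \<and> 2 ^ k \<le> 2 * t \<and> t \<le> (2 ^ k :: real)"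
proof -
  obtain N where N: "\<And>k. k \<ge> N \<Longrightarrow> P k" using assms by (auto simp: eventually_sequentially)
  have "\<exists>k. P k \<and> 2 ^ k \<le> 2 * t \<and> t \<le> (2 ^ k :: real)" if t: "t \<ge> 2 ^ N" for t :: real
  proof -
    have "t \<ge> 1" using t one_le_power[of "2::real" N] by linarith
    then obtain k where k: "2 ^ k \<le> 2 * t" "t \<le> 2 ^ k" by (rule dyadic_scale)
    have "(2::real) ^ N \<le> 2 ^ k" using t k by linarith
    then have "N \<le> k" by simp
    with N k show ?thesis by blast
  qed
  then show ?thesis by (auto simp: eventually_at_top_linorder)
qed

lemma even_sum_at_top: "filterlim even_sum at_top at_top"
proof -
  have "filterlim (\<lambda>k. weight (Suc k) * 2 ^ Suc k / 8) at_top sequentially"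
    unfolding weight_def by real_asymp
  then have "\<forall>\<^sub>F k in sequentially. weight (Suc k) * 2 ^ Suc k / 8 \<ge> C" for C
    by (simp add: filterlim_at_top)
  from eventually_dyadic_scale[OF this]
  have "\<forall>\<^sub>F t in at_top. even_sum t \<ge> C" for C
  proof (rule eventually_rev_mp[OF _ eventually_mono[OF eventually_gt_at_top[of 0]]], intro impI)
    fix t :: real
    assume "t > 0" "\<exists>k. C \<le> weight (Suc k) * 2 ^ Suc k / 8 \<and> 2 ^ k \<le> 2 * t \<and> t \<le> 2 ^ k"
    then obtain k where "C \<le> weight (Suc k) * 2 ^ Suc k / 8" "2 ^ k \<le> 2 * \<bar>t\<bar>" "\<bar>t\<bar> \<le> 2 ^ k" by auto
    with even_sum_lower[of k t] show "C \<le> even_sum t" by linarith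
  qed
  then show ?thesis by (simp add: filterlim_at_top)
qed

lemma even_sum_at_bot: "filterlim even_sum at_top at_bot"
proof -
  have "even_sum (- t) = even_sum t" for t by (simp add: even_sum_def wave_even)
  then show ?thesis using even_sum_at_top by (simp add: filterlim_at_bot_mirror)
qed

lemma odd_sum_at_top: "filterlim odd_sum at_top at_top"
proof -
  have "filterlim (\<lambda>k. 2 * 2 ^ k / (real k + 3) - (100 + 12 * 2 ^ k * weight k)) at_top sequentially"
    unfolding weight_def by real_asymp
  then have "\<forall>\<^sub>F k in sequentially. 2 * 2 ^ k / (real k + 3) - (100 + 12 * 2 ^ k * weight k) \<ge> C" for C
    by (simp add: filterlim_at_top)
  from eventually_dyadic_scale[OF this]
  have "\<forall>\<^sub>F t in at_top. odd_sum t \<ge> C" for C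
  proof (rule eventually_mono)
    fix t :: real
    assume "\<exists>k. 2 * 2 ^ k / (real k + 3) - (100 + 12 * 2 ^ k * weight k) \<ge> C \<and> 2 ^ k \<le> 2 * t \<and> t \<le> 2 ^ k"
    then obtain k where "2 * 2 ^ k / (real k + 3) - (100 + 12 * 2 ^ k * weight k) \<ge> C" "2 ^ k \<le> 2 * t" "t \<le> 2 ^ k" by auto
    with odd_sum_lower[of k t] show "C \<le> odd_sum t" by linarith
  qed
  then show ?thesis by (simp add: filterlim_at_top)
qed

lemma odd_sum_at_bot: "filterlim odd_sum at_bot at_bot"
proof -
  have "odd_sum (- t) = - odd_sum t" for t
    using summable_wave[of "\<lambda>_. 1/4" t] by (simp add: odd_sum_def wave_odd suminf_minus)
  then show ?thesis using odd_sum_at_top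
    by (simp add: filterlim_at_bot_mirror filterlim_uminus_at_bot)
qed

text \<open>\<open>C\<close> is uniform in \<open>k\<close>, while the integer may vary with
  \<open>k\<close>. The constant is left unspecified because it grows by \<open>|t|\<close> along
  the flow; exact phases would not be preserved.\<close>

definition near_phase :: "real \<Rightarrow> real \<Rightarrow> real \<Rightarrow> bool" where
  "near_phase \<phi> \<omega> \<theta> \<longleftrightarrow> (\<exists>C. \<forall>k. \<exists>m. \<bar>phase k \<omega> \<theta> - \<phi> - of_int m\<bar> \<le> C * (1/2) ^ k)"

text \<open>Moving the \<open>k\<close>-th phase by \<open>O(2\<^sup>-\<^sup>k)\<close> changes the \<open>k\<close>-th summand by \<open>O(weight k)\<close>,
  uniformly in time.\<close>

lemma cocycle_near_phase:
  assumes "near_phase \<phi> \<omega> \<theta>"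
  obtains D where "\<And>t. \<bar>cocycle t \<omega> \<theta> - (\<Sum>k. wave k \<phi> t)\<bar> \<le> D"
proof -
  obtain C where C: "\<And>k. \<exists>m. \<bar>phase k \<omega> \<theta> - \<phi> - of_int m\<bar> \<le> C * (1/2) ^ k"
    using assms by (auto simp: near_phase_def)
  have bound: "\<bar>wave k (phase k \<omega> \<theta>) t - wave k \<phi> t\<bar> \<le> 8 * pi * C * weight k" for k t
  proof -
    obtain m where m: "\<bar>phase k \<omega> \<theta> - \<phi> - of_int m\<bar> \<le> C * (1/2) ^ k"
      using C by blast
    define e where "e = phase k \<omega> \<theta> - \<phi> - of_int m"
    have ph: "phase k \<omega> \<theta> = \<phi> + e + of_int m" by (simp add: e_def)
    \<comment> \<open>The four cosines are paired by time instead of by starting phase. The members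
      of a pair differ by \<open>e\<close> alone, so \<open>t\<close> disappears from the
      bound.\<close>
    have "wave k (phase k \<omega> \<theta>) t - wave k \<phi> t = amp k *
        ((cos (2 * pi * (\<phi> + e)) - cos (2 * pi * \<phi>))
          - (cos (2 * pi * (\<phi> + e + \<delta> k * t)) - cos (2 * pi * (\<phi> + \<delta> k * t))))"
      unfolding ph wave_shift by (simp only: wave_def right_diff_distrib)
    also have "\<bar>\<dots>\<bar> \<le> amp k * (2 * pi * \<bar>e\<bar> + 2 * pi * \<bar>e\<bar>)"
    proof -
      have cos_bound: "\<bar>cos (2 * pi * (x + e)) - cos (2 * pi * x)\<bar> \<le> 2 * pi * \<bar>e\<bar>" for x
      proof -
        have "2 * pi * (x + e) - 2 * pi * x = 2 * pi * e" by (simp add: distrib_left)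
        then show ?thesis
          using abs_cos_diff_le[of "2 * pi * (x + e)" "2 * pi * x"] by (simp add: abs_mult)
      qed
      have "\<bar>(cos (2 * pi * (\<phi> + e)) - cos (2 * pi * \<phi>))
          - (cos (2 * pi * (\<phi> + \<delta> k * t + e)) - cos (2 * pi * (\<phi> + \<delta> k * t)))\<bar>
          \<le> 2 * pi * \<bar>e\<bar> + 2 * pi * \<bar>e\<bar>"
        using cos_bound[of \<phi>] cos_bound[of "\<phi> + \<delta> k * t"] by linarith
      moreover have "\<phi> + e + \<delta> k * t = \<phi> + \<delta> k * t + e" by simp
      ultimately show ?thesis
        unfolding abs_mult abs_of_pos[OF amp_pos] using amp_pos[of k]
        by (intro mult_left_mono) (simp_all only: less_imp_le)
    qed
    also have "\<dots> = 4 * pi * (amp k * \<bar>e\<bar>)" by simp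
    also have "\<dots> \<le> 4 * pi * ((weight k * 2 ^ Suc k) * (C * (1/2) ^ k))"
      using m amp_upper[of k] amp_pos[of k] weight_pos[of k]
      by (intro mult_left_mono mult_mono) (auto simp: e_def)
    also have "\<dots> = 8 * pi * C * weight k" by (simp add: power_one_over)
    finally show ?thesis .
  qed
  show thesis
  proof (rule that)
    fix t
    have "\<bar>cocycle t \<omega> \<theta> - (\<Sum>k. wave k \<phi> t)\<bar> = \<bar>\<Sum>k. wave k (phase k \<omega> \<theta>) t - wave k \<phi> t\<bar>"
      unfolding cocycle_def by (subst suminf_diff) (auto intro: summable_wave)
    also have "\<dots> \<le> (\<Sum>k. 8 * pi * C * weight k)"
      using norm_suminf_le[of "\<lambda>k. wave k (phase k \<omega> \<theta>) t - wave k \<phi> t" "\<lambda>k. 8 * pi * C * weight k"]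
        bound[of _ t] summable_mult[OF summable_weight, of "8 * pi * C"] by (simp only: real_norm_def)
    finally show "\<bar>cocycle t \<omega> \<theta> - (\<Sum>k. wave k \<phi> t)\<bar> \<le> (\<Sum>k. 8 * pi * C * weight k)" .
  qed
qed

lemma filterlim_at_top_bounded_diff:
  fixes f g :: "real \<Rightarrow> real"
  assumes "filterlim f at_top L" "\<And>t. \<bar>g t - f t\<bar> \<le> C"
  shows "filterlim g at_top L"
proof -
  have "filterlim (\<lambda>t. - C + f t) at_top L"
    by (rule filterlim_tendsto_add_at_top[OF tendsto_const assms(1)])
  then show ?thesis
  proof (rule filterlim_at_top_mono)
    have "- C + f t \<le> g t" for t using assms(2)[of t] by linarith
    then show "\<forall>\<^sub>F t in L. - C + f t \<le> g t" by (intro always_eventually allI)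
  qed
qed

lemma filterlim_at_bot_bounded_diff:
  fixes f g :: "real \<Rightarrow> real"
  assumes "filterlim f at_bot L" "\<And>t. \<bar>g t - f t\<bar> \<le> C"
  shows "filterlim g at_bot L"
proof -
  have "\<bar>- g t - (- f t)\<bar> \<le> C" for t using assms(2)[of t] by linarith
  with filterlim_at_top_bounded_diff[of "\<lambda>t. - f t" L "\<lambda>t. - g t" C] assms(1)
  show ?thesis by (simp add: filterlim_uminus_at_bot)
qed

lemma cocycle_limit_of_exact:
  assumes "near_phase \<phi> \<omega> \<theta>"
  shows "filterlim (\<lambda>t. \<Sum>k. wave k \<phi> t) at_top L \<Longrightarrow> filterlim (\<lambda>t. cocycle t \<omega> \<theta>) at_top L"
    and "filterlim (\<lambda>t. \<Sum>k. wave k \<phi> t) at_bot L \<Longrightarrow> filterlim (\<lambda>t. cocycle t \<omega> \<theta>) at_bot L"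
proof -
  obtain D where D: "\<And>t. \<bar>cocycle t \<omega> \<theta> - (\<Sum>k. wave k \<phi> t)\<bar> \<le> D"
    using cocycle_near_phase[OF assms] by blast
  show "filterlim (\<lambda>t. cocycle t \<omega> \<theta>) at_top L" if "filterlim (\<lambda>t. \<Sum>k. wave k \<phi> t) at_top L"
    by (rule filterlim_at_top_bounded_diff[OF that D])
  show "filterlim (\<lambda>t. cocycle t \<omega> \<theta>) at_bot L" if "filterlim (\<lambda>t. \<Sum>k. wave k \<phi> t) at_bot L"
    by (rule filterlim_at_bot_bounded_diff[OF that D])
qed

lemma exact_sums:
  "(\<Sum>k. wave k 0 t) = even_sum t" "(\<Sum>k. wave k (1/4) t) = odd_sum t"
  "(\<Sum>k. wave k (1/2) t) = - even_sum t" "(\<Sum>k. wave k (3/4) t) = - odd_sum t"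
  unfolding even_sum_def odd_sum_def wave_half wave_three_quarters
  by (simp_all add: suminf_minus summable_wave)

lemma cocycle_limits_even:
  assumes "near_phase 0 \<omega> \<theta>"
  shows "filterlim (\<lambda>t. cocycle t \<omega> \<theta>) at_top at_top" "filterlim (\<lambda>t. cocycle t \<omega> \<theta>) at_top at_bot"
  using cocycle_limit_of_exact(1)[OF assms, unfolded exact_sums] even_sum_at_top even_sum_at_bot by simp_all

lemma cocycle_limits_half:
  assumes "near_phase (1/2) \<omega> \<theta>"
  shows "filterlim (\<lambda>t. cocycle t \<omega> \<theta>) at_bot at_top" "filterlim (\<lambda>t. cocycle t \<omega> \<theta>) at_bot at_bot"
  using cocycle_limit_of_exact(2)[OF assms, unfolded exact_sums] even_sum_at_top even_sum_at_bot
  by (simp_all only: filterlim_uminus_at_bot minus_minus)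

lemma cocycle_limits_quarter:
  assumes "near_phase (1/4) \<omega> \<theta>"
  shows "filterlim (\<lambda>t. cocycle t \<omega> \<theta>) at_top at_top" "filterlim (\<lambda>t. cocycle t \<omega> \<theta>) at_bot at_bot"
  using cocycle_limit_of_exact[OF assms, unfolded exact_sums] odd_sum_at_top odd_sum_at_bot by simp_all

lemma cocycle_limits_three_quarters:
  assumes "near_phase (3/4) \<omega> \<theta>"
  shows "filterlim (\<lambda>t. cocycle t \<omega> \<theta>) at_bot at_top" "filterlim (\<lambda>t. cocycle t \<omega> \<theta>) at_top at_bot"
proof -
  have "filterlim (\<lambda>t. - odd_sum t) at_bot at_top" "filterlim (\<lambda>t. - odd_sum t) at_top at_bot"
    using odd_sum_at_top odd_sum_at_bot
    by (simp_all only: filterlim_uminus_at_bot minus_minus)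
  with cocycle_limit_of_exact[OF assms, unfolded exact_sums]
  show "filterlim (\<lambda>t. cocycle t \<omega> \<theta>) at_bot at_top" "filterlim (\<lambda>t. cocycle t \<omega> \<theta>) at_top at_bot"
    by simp_all
qed

lemma near_phase_flow:
  assumes "near_phase \<phi> \<omega> \<theta>" shows "near_phase \<phi> (\<omega> + \<alpha> * t) (\<theta> + t)"
proof -
  obtain C where C: "\<And>k. \<exists>m. \<bar>phase k \<omega> \<theta> - \<phi> - of_int m\<bar> \<le> C * (1/2) ^ k"
    using assms by (auto simp: near_phase_def)
  have "\<exists>m. \<bar>phase k (\<omega> + \<alpha> * t) (\<theta> + t) - \<phi> - of_int m\<bar> \<le> (C + \<bar>t\<bar>) * (1/2) ^ k" for k
  proof -
    obtain m where m: "\<bar>phase k \<omega> \<theta> - \<phi> - of_int m\<bar> \<le> C * (1/2) ^ k" using C by blast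
    have "\<bar>t * \<delta> k\<bar> \<le> \<bar>t\<bar> * (1/2) ^ k"
      unfolding abs_mult using delta_bounds[of k] by (intro mult_left_mono) auto
    then have "\<bar>phase k (\<omega> + \<alpha> * t) (\<theta> + t) - \<phi> - of_int m\<bar> \<le> (C + \<bar>t\<bar>) * (1/2) ^ k"
      using m unfolding phase_add distrib_right mult.commute[of "\<delta> k" t] by linarith
    then show ?thesis ..
  qed
  then show ?thesis unfolding near_phase_def by blast
qed

lemma near_phase_shift:
  assumes "near_phase \<phi> \<omega> \<theta>" shows "near_phase \<phi> (\<omega> + of_int m) (\<theta> + of_int n)"
proof -
  obtain C where C: "\<And>k. \<exists>m. \<bar>phase k \<omega> \<theta> - \<phi> - of_int m\<bar> \<le> C * (1/2) ^ k"
    using assms by (auto simp: near_phase_def)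
  have "\<exists>l. \<bar>phase k (\<omega> + of_int m) (\<theta> + of_int n) - \<phi> - of_int l\<bar> \<le> C * (1/2) ^ k" for k
  proof -
    obtain l where "\<bar>phase k \<omega> \<theta> - \<phi> - of_int l\<bar> \<le> C * (1/2) ^ k" using C by blast
    then show ?thesis
      unfolding phase_shift by (intro exI[of _ "l + (q k * m - p k * n)"]) simp
  qed
  then show ?thesis unfolding near_phase_def by blast
qed

lemma near_phase_multiple_of_quarter: "near_phase (of_int j / 4) (of_int j / 4) 0"
  unfolding near_phase_def
proof (rule exI[of _ 1], rule allI)
  fix k
  have "q k = 4 * (q k div 4) + 1" using q_mod_4[of k] by (metis mult_div_mod_eq)
  then have "real_of_int (q k) = 4 * of_int (q k div 4) + 1" by (metis of_int_1 of_int_add of_int_mult of_int_numeral)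
  then have "phase k (of_int j / 4) 0 = of_int j / 4 + of_int (j * (q k div 4))"
    by (simp add: phase_def algebra_simps)
  then show "\<exists>m. \<bar>phase k (of_int j / 4) 0 - of_int j / 4 - of_int m\<bar> \<le> 1 * (1/2) ^ k"
    by (intro exI[of _ "j * (q k div 4)"]) simp
qed

text \<open>Follow the flow from the exact point \<open>(j/4, 0)\<close> for time
  \<open>\<theta> + n\<close> and shift back by integers: the second coordinate is again \<theta>,
  and Kronecker's theorem puts the first one near \<omega>. Keeping \<theta> fixed is what later
  allows an intermediate value argument in \<omega> alone.\<close>

lemma near_phase_dense:
  assumes "\<epsilon> > 0"
  obtains \<omega>' where "\<bar>\<omega>' - \<omega>\<bar> < \<epsilon>" "near_phase (of_int j / 4) \<omega>' \<theta>"
proof -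
  obtain n :: nat and m :: int
    where nm: "\<bar>real n * \<alpha> - of_int m - (\<omega> - of_int j / 4 - \<alpha> * \<theta>)\<bar> < \<epsilon>"
    using kronecker_large[OF alpha_irrational assms] by blast
  have "near_phase (of_int j / 4) (of_int j / 4 + \<alpha> * (\<theta> + n) + of_int (- m)) (0 + (\<theta> + n) + of_int (- int n))"
    by (intro near_phase_shift near_phase_flow near_phase_multiple_of_quarter)
  then have "near_phase (of_int j / 4) (of_int j / 4 + \<alpha> * (\<theta> + n) - of_int m) \<theta>" by simp
  moreover have "\<bar>of_int j / 4 + \<alpha> * (\<theta> + n) - of_int m - \<omega>\<bar> < \<epsilon>"
    using nm by (simp add: algebra_simps)
  ultimately show thesis by (rule that[rotated])
qed

end

section \<open>Toroidal coordinates\<close>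

lemma to_circle_eq_iff: "to_circle s = to_circle t \<longleftrightarrow> s - t \<in> \<int>"
  by (simp add: circle.abs_eq_iff)

lemma to_circle_rep: "to_circle (rep_circle a) = a"
  using Quotient_abs_rep[OF Quotient_circle] by simp

lemma rep_to_circle:
  obtains m :: int where "rep_circle (to_circle t) = t + of_int m"
proof -
  have "rep_circle (to_circle t) - t \<in> \<int>"
    using to_circle_rep[of "to_circle t"] by (simp add: to_circle_eq_iff)
  then obtain m :: int where "rep_circle (to_circle t) - t = of_int m" by (auto elim: Ints_cases)
  then show thesis using that[of m] by simp
qed

lemma open_to_circle_image:
  assumes "open U"
  shows "open (to_circle ` U)"
proof -
  have "to_circle -` (to_circle ` U) = (\<Union>m::int. (+) (of_int m) ` U)"
  proof (intro equalityI subsetI)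
    fix t assume "t \<in> to_circle -` to_circle ` U"
    then obtain u where u: "u \<in> U" "t - u \<in> \<int>" by (auto simp: to_circle_eq_iff)
    then obtain m :: int where "t - u = of_int m" by (auto elim: Ints_cases)
    then have "t = of_int m + u" by simp
    then show "t \<in> (\<Union>m::int. (+) (of_int m) ` U)" using u by blast
  next
    fix t assume "t \<in> (\<Union>m::int. (+) (of_int m) ` U)"
    then obtain m :: int and u where u: "u \<in> U" "t = of_int m + u" by auto
    then have "to_circle t = to_circle u" by (simp add: to_circle_eq_iff)
    then show "t \<in> to_circle -` to_circle ` U" using u by auto
  qed
  then show ?thesis
    using assms by (simp add: open_circle_def open_UN open_translation)
qed

text \<open>A product of quotient maps need not be a quotient map, so continuity does not descend
  automatically. Here \<open>to_circle\<close> is open, and boxes in the plane map to open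
  boxes.\<close>

lemma continuous_on_circle_prod:
  fixes f :: "circle \<times> circle \<Rightarrow> real"
  assumes "continuous_on UNIV (\<lambda>(s, t). f (to_circle s, to_circle t))"
  shows "continuous_on UNIV f"
  unfolding continuous_on_open_vimage[OF open_UNIV]
proof (intro allI impI)
  fix V :: "real set" assume V: "open V"
  show "open (f -` V \<inter> UNIV)"
  proof (subst open_subopen, intro ballI)
    fix z assume z: "z \<in> f -` V \<inter> UNIV"
    obtain a b where ab: "z = (a, b)" by (cases z)
    let ?P = "(\<lambda>(s, t). f (to_circle s, to_circle t)) -` V"
    have "open ?P"
      using assms V continuous_on_open_vimage[OF open_UNIV] by auto
    moreover have "(rep_circle a, rep_circle b) \<in> ?P"
      using z by (simp add: ab to_circle_rep)
    ultimately obtain A B where AB: "open A" "open B" "(rep_circle a, rep_circle b) \<in> A \<times> B" "A \<times> B \<subseteq> ?P"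
      by (rule open_prod_elim)
    have "open (to_circle ` A \<times> to_circle ` B)"
      using AB by (intro open_Times open_to_circle_image)
    moreover have "z \<in> to_circle ` A \<times> to_circle ` B"
      using AB(3) to_circle_rep[of a] to_circle_rep[of b] unfolding ab by (metis SigmaE2 SigmaI imageI)
    moreover have "to_circle ` A \<times> to_circle ` B \<subseteq> f -` V \<inter> UNIV"
      using AB(4) by auto
    ultimately show "\<exists>T. open T \<and> z \<in> T \<and> T \<subseteq> f -` V \<inter> UNIV" by blast
  qed
qed

context cascade
begin

definition psi :: "circle \<times> circle \<Rightarrow> real" where
  "psi = (\<lambda>(a, b). psi_lift (rep_circle a) (rep_circle b))"

lemma psi_to_circle: "psi (to_circle s, to_circle t) = psi_lift s t"
  by (metis (no_types, lifting) case_prod_conv psi_def psi_lift_shift rep_to_circle)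

lemma continuous_psi: "continuous_on UNIV psi"
  by (rule continuous_on_circle_prod) (use continuous_psi_lift in \<open>simp add: psi_to_circle\<close>)

end

section \<open>Toroidal coordinates through a Moebius map of the meridian half plane\<close>

lemma cis_eq_iff: "cis a = cis b \<longleftrightarrow> (\<exists>m::int. a = b + 2 * pi * of_int m)"
proof
  assume "cis a = cis b"
  then have "cis (a - b) = 1" by (metis cis_divide cis_neq_zero right_inverse_eq)
  then have "cos (a - b) = 1" by (metis cis.sel(1) one_complex.sel(1))
  then obtain m :: int where "a - b = of_int m * 2 * pi" by (auto simp: cos_one_2pi_int)
  then show "\<exists>m::int. a = b + 2 * pi * of_int m" by (intro exI[of _ m]) (simp add: algebra_simps)
next
  assume "\<exists>m::int. a = b + 2 * pi * of_int m"
  then show "cis a = cis b" by (auto simp: cis_mult[symmetric])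
qed

lemma to_circle_Arg:
  assumes "z = of_real r * cis (2 * pi * t)" "r > 0"
  shows "to_circle (Arg z / (2 * pi)) = to_circle t"
proof -
  have "z \<noteq> 0" "sgn z = cis (2 * pi * t)"
    using assms by (auto simp: sgn_eq norm_mult)
  then have "cis (Arg z) = cis (2 * pi * t)" by (simp add: cis_Arg)
  then obtain m :: int where "Arg z = 2 * pi * t + 2 * pi * of_int m" by (auto simp: cis_eq_iff)
  then have "Arg z / (2 * pi) - t = of_int m" by (simp add: field_simps)
  then show ?thesis by (simp add: to_circle_eq_iff)
qed

text \<open>The quotient by rotation about the axis. \<open>R0\<close> becomes the imaginary axis
  and \<open>S0\<close> the point 1, which the Moebius map in \<open>cayley\<close> sends to the
  unit circle and to infinity.\<close>

definition half_plane :: "point \<Rightarrow> complex" where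
  "half_plane = (\<lambda>(x, y, z). Complex (sqrt (x\<^sup>2 + y\<^sup>2)) z)"

definition horiz :: "point \<Rightarrow> complex" where
  "horiz = (\<lambda>(x, y, z). Complex x y)"

text \<open>The logarithm of \<open>cayley P\<close> is the pair of toroidal coordinates of \<open>P\<close>.\<close>

definition cayley :: "point \<Rightarrow> complex" where
  "cayley P = (1 + half_plane P) / (1 - half_plane P)"

text \<open>The modulus is \<open>exp \<tau>\<close> with \<open>\<tau> = exp h\<close>, so that
  \<open>h\<close> runs through all reals and \<psi> enters additively. The half turn
  \<open>- pi\<close> compensates a sign in the definition of \<open>omega_coord\<close>.\<close>

definition zcoord :: "real \<Rightarrow> real \<Rightarrow> complex" where
  "zcoord \<omega> h = of_real (exp (exp h)) * cis (2 * pi * \<omega> - pi)"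

definition wcoord :: "real \<Rightarrow> real \<Rightarrow> complex" where
  "wcoord \<omega> h = (zcoord \<omega> h - 1) / (zcoord \<omega> h + 1)"

definition chart :: "real \<Rightarrow> real \<Rightarrow> real \<Rightarrow> point" where
  "chart \<omega> \<theta> h = (Re (wcoord \<omega> h) * cos (2 * pi * \<theta>), Re (wcoord \<omega> h) * sin (2 * pi * \<theta>), Im (wcoord \<omega> h))"

lemma norm_zcoord: "cmod (zcoord \<omega> h) = exp (exp h)"
  by (simp add: zcoord_def norm_mult)

lemma norm_zcoord_gt_1: "cmod (zcoord \<omega> h) > 1"
  by (simp add: norm_zcoord)

lemma zcoord_neq: "zcoord \<omega> h + 1 \<noteq> 0" "zcoord \<omega> h \<noteq> 0"
proof -
  show "zcoord \<omega> h + 1 \<noteq> 0"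
  proof
    assume "zcoord \<omega> h + 1 = 0"
    then have "zcoord \<omega> h = -1" by (simp add: eq_neg_iff_add_eq_0)
    then show False using norm_zcoord_gt_1[of \<omega> h] by simp
  qed
  show "zcoord \<omega> h \<noteq> 0" using norm_zcoord_gt_1[of \<omega> h] by auto
qed

lemma Re_moebius: "Re ((z - 1) / (z + 1)) = ((cmod z)\<^sup>2 - 1) / (cmod (z + 1))\<^sup>2"
  by (simp add: Re_divide cmod_power2) (simp add: power2_eq_square algebra_simps)

lemma Re_wcoord: "Re (wcoord \<omega> h) = ((exp (exp h))\<^sup>2 - 1) / (cmod (zcoord \<omega> h + 1))\<^sup>2"
  by (simp add: wcoord_def Re_moebius norm_zcoord)

lemma Re_wcoord_pos: "Re (wcoord \<omega> h) > 0"
proof -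
  have "(exp (exp h))\<^sup>2 > (1::real)" by (simp add: one_less_power)
  then show ?thesis using zcoord_neq by (simp add: Re_wcoord)
qed

lemma wcoord_neq_1: "wcoord \<omega> h \<noteq> 1"
  using zcoord_neq[of \<omega> h] by (simp add: wcoord_def field_simps)

lemma wcoord_inverse: "(1 + wcoord \<omega> h) / (1 - wcoord \<omega> h) = zcoord \<omega> h"
  using zcoord_neq[of \<omega> h] by (simp add: wcoord_def divide_simps)

lemma half_plane_chart: "half_plane (chart \<omega> \<theta> h) = wcoord \<omega> h"
proof -
  have "(Re (wcoord \<omega> h) * cos (2 * pi * \<theta>))\<^sup>2 + (Re (wcoord \<omega> h) * sin (2 * pi * \<theta>))\<^sup>2 = (Re (wcoord \<omega> h))\<^sup>2"
    by (simp add: power_mult_distrib flip: distrib_left)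
  then show ?thesis
    using Re_wcoord_pos[of \<omega> h] by (simp add: half_plane_def chart_def complex_eq_iff)
qed

lemma cayley_chart: "cayley (chart \<omega> \<theta> h) = zcoord \<omega> h"
  by (simp add: cayley_def half_plane_chart wcoord_inverse)

lemma horiz_chart: "horiz (chart \<omega> \<theta> h) = of_real (Re (wcoord \<omega> h)) * cis (2 * pi * \<theta>)"
  by (simp add: horiz_def chart_def complex_eq_iff)

lemma norm_horiz: "cmod (horiz P) = Re (half_plane P)"
  by (cases P) (simp add: horiz_def half_plane_def cmod_def)

lemma singular_iff: "P \<in> S0 \<union> R0 \<longleftrightarrow> half_plane P = 1 \<or> horiz P = 0"
  by (cases P) (auto simp: S0_def R0_def half_plane_def horiz_def complex_eq_iff)

lemma chart_regular: "chart \<omega> \<theta> h \<notin> S0 \<union> R0"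
  using Re_wcoord_pos[of \<omega> h] wcoord_neq_1[of \<omega> h]
  unfolding singular_iff half_plane_chart norm_eq_zero[symmetric, of "horiz (chart \<omega> \<theta> h)"] norm_horiz by simp

lemma Re_half_plane_pos:
  assumes "P \<notin> S0 \<union> R0" shows "Re (half_plane P) > 0"
  using assms unfolding singular_iff norm_horiz[symmetric] by simp

lemma norm_moebius_gt_1:
  assumes "Re w > 0" "w \<noteq> 1" shows "cmod ((1 + w) / (1 - w)) > 1"
proof -
  have "(cmod (1 - w))\<^sup>2 < (cmod (1 + w))\<^sup>2"
    using assms(1) by (simp add: cmod_power2) (simp add: power2_eq_square algebra_simps)
  then have "cmod (1 - w) < cmod (1 + w)" by (rule power_less_imp_less_base) simp
  then show ?thesis using assms(2) by (simp add: norm_divide)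
qed

lemma norm_cayley_gt_1:
  assumes "P \<notin> S0 \<union> R0" shows "cmod (cayley P) > 1"
  unfolding cayley_def using assms Re_half_plane_pos[OF assms] singular_iff[of P] by (intro norm_moebius_gt_1) blast+

text \<open>The modulus of \<open>horiz P\<close> is the real part of \<open>half_plane P\<close>,
  which \<open>cayley P\<close> already determines; so \<open>r\<close> is forced and only the
  direction of \<open>horiz P\<close> is further data.\<close>

lemma chart_eqI:
  assumes "cayley P = zcoord \<omega> h" "horiz P = of_real r * cis (2 * pi * \<theta>)" "r > 0"
  shows "P = chart \<omega> \<theta> h"
proof -
  have "half_plane P \<noteq> 1"
    using assms(1) zcoord_neq(2)[of \<omega> h] by (auto simp: cayley_def)
  then have "half_plane P = wcoord \<omega> h"
    using assms(1) zcoord_neq[of \<omega> h] unfolding wcoord_def cayley_def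
    by (simp add: divide_simps) (simp add: algebra_simps)
  moreover have "r = Re (half_plane P)"
    using assms by (simp add: norm_horiz[symmetric] norm_mult)
  ultimately show ?thesis
    using assms(2) by (cases P) (simp add: chart_def horiz_def half_plane_def complex_eq_iff)
qed

lemma polar_turns:
  assumes "z \<noteq> 0" obtains t where "z = of_real (cmod z) * cis (2 * pi * t)"
proof (rule that[of "Arg z / (2 * pi)"])
  show "z = of_real (cmod z) * cis (2 * pi * (Arg z / (2 * pi)))"
    using rcis_cmod_Arg[of z] by (simp add: rcis_def)
qed

lemma chart_surj:
  assumes "P \<notin> S0 \<union> R0" obtains \<omega> \<theta> h where "P = chart \<omega> \<theta> h"
proof -
  have n: "cmod (cayley P) > 1" by (rule norm_cayley_gt_1[OF assms])
  then have "- cayley P \<noteq> 0" by auto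
  then obtain \<omega> where "- cayley P = of_real (cmod (- cayley P)) * cis (2 * pi * \<omega>)" by (rule polar_turns)
  then have c: "cayley P = of_real (cmod (cayley P)) * cis (2 * pi * \<omega> - pi)"
    by (simp add: cis_divide[symmetric]) (metis minus_minus)
  define h where "h = ln (ln (cmod (cayley P)))"
  have h: "exp (exp h) = cmod (cayley P)" using n ln_gt_zero[OF n] \<open>- cayley P \<noteq> 0\<close> by (simp add: h_def)
  have "horiz P \<noteq> 0" using assms singular_iff[of P] by blast
  then obtain \<theta> where "horiz P = of_real (cmod (horiz P)) * cis (2 * pi * \<theta>)" by (rule polar_turns)
  with c \<open>horiz P \<noteq> 0\<close> have "P = chart \<omega> \<theta> h"
    by (intro chart_eqI) (auto simp: zcoord_def h)
  then show thesis by (rule that)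
qed

lemma zcoord_shift: "zcoord (\<omega> + of_int m) h = zcoord \<omega> h"
proof -
  have "cis (2 * pi * (\<omega> + of_int m) - pi) = cis (2 * pi * \<omega> - pi)"
    unfolding cis_eq_iff by (intro exI[of _ m]) (simp add: algebra_simps)
  then show ?thesis by (simp add: zcoord_def)
qed

lemma chart_shift: "chart (\<omega> + of_int m) (\<theta> + of_int n) h = chart \<omega> \<theta> h"
  unfolding chart_def wcoord_def zcoord_shift cos_int_shift sin_int_shift ..

lemma theta_coord_eq:
  assumes "Complex x y = of_real r * cis (2 * pi * \<theta>)" "r > 0"
  shows "theta_coord x y = to_circle \<theta>"
  unfolding theta_coord_def by (rule to_circle_Arg[OF assms])

text \<open>With \<open>w\<close> the half-plane point, \<open>(1 + w) / (1 - w)\<close> has the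
  argument of \<open>(1 + w) * cnj (1 - w)\<close>, which is the negative of the complex number
  inside \<open>omega_coord\<close>.\<close>

lemma omega_coord_eq:
  assumes "cayley (x, y, z) = of_real r * cis (2 * pi * \<omega> - pi)" "r > 0"
  shows "omega_coord x y z = to_circle \<omega>"
proof -
  let ?w = "half_plane (x, y, z)"
  have w: "?w \<noteq> 1" using assms by (auto simp: cayley_def)
  have "Complex (x\<^sup>2 + y\<^sup>2 + z\<^sup>2 - 1) (- 2 * z) = - ((1 + ?w) * cnj (1 - ?w))"
    by (simp add: half_plane_def complex_eq_iff) (simp add: power2_eq_square[symmetric] algebra_simps)
  also have "\<dots> = - cayley (x, y, z) * ((1 - ?w) * cnj (1 - ?w))"
    using w by (simp add: cayley_def)
  also have "(1 - ?w) * cnj (1 - ?w) = of_real ((cmod (1 - ?w))\<^sup>2)" by (rule complex_norm_square[symmetric])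
  also have "- cayley (x, y, z) = of_real r * cis (2 * pi * \<omega>)"
    by (simp add: assms(1) cis_divide[symmetric])
  finally have "Complex (x\<^sup>2 + y\<^sup>2 + z\<^sup>2 - 1) (- 2 * z) = of_real (r * (cmod (1 - ?w))\<^sup>2) * cis (2 * pi * \<omega>)"
    by (simp add: algebra_simps)
  then show ?thesis
    unfolding omega_coord_def using assms(2) w
    by (intro to_circle_Arg[where r = "r * (cmod (1 - ?w))\<^sup>2"]) auto
qed

text \<open>The quotient under the root in \<open>F\<close> is the squared modulus of
  \<open>cayley\<close>, so the logarithmic factor of \<open>F\<close> is the coordinate
  \<tau>.\<close>

lemma F_eq:
  assumes "(x, y, z) \<notin> S0 \<union> R0"
  shows "F \<psi> x y z = ln (cmod (cayley (x, y, z))) * \<psi> (omega_coord x y z, theta_coord x y)"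
proof -
  have "cmod (cayley (x, y, z)) = sqrt (((sqrt (x\<^sup>2 + y\<^sup>2) + 1)\<^sup>2 + z\<^sup>2) / ((sqrt (x\<^sup>2 + y\<^sup>2) - 1)\<^sup>2 + z\<^sup>2))"
  proof -
    have "cmod (1 + half_plane (x, y, z)) = sqrt ((sqrt (x\<^sup>2 + y\<^sup>2) + 1)\<^sup>2 + z\<^sup>2)"
      "cmod (1 - half_plane (x, y, z)) = sqrt ((sqrt (x\<^sup>2 + y\<^sup>2) - 1)\<^sup>2 + z\<^sup>2)"
      by (simp_all add: half_plane_def cmod_def power2_commute add.commute)
    then show ?thesis by (simp only: cayley_def norm_divide real_sqrt_divide)
  qed
  then show ?thesis by (simp add: F_def)
qed

lemma F_chart:
  assumes "chart \<omega> \<theta> h = (x, y, z)"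
  shows "F \<psi> x y z = exp h * \<psi> (to_circle \<omega>, to_circle \<theta>)"
proof -
  have c: "cayley (x, y, z) = zcoord \<omega> h" by (simp flip: assms add: cayley_chart)
  have "omega_coord x y z = to_circle \<omega>"
    by (rule omega_coord_eq[where r = "exp (exp h)"]) (simp_all add: c zcoord_def)
  moreover have "theta_coord x y = to_circle \<theta>"
    using horiz_chart[of \<omega> \<theta> h] Re_wcoord_pos[of \<omega> h]
    by (intro theta_coord_eq[where r = "Re (wcoord \<omega> h)"]) (simp_all add: assms horiz_def)
  moreover have "(x, y, z) \<notin> S0 \<union> R0" using chart_regular[of \<omega> \<theta> h] assms by simp
  ultimately show ?thesis by (simp add: F_eq c norm_zcoord)
qed

lemma continuous_zcoord:
  assumes "continuous_on A f" "continuous_on A g"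
  shows "continuous_on A (\<lambda>s. zcoord (f s) (g s))"
  unfolding zcoord_def cis_conv_exp by (intro continuous_intros assms)

lemma continuous_chart:
  fixes f g k :: "'a::t2_space \<Rightarrow> real"
  assumes "continuous_on A f" "continuous_on A g" "continuous_on A k"
  shows "continuous_on A (\<lambda>s. chart (f s) (g s) (k s))"
  unfolding chart_def wcoord_def
  by (intro continuous_intros continuous_zcoord assms ballI zcoord_neq)

lemma closed_singular: "closed (S0 \<union> R0)"
proof (rule closed_Un)
  have "S0 = {P. (fst P)\<^sup>2 + (fst (snd P))\<^sup>2 = 1} \<inter> {P. snd (snd P) = 0}" by (auto simp: S0_def)
  also have "closed \<dots>" by (intro closed_Int closed_Collect_eq continuous_intros)
  finally show "closed S0" .
  have "R0 = {P. fst P = 0} \<inter> {P. fst (snd P) = 0}" by (auto simp: R0_def)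
  also have "closed \<dots>" by (intro closed_Int closed_Collect_eq continuous_intros)
  finally show "closed R0" .
qed

lemma closure_regular: "closure (- (S0 \<union> R0)) = UNIV"
proof -
  have "P \<in> closure (- (S0 \<union> R0))" for P
  proof (cases "P \<in> S0 \<union> R0")
    case False then show ?thesis using closure_subset[of "- (S0 \<union> R0)"] by blast
  next
    case True
    obtain x y z where P: "P = (x, y, z)" by (cases P)
    \<comment> \<open>The 2 keeps the values strictly below 1, so that \<open>(?e n, 0, z)\<close>
      also misses the circle when \<open>z = 0\<close>.\<close>
    let ?e = "\<lambda>n. 1 / (real n + 2)"
    have lim: "?e \<longlonglongrightarrow> 0" by real_asymp
    have ne: "?e n \<noteq> 0" "(?e n)\<^sup>2 \<noteq> 1" for n
      by (auto simp: power2_eq_1_iff field_simps)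
    show ?thesis
    proof (cases "P \<in> R0")
      case True
      have "(\<lambda>n. (?e n, 0, z)) \<longlonglongrightarrow> (0, 0, z)" by (intro tendsto_intros lim)
      moreover have "(?e n, 0, z) \<in> - (S0 \<union> R0)" for n using ne[of n] by (auto simp: S0_def R0_def)
      ultimately have "(0, 0, z) \<in> closure (- (S0 \<union> R0))" unfolding closure_sequential by (intro exI conjI allI)
      then show ?thesis using True by (simp add: P R0_def)
    next
      case False
      with \<open>P \<in> S0 \<union> R0\<close> have S: "x\<^sup>2 + y\<^sup>2 = 1" "z = 0" by (auto simp: P S0_def)
      have "(\<lambda>n. (x, y, ?e n)) \<longlonglongrightarrow> (x, y, 0)" by (intro tendsto_intros lim)
      moreover have "(x, y, ?e n) \<in> - (S0 \<union> R0)" for n using ne[of n] S by (auto simp: S0_def R0_def)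
      ultimately have "(x, y, 0) \<in> closure (- (S0 \<union> R0))" unfolding closure_sequential by (intro exI conjI allI)
      then show ?thesis using S by (simp add: P)
    qed
  qed
  then show ?thesis by auto
qed

section \<open>Solutions in toroidal coordinates\<close>

text \<open>The logarithm of \<open>(1 + w) / (1 - w)\<close> has derivative
  \<open>2 / (1 - w^2)\<close> in \<open>w\<close>, so the meridian equation turns into the linear
  equation \<open>z' = z * v\<close>.\<close>

lemma has_vector_derivative_moebius:
  fixes w :: "real \<Rightarrow> complex"
  assumes "(w has_vector_derivative (1 - (w t)\<^sup>2) / 2 * v) (at t)" "w t \<noteq> 1"
  shows "((\<lambda>t. (1 + w t) / (1 - w t)) has_vector_derivative (1 + w t) / (1 - w t) * v) (at t)"
proof -
  have "((\<lambda>w. (1 + w) / (1 - w)) has_field_derivative 2 / (1 - w t)\<^sup>2) (at (w t))"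
    using assms(2) by (auto intro!: derivative_eq_intros simp: power2_eq_square)
  from field_vector_diff_chain_at[OF assms(1) this]
  have "((\<lambda>t. (1 + w t) / (1 - w t)) has_vector_derivative (1 - (w t)\<^sup>2) / 2 * v * (2 / (1 - w t)\<^sup>2)) (at t)"
    by (simp add: o_def)
  moreover have "(1 - (w t)\<^sup>2) / 2 * v * (2 / (1 - w t)\<^sup>2) = (1 + w t) / (1 - w t) * v"
  proof -
    have "1 - (w t)\<^sup>2 = (1 - w t) * (1 + w t)" by (simp add: power2_eq_square algebra_simps)
    then show ?thesis using assms(2) by (simp add: power2_eq_square)
  qed
  ultimately show ?thesis by simp
qed

lemma has_vector_derivative_inverse_moebius:
  fixes z :: "real \<Rightarrow> complex"
  assumes "(z has_vector_derivative z t * v) (at t)" "z t + 1 \<noteq> 0"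
  shows "((\<lambda>t. (z t - 1) / (z t + 1)) has_vector_derivative (1 - ((z t - 1) / (z t + 1))\<^sup>2) / 2 * v) (at t)"
proof -
  have "((\<lambda>z. (z - 1) / (z + 1)) has_field_derivative 2 / (z t + 1)\<^sup>2) (at (z t))"
    using assms(2) by (auto intro!: derivative_eq_intros simp: power2_eq_square)
  from field_vector_diff_chain_at[OF assms(1) this]
  have "((\<lambda>t. (z t - 1) / (z t + 1)) has_vector_derivative z t * v * (2 / (z t + 1)\<^sup>2)) (at t)"
    by (simp add: o_def)
  moreover have "(1 - ((z t - 1) / (z t + 1))\<^sup>2) / 2 = 2 * z t / (z t + 1)\<^sup>2"
    using assms(2) by (simp add: power_divide divide_simps) (simp add: power2_eq_square algebra_simps)
  ultimately show ?thesis by (simp add: mult_ac)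
qed

lemma has_vector_derivative_Re:
  "(f has_vector_derivative f') net \<Longrightarrow> ((\<lambda>t. Re (f t)) has_vector_derivative Re f') net"
  by (rule bounded_linear.has_vector_derivative[OF bounded_linear_Re])

lemma has_vector_derivative_Im:
  "(f has_vector_derivative f') net \<Longrightarrow> ((\<lambda>t. Im (f t)) has_vector_derivative Im f') net"
  by (rule bounded_linear.has_vector_derivative[OF bounded_linear_Im])

context cascade
begin

abbreviation "V \<equiv> vector_field \<alpha> psi"

text \<open>The common logarithmic growth rate of \<open>x\<close>, \<open>y\<close> and \<open>\<rho>\<close>, beside the rotation about the axis.\<close>

definition radial_rate :: "point \<Rightarrow> real" where
  "radial_rate = (\<lambda>(x, y, z). 2 * pi * \<alpha> * z
     + (1 - x\<^sup>2 - y\<^sup>2 + z\<^sup>2) / (2 * sqrt (x\<^sup>2 + y\<^sup>2)) * F psi x y z)"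

lemma V_regular:
  assumes "(x, y, z) \<notin> S0 \<union> R0"
  shows "V (x, y, z) = (- 2 * pi * y + x * radial_rate (x, y, z), 2 * pi * x + y * radial_rate (x, y, z),
    pi * \<alpha> * (1 - x\<^sup>2 - y\<^sup>2 + z\<^sup>2) - z * sqrt (x\<^sup>2 + y\<^sup>2) * F psi x y z)"
  using assms by (simp add: vector_field_def radial_rate_def algebra_simps)

text \<open>This is where the special form of the system enters: in the variable of
  \<open>cayley\<close> the meridian motion has logarithmic derivative
  \<open>F + 2 * pi * \<alpha> * \<i>\<close>. The real part drives \<tau>, the imaginary part turns
  \<omega> at the constant rate \<alpha>.\<close>

lemma half_plane_field:
  assumes "(x, y, z) \<notin> S0 \<union> R0"
  shows "(1 - (half_plane (x, y, z))\<^sup>2) / 2 * (of_real (F psi x y z) + 2 * pi * \<alpha> * \<i>)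
    = Complex (sqrt (x\<^sup>2 + y\<^sup>2) * radial_rate (x, y, z))
        (pi * \<alpha> * (1 - x\<^sup>2 - y\<^sup>2 + z\<^sup>2) - z * sqrt (x\<^sup>2 + y\<^sup>2) * F psi x y z)"
proof -
  define \<rho> where "\<rho> = sqrt (x\<^sup>2 + y\<^sup>2)"
  have \<rho>: "\<rho> > 0" using Re_half_plane_pos[OF assms] by (simp add: half_plane_def \<rho>_def)
  have \<rho>2: "\<rho>\<^sup>2 = x\<^sup>2 + y\<^sup>2" by (simp add: \<rho>_def)
  have e: "1 - x\<^sup>2 - y\<^sup>2 + z\<^sup>2 = 1 - \<rho>\<^sup>2 + z\<^sup>2" by (simp add: \<rho>2)
  have h: "half_plane (x, y, z) = Complex \<rho> z" by (simp add: half_plane_def \<rho>_def)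
  have "\<rho> * radial_rate (x, y, z) = 2 * pi * \<alpha> * z * \<rho> + (1 - \<rho>\<^sup>2 + z\<^sup>2) / 2 * F psi x y z"
    using \<rho> unfolding radial_rate_def case_prod_conv \<rho>_def[symmetric] e by (simp add: field_simps)
  then show ?thesis
    unfolding h e \<rho>_def[symmetric] by (simp add: complex_eq_iff power2_eq_square field_simps)
qed

lemma chart_curve_derivative:
  fixes \<omega> \<theta> h :: real
  defines "e \<equiv> \<lambda>t. chart (\<omega> + \<alpha> * t) (\<theta> + t) (h + cocycle t \<omega> \<theta>)"
  shows "(e has_vector_derivative V (e t)) (at t)"
proof -
  define k where "k t = h + cocycle t \<omega> \<theta>" for t
  define w where "w t = wcoord (\<omega> + \<alpha> * t) (k t)" for t
  obtain x y z where xyz: "e t = (x, y, z)" by (cases "e t")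
  have reg: "(x, y, z) \<notin> S0 \<union> R0" unfolding xyz[symmetric] e_def by (rule chart_regular)
  define f where "f = exp (k t) * psi_lift (\<omega> + \<alpha> * t) (\<theta> + t)"
  have f: "F psi x y z = f"
    using F_chart[OF xyz[unfolded e_def]] by (simp add: f_def k_def psi_to_circle)
  have k: "(k has_real_derivative psi_lift (\<omega> + \<alpha> * t) (\<theta> + t)) (at t)"
    unfolding k_def using cocycle_has_derivative[of \<omega> \<theta> t] by (auto intro!: derivative_eq_intros)
  \<comment> \<open>The curve is a logarithm of \<open>zcoord\<close>; its derivative is exactly the
    factor in \<open>half_plane_field\<close>.\<close>
  have "((\<lambda>t. of_real (exp (k t)) + \<i> * of_real (2 * pi * (\<omega> + \<alpha> * t) - pi)) has_vector_derivative
      of_real f + \<i> * of_real (2 * pi * \<alpha>)) (at t)"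
  proof (intro has_vector_derivative_add has_vector_derivative_mult_right has_vector_derivative_of_real)
    show "((\<lambda>t. exp (k t)) has_real_derivative f) (at t)"
      unfolding f_def
      using k by (auto intro!: derivative_eq_intros)
    show "((\<lambda>t. 2 * pi * (\<omega> + \<alpha> * t) - pi) has_real_derivative 2 * pi * \<alpha>) (at t)"
      by (auto intro!: derivative_eq_intros)
  qed
  from field_vector_diff_chain_at[OF this DERIV_exp]
  have "((\<lambda>t. zcoord (\<omega> + \<alpha> * t) (k t)) has_vector_derivative
      zcoord (\<omega> + \<alpha> * t) (k t) * (of_real f + 2 * pi * \<alpha> * \<i>)) (at t)"
    by (simp add: o_def zcoord_def exp_add cis_conv_exp exp_of_real mult_ac)
  from has_vector_derivative_inverse_moebius[OF this zcoord_neq(1)]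
  have "(w has_vector_derivative (1 - (w t)\<^sup>2) / 2 * (of_real f + 2 * pi * \<alpha> * \<i>)) (at t)"
    unfolding w_def[abs_def] wcoord_def .
  also have "w t = half_plane (x, y, z)"
    unfolding xyz[symmetric] e_def half_plane_chart w_def k_def ..
  also note half_plane_field[OF reg, unfolded f]
  finally have w: "(w has_vector_derivative Complex (sqrt (x\<^sup>2 + y\<^sup>2) * radial_rate (x, y, z))
        (pi * \<alpha> * (1 - x\<^sup>2 - y\<^sup>2 + z\<^sup>2) - z * sqrt (x\<^sup>2 + y\<^sup>2) * f)) (at t)" .
  have e_eq: "e = (\<lambda>t. (Re (w t) * cos (2 * pi * (\<theta> + t)), Re (w t) * sin (2 * pi * (\<theta> + t)), Im (w t)))"
    by (simp add: e_def chart_def w_def k_def)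
  have comp: "x = Re (w t) * cos (2 * pi * (\<theta> + t))" "y = Re (w t) * sin (2 * pi * (\<theta> + t))" "z = Im (w t)"
    using xyz by (simp_all add: e_eq)
  have rho: "sqrt (x\<^sup>2 + y\<^sup>2) = Re (w t)"
    using \<open>w t = half_plane (x, y, z)\<close> by (simp add: half_plane_def)
  note Re' = has_vector_derivative_Re[OF w, unfolded has_real_derivative_iff_has_vector_derivative[symmetric]]
  have "((\<lambda>t. Re (w t) * cos (2 * pi * (\<theta> + t))) has_vector_derivative - 2 * pi * y + x * radial_rate (x, y, z)) (at t)"
    unfolding has_real_derivative_iff_has_vector_derivative[symmetric]
    by (rule derivative_eq_intros Re' refl)+ (simp add: comp(1,2)[symmetric] rho, simp add: comp)
  moreover have "((\<lambda>t. Re (w t) * sin (2 * pi * (\<theta> + t))) has_vector_derivative 2 * pi * x + y * radial_rate (x, y, z)) (at t)"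
    unfolding has_real_derivative_iff_has_vector_derivative[symmetric]
    by (rule derivative_eq_intros Re' refl)+ (simp add: comp(1,2)[symmetric] rho, simp add: comp)
  moreover note has_vector_derivative_Im[OF w]
  ultimately have "(e has_vector_derivative (- 2 * pi * y + x * radial_rate (x, y, z),
      2 * pi * x + y * radial_rate (x, y, z),
      pi * \<alpha> * (1 - x\<^sup>2 - y\<^sup>2 + z\<^sup>2) - z * sqrt (x\<^sup>2 + y\<^sup>2) * f)) (at t)"
    unfolding e_eq by (intro has_vector_derivative_Pair) simp_all
  then show ?thesis unfolding xyz V_regular[OF reg] f .
qed

lemma regular_curve_derivatives:
  assumes "(u has_vector_derivative V (u t)) (at t)" "u t = (x, y, z)" "u t \<notin> S0 \<union> R0"
  shows "((\<lambda>t. cmod (horiz (u t))) has_vector_derivative cmod (horiz (u t)) * radial_rate (u t)) (at t)"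
    and "((\<lambda>t. horiz (u t)) has_vector_derivative horiz (u t) * (radial_rate (u t) + 2 * pi * \<i>)) (at t)"
    and "((\<lambda>t. cayley (u t)) has_vector_derivative
      cayley (u t) * (of_real (F psi x y z) + 2 * pi * \<alpha> * \<i>)) (at t)"
proof -
  define X Y Z where "X t = fst (u t)" and "Y t = fst (snd (u t))" and "Z t = snd (snd (u t))" for t
  note reg = assms(3)[unfolded assms(2)]
  have val: "X t = x" "Y t = y" "Z t = z" using assms(2) by (simp_all add: X_def Y_def Z_def)
  have "(X has_vector_derivative fst (V (u t))) (at t)" "(Y has_vector_derivative fst (snd (V (u t)))) (at t)"
    "(Z has_vector_derivative snd (snd (V (u t)))) (at t)"
    unfolding X_def Y_def Z_def
    by (intro bounded_linear.has_vector_derivative[OF bounded_linear_fst]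
        bounded_linear.has_vector_derivative[OF bounded_linear_snd] assms(1))+
  then have X: "(X has_real_derivative - 2 * pi * y + x * radial_rate (x, y, z)) (at t)"
    and Y: "(Y has_real_derivative 2 * pi * x + y * radial_rate (x, y, z)) (at t)"
    and Z: "(Z has_real_derivative pi * \<alpha> * (1 - x\<^sup>2 - y\<^sup>2 + z\<^sup>2) - z * sqrt (x\<^sup>2 + y\<^sup>2) * F psi x y z) (at t)"
    unfolding has_real_derivative_iff_has_vector_derivative assms(2) V_regular[OF reg] by simp_all
  have rho_eq: "cmod (horiz (u t)) = sqrt ((X t)\<^sup>2 + (Y t)\<^sup>2)" for t
    by (cases "u t") (simp add: horiz_def X_def Y_def cmod_def)
  have pos: "sqrt (x\<^sup>2 + y\<^sup>2) > 0" "x\<^sup>2 + y\<^sup>2 > 0"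
    using Re_half_plane_pos[OF reg] by (simp_all add: half_plane_def)
  have rho: "((\<lambda>t. sqrt ((X t)\<^sup>2 + (Y t)\<^sup>2)) has_real_derivative sqrt (x\<^sup>2 + y\<^sup>2) * radial_rate (x, y, z)) (at t)"
  proof -
    have "((\<lambda>t. (X t)\<^sup>2 + (Y t)\<^sup>2) has_real_derivative 2 * ((x\<^sup>2 + y\<^sup>2) * radial_rate (x, y, z))) (at t)"
      by (rule DERIV_cong[OF DERIV_add[OF DERIV_power[OF X] DERIV_power[OF Y]]])
        (simp add: val power2_eq_square algebra_simps)
    moreover have "(sqrt has_real_derivative inverse (sqrt (x\<^sup>2 + y\<^sup>2)) / 2) (at ((X t)\<^sup>2 + (Y t)\<^sup>2))"
      unfolding val by (rule DERIV_real_sqrt) (rule pos(2))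
    ultimately have "((\<lambda>t. sqrt ((X t)\<^sup>2 + (Y t)\<^sup>2)) has_real_derivative
        inverse (sqrt (x\<^sup>2 + y\<^sup>2)) / 2 * (2 * ((x\<^sup>2 + y\<^sup>2) * radial_rate (x, y, z)))) (at t)"
      by (intro DERIV_chain2[where f = sqrt and g = "\<lambda>t. (X t)\<^sup>2 + (Y t)\<^sup>2"])
    also have "inverse (sqrt (x\<^sup>2 + y\<^sup>2)) / 2 * (2 * ((x\<^sup>2 + y\<^sup>2) * radial_rate (x, y, z)))
        = (x\<^sup>2 + y\<^sup>2) / sqrt (x\<^sup>2 + y\<^sup>2) * radial_rate (x, y, z)"
      by (simp only: divide_inverse) simp
    also have "(x\<^sup>2 + y\<^sup>2) / sqrt (x\<^sup>2 + y\<^sup>2) = sqrt (x\<^sup>2 + y\<^sup>2)"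
      by (rule real_div_sqrt) (use pos(2) in linarith)
    finally show ?thesis .
  qed
  then show "((\<lambda>t. cmod (horiz (u t))) has_vector_derivative cmod (horiz (u t)) * radial_rate (u t)) (at t)"
    unfolding has_real_derivative_iff_has_vector_derivative rho_eq by (simp add: val assms(2))
  have horiz_eq: "horiz (u t) = of_real (X t) + \<i> * of_real (Y t)" for t
    by (cases "u t") (simp add: horiz_def X_def Y_def complex_eq_iff)
  have "((\<lambda>t. of_real (X t) + \<i> * of_real (Y t)) has_vector_derivative
      of_real (- 2 * pi * y + x * radial_rate (x, y, z)) + \<i> * of_real (2 * pi * x + y * radial_rate (x, y, z))) (at t)"
    by (intro has_vector_derivative_add has_vector_derivative_mult_right has_vector_derivative_of_real
X Y)
  then show "((\<lambda>t. horiz (u t)) has_vector_derivative horiz (u t) * (radial_rate (u t) + 2 * pi * \<i>)) (at t)"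
    unfolding horiz_eq
    by (rule has_vector_derivative_eq_rhs) (simp add: val assms(2) complex_eq_iff algebra_simps)
  have hp_eq: "half_plane (u t) = of_real (sqrt ((X t)\<^sup>2 + (Y t)\<^sup>2)) + \<i> * of_real (Z t)" for t
    by (cases "u t") (simp add: half_plane_def X_def Y_def Z_def complex_eq_iff)
  have "((\<lambda>t. half_plane (u t)) has_vector_derivative of_real (sqrt (x\<^sup>2 + y\<^sup>2) * radial_rate (x, y, z))
      + \<i> * of_real (pi * \<alpha> * (1 - x\<^sup>2 - y\<^sup>2 + z\<^sup>2) - z * sqrt (x\<^sup>2 + y\<^sup>2) * F psi x y z)) (at t)"
    unfolding hp_eq
    by (intro has_vector_derivative_add has_vector_derivative_mult_right has_vector_derivative_of_real
rho Z)
  then have hp: "((\<lambda>t. half_plane (u t)) has_vector_derivative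
      (1 - (half_plane (u t))\<^sup>2) / 2 * (of_real (F psi x y z) + 2 * pi * \<alpha> * \<i>)) (at t)"
    unfolding assms(2) half_plane_field[OF reg]
    by (rule has_vector_derivative_eq_rhs) (simp add: complex_eq_iff)
  show "((\<lambda>t. cayley (u t)) has_vector_derivative
      cayley (u t) * (of_real (F psi x y z) + 2 * pi * \<alpha> * \<i>)) (at t)"
    using has_vector_derivative_moebius[OF hp] assms(3) singular_iff[of "u t"] by (simp add: cayley_def)
qed

section \<open>Uniqueness of solutions off the singular set\<close>

lemma constant_on_interval:
  fixes f :: "real \<Rightarrow> 'a::real_normed_vector"
  assumes "is_interval J" "\<And>t. t \<in> J \<Longrightarrow> (f has_vector_derivative 0) (at t)" "s \<in> J" "t \<in> J"
  shows "f t = f s"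
proof -
  obtain c where "\<And>t. t \<in> J \<Longrightarrow> f t = c"
    using has_vector_derivative_zero_constant[of J f] assms(1,2)
    by (metis has_vector_derivative_at_within is_interval_convex)
  then show ?thesis using assms by simp
qed

text \<open>Only continuity of \<open>psi\<close> is at hand, so no Lipschitz argument applies.
  Instead the skew product is solved from the base upwards: constants of motion fix the arguments of
  \<open>cayley\<close> and \<open>horiz\<close>, and the height then follows by integrating a known
  function of time.\<close>

lemma local_uniqueness:
  fixes \<omega> \<theta> h :: real
  defines "e \<equiv> \<lambda>t. chart (\<omega> + \<alpha> * t) (\<theta> + t) (h + cocycle t \<omega> \<theta>)"
  assumes J: "is_interval J" and s: "s \<in> J" "u s = e s" and t: "t \<in> J"
    and u: "\<And>t. t \<in> J \<Longrightarrow> (u has_vector_derivative V (u t)) (at t)"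
    and reg: "\<And>t. t \<in> J \<Longrightarrow> u t \<notin> S0 \<union> R0"
  shows "u t = e t"
proof -
  define f where "f t = (case u t of (x, y, z) \<Rightarrow> F psi x y z)" for t
  define \<tau> where "\<tau> t = ln (cmod (cayley (u t)))" for t
  have cay: "((\<lambda>t. cayley (u t)) has_vector_derivative cayley (u t) * (of_real (f t) + 2 * pi * \<alpha> * \<i>)) (at t)"
    if "t \<in> J" for t
    using regular_curve_derivatives(3)[OF u[OF that] _ reg[OF that]] by (cases "u t") (simp add: f_def)
  have norm_gt: "cmod (cayley (u t)) > 1" if "t \<in> J" for t
    by (rule norm_cayley_gt_1[OF reg[OF that]])
  have tau: "(\<tau> has_real_derivative f t) (at t)" if "t \<in> J" for t
  proof -
    \<comment> \<open>The squared modulus is a polynomial in real and imaginary part, and half its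
      logarithm is \<open>\<tau>\<close>.\<close>
    define N where "N t = (Re (cayley (u t)))\<^sup>2 + (Im (cayley (u t)))\<^sup>2" for t
    have N: "N t = (cmod (cayley (u t)))\<^sup>2" for t by (simp add: N_def cmod_power2)
    note Re' = has_vector_derivative_Re[OF cay[OF that], unfolded has_real_derivative_iff_has_vector_derivative[symmetric]]
    note Im' = has_vector_derivative_Im[OF cay[OF that], unfolded has_real_derivative_iff_has_vector_derivative[symmetric]]
    have N': "(N has_real_derivative 2 * f t * N t) (at t)"
      unfolding N_def
      by (rule derivative_eq_intros Re' Im' refl)+ (simp add: power2_eq_square algebra_simps)
    have "N t > 0" using norm_gt[OF that] unfolding N by (intro zero_less_power) linarith
    with N' have "((\<lambda>t. ln (N t) / 2) has_real_derivative f t) (at t)"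
      by (auto intro!: derivative_eq_intros)
    moreover have "ln (N t) / 2 = \<tau> t" for t
      unfolding N \<tau>_def by (cases "cayley (u t) = 0") (simp_all add: ln_realpow)
    ultimately show ?thesis by simp
  qed
  have tau_pos: "\<tau> t > 0" if "t \<in> J" for t unfolding \<tau>_def by (rule ln_gt_zero[OF norm_gt[OF that]])
  \<comment> \<open>Removing the modulus and the uniform rotation at rate \<alpha> leaves a
    constant.\<close>
  define E where "E t = cayley (u t) * exp (- (of_real (\<tau> t) + \<i> * of_real (2 * pi * \<alpha> * t)))" for t
  have "(E has_vector_derivative 0) (at t)" if "t \<in> J" for t
  proof -
    have "((\<lambda>t. - (of_real (\<tau> t) + \<i> * of_real (2 * pi * \<alpha> * t))) has_vector_derivative
        - (of_real (f t) + \<i> * of_real (2 * pi * \<alpha>))) (at t)"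
    proof (intro has_vector_derivative_minus has_vector_derivative_add has_vector_derivative_mult_right has_vector_derivative_of_real)
      show "(\<tau> has_real_derivative f t) (at t)" by (rule tau[OF that])
      show "((\<lambda>t. 2 * pi * \<alpha> * t) has_real_derivative 2 * pi * \<alpha>) (at t)"
        by (auto intro!: derivative_eq_intros)
    qed
    note field_vector_diff_chain_at[OF this DERIV_exp, unfolded o_def]
    from has_vector_derivative_mult[OF cay[OF that] this] show ?thesis
      unfolding E_def by (rule has_vector_derivative_eq_rhs) (simp add: algebra_simps)
  qed
  then have E: "E t = E s" if "t \<in> J" for t using constant_on_interval[OF J _ s(1) that] by blast
  have cay_s: "cayley (u s) = zcoord (\<omega> + \<alpha> * s) (h + cocycle s \<omega> \<theta>)"
    unfolding s(2) e_def by (rule cayley_chart)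
  have tau_s: "\<tau> s = exp (h + cocycle s \<omega> \<theta>)"
    by (simp add: \<tau>_def cay_s norm_zcoord)
  have E_s: "E s = exp (\<i> * of_real (2 * pi * \<omega> - pi))"
    unfolding E_def cay_s tau_s zcoord_def cis_conv_exp exp_of_real[symmetric] exp_add[symmetric]
    by (rule arg_cong[where f = exp]) (simp add: algebra_simps)
  have cay_t: "cayley (u t) = of_real (exp (\<tau> t)) * cis (2 * pi * (\<omega> + \<alpha> * t) - pi)" if "t \<in> J" for t
  proof -
    have "cayley (u t) = E t * exp (of_real (\<tau> t) + \<i> * of_real (2 * pi * \<alpha> * t))"
      by (simp add: E_def mult.assoc exp_add[symmetric])
    also have "\<dots> = exp (\<i> * of_real (2 * pi * \<omega> - pi)) * exp (of_real (\<tau> t) + \<i> * of_real (2 * pi * \<alpha> * t))"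
      by (simp only: E[OF that] E_s)
    also have "\<dots> = of_real (exp (\<tau> t)) * cis (2 * pi * (\<omega> + \<alpha> * t) - pi)"
      unfolding cis_conv_exp exp_of_real[symmetric] exp_add[symmetric]
      by (rule arg_cong[where f = exp]) (simp add: algebra_simps)
    finally show ?thesis .
  qed
  \<comment> \<open>The same for the angle about the axis: the radial factor of the field cancels
    after normalisation, leaving rotation at rate 1.\<close>
  define D where "D t = horiz (u t) / of_real (cmod (horiz (u t))) * exp (- (\<i> * of_real (2 * pi * t)))" for t
  have rho_pos: "cmod (horiz (u t)) > 0" if "t \<in> J" for t
    using Re_half_plane_pos[OF reg[OF that]] by (simp only: norm_horiz)
  have "(D has_vector_derivative 0) (at t)" if "t \<in> J" for t
  proof -
    obtain x y z where xyz: "u t = (x, y, z)" by (cases "u t")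
    note d = regular_curve_derivatives(1,2)[OF u[OF that] xyz reg[OF that]]
    note inv = field_vector_diff_chain_at[OF has_vector_derivative_of_real[OF d(1)[folded has_real_derivative_iff_has_vector_derivative]] DERIV_inverse, unfolded o_def]
    have "((\<lambda>t. - (\<i> * of_real (2 * pi * t))) has_vector_derivative - (\<i> * of_real (2 * pi))) (at t)"
    proof (intro has_vector_derivative_minus has_vector_derivative_mult_right has_vector_derivative_of_real)
      show "((\<lambda>t. 2 * pi * t) has_real_derivative 2 * pi) (at t)"
        by (auto intro!: derivative_eq_intros)
    qed
    note ex = field_vector_diff_chain_at[OF this DERIV_exp, unfolded o_def]
    have "of_real (cmod (horiz (u t))) \<noteq> (0::complex)" using rho_pos[OF that] by simp
    then show ?thesis
      unfolding D_def divide_inverse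
      by (intro has_vector_derivative_eq_rhs[OF has_vector_derivative_mult[OF has_vector_derivative_mult[OF d(2) inv] ex]])
        (auto simp: field_simps power2_eq_square)
  qed
  then have D: "D t = D s" if "t \<in> J" for t using constant_on_interval[OF J _ s(1) that] by blast
  have D_s: "D s = exp (\<i> * of_real (2 * pi * \<theta>))"
  proof -
    have "D s = cis (2 * pi * (\<theta> + s)) * exp (- (\<i> * of_real (2 * pi * s)))"
      using Re_wcoord_pos[of "\<omega> + \<alpha> * s" "h + cocycle s \<omega> \<theta>"]
      by (simp add: D_def s(2) e_def horiz_chart norm_mult)
    then show ?thesis
      unfolding cis_conv_exp exp_add[symmetric] by (simp add: algebra_simps)
  qed
  have horiz_t: "horiz (u t) = of_real (cmod (horiz (u t))) * cis (2 * pi * (\<theta> + t))" if "t \<in> J" for t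
  proof -
    have "horiz (u t) = of_real (cmod (horiz (u t))) * (D t * exp (\<i> * of_real (2 * pi * t)))"
      using rho_pos[OF that] by (simp add: D_def mult.assoc exp_add[symmetric])
    also have "D t * exp (\<i> * of_real (2 * pi * t)) = cis (2 * pi * (\<theta> + t))"
      unfolding D[OF that] D_s cis_conv_exp exp_add[symmetric] by (simp add: algebra_simps)
    finally show ?thesis .
  qed
  \<comment> \<open>Both angles are known by now, so \<open>psi\<close> is evaluated along the
    explicit base orbit and the derivative of \<open>ln \<tau>\<close> no longer depends on the
    solution.\<close>
  have f_eq: "f t = \<tau> t * psi_lift (\<omega> + \<alpha> * t) (\<theta> + t)" if "t \<in> J" for t
  proof -
    obtain x y z where xyz: "u t = (x, y, z)" by (cases "u t")
    have "F psi x y z = \<tau> t * psi (omega_coord x y z, theta_coord x y)"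
      using F_eq[of x y z psi] reg[OF that] by (simp add: xyz \<tau>_def)
    moreover have "omega_coord x y z = to_circle (\<omega> + \<alpha> * t)"
      using cay_t[OF that] by (intro omega_coord_eq[where r = "exp (\<tau> t)"]) (simp_all add: xyz)
    moreover have "theta_coord x y = to_circle (\<theta> + t)"
      using horiz_t[OF that] rho_pos[OF that]
      by (intro theta_coord_eq[where r = "cmod (horiz (u t))"]) (simp_all add: xyz horiz_def)
    ultimately show ?thesis by (simp add: f_def xyz psi_to_circle)
  qed
  have "((\<lambda>t. ln (\<tau> t) - cocycle t \<omega> \<theta>) has_vector_derivative 0) (at t)" if "t \<in> J" for t
    unfolding has_real_derivative_iff_has_vector_derivative[symmetric]
    using tau[OF that] tau_pos[OF that] cocycle_has_derivative[of \<omega> \<theta> t]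
    by (auto intro!: derivative_eq_intros simp: f_eq[OF that])
  from constant_on_interval[OF J this s(1) t]
  have "ln (\<tau> t) = h + cocycle t \<omega> \<theta>" by (simp add: tau_s)
  then have "\<tau> t = exp (h + cocycle t \<omega> \<theta>)" using tau_pos[OF t] by (metis exp_ln)
  then show ?thesis
    unfolding e_def using cay_t[OF t] horiz_t[OF t] rho_pos[OF t]
    by (intro chart_eqI[where r = "cmod (horiz (u t))"]) (simp_all add: zcoord_def)
qed

text \<open>A solution could a priori run into \<open>S0 \<union> R0\<close>, where
  \<open>local_uniqueness\<close> is silent. The set of times of agreement is closed by continuity.
  It is open because the explicit curve is regular, so \<open>u\<close> is regular near each such
  time; connectedness of \<open>I\<close> finishes.\<close>

lemma solution_unique:
  assumes "solution_on V I u (chart \<omega> \<theta> h)" "t \<in> I"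
  shows "u t = chart (\<omega> + \<alpha> * t) (\<theta> + t) (h + cocycle t \<omega> \<theta>)"
proof -
  define e where "e t = chart (\<omega> + \<alpha> * t) (\<theta> + t) (h + cocycle t \<omega> \<theta>)" for t
  have I: "open I" "is_interval I" "0 \<in> I" "u 0 = chart \<omega> \<theta> h"
    and u: "\<And>t. t \<in> I \<Longrightarrow> (u has_vector_derivative V (u t)) (at t)"
    using assms by (auto simp: solution_on_def)
  have cu: "continuous_on I u"
    using u has_vector_derivative_continuous by (blast intro: continuous_at_imp_continuous_on)
  have ce: "continuous_on I e"
    using chart_curve_derivative has_vector_derivative_continuous
    unfolding e_def by (blast intro: continuous_at_imp_continuous_on)
  let ?A = "{t \<in> I. u t = e t}"
  have "closedin (top_of_set I) {t \<in> I. u t - e t = 0}"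
    by (intro continuous_closedin_preimage_constant continuous_intros cu ce)
  then have "closedin (top_of_set I) ?A" by simp
  moreover have "openin (top_of_set I) ?A"
  proof -
    have "\<exists>\<epsilon>>0. ball s \<epsilon> \<subseteq> ?A" if s: "s \<in> ?A" for s
    proof -
      have "open (I \<inter> u -` (- (S0 \<union> R0)))"
        by (intro continuous_open_preimage cu I) (rule open_Compl[OF closed_singular])
      moreover have "s \<in> I \<inter> u -` (- (S0 \<union> R0))" using s chart_regular by (auto simp: e_def)
      ultimately obtain \<epsilon> where \<epsilon>: "\<epsilon> > 0" "ball s \<epsilon> \<subseteq> I \<inter> u -` (- (S0 \<union> R0))"
        by (meson openE)
      have "u t = e t" if "t \<in> ball s \<epsilon>" for t
        unfolding e_def
      proof (rule local_uniqueness[of "ball s \<epsilon>" s])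
        show "is_interval (ball s \<epsilon>)" by (simp add: is_interval_convex_1)
      qed (use \<epsilon> s u that in \<open>auto simp: e_def\<close>)
      then show ?thesis using \<epsilon> by auto
    qed
    then have "open ?A" by (subst open_contains_ball) blast
    then show ?thesis using I(1) by (simp add: openin_open_eq)
  qed
  moreover have "0 \<in> ?A" using I(3,4) by (simp add: e_def)
  moreover have "connected I" using I(2) by (rule is_interval_connected)
  ultimately have "?A = I" unfolding connected_clopen by blast
  then show ?thesis using assms(2) by (auto simp: e_def)
qed

end

section \<open>Limit sets, density and transitivity\<close>

text \<open>Used to reach a prescribed limit point: \<open>\<beta> = 1\<close> fixes the angle
  \<theta> modulo 1, \<open>\<beta> = \<alpha>\<close> fixes \<omega>. One statement serves both
  time directions.\<close>

lemma residue_times: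
  fixes \<beta> a :: real
  assumes "\<beta> > 0" "L = at_top \<or> L = at_bot"
  obtains \<tau> :: "nat \<Rightarrow> real" and m :: "nat \<Rightarrow> int"
  where "filterlim \<tau> L sequentially" "\<And>n. \<beta> * \<tau> n = a + of_int (m n)"
proof -
  define s :: int where "s = (if L = at_top then 1 else - 1)"
  let ?\<tau> = "\<lambda>n. (a + of_int (s * int n)) / \<beta>"
  have "filterlim ?\<tau> L sequentially"
  proof (cases "L = at_top")
    case True
    have "filterlim (\<lambda>n. inverse \<beta> * (a + real n)) at_top sequentially"
      using assms(1) by (intro filterlim_tendsto_pos_mult_at_top[OF tendsto_const]
          filterlim_tendsto_add_at_top[OF tendsto_const] filterlim_real_sequentially) auto
    then show ?thesis using True by (simp add: s_def divide_inverse mult.commute)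
  next
    case False
    have "filterlim (\<lambda>n. inverse \<beta> * (- a + real n)) at_top sequentially"
      using assms(1) by (intro filterlim_tendsto_pos_mult_at_top[OF tendsto_const]
          filterlim_tendsto_add_at_top[OF tendsto_const] filterlim_real_sequentially) auto
    then have "filterlim (\<lambda>n. - (inverse \<beta> * (- a + real n))) at_bot sequentially"
      by (simp only: filterlim_uminus_at_bot minus_minus)
    moreover have "- (inverse \<beta> * (- a + real n)) = (a + of_int (s * int n)) / \<beta>" for n
      using False by (simp add: s_def divide_inverse algebra_simps)
    ultimately show ?thesis using False assms(2) by simp
  qed
  moreover have "\<beta> * ?\<tau> n = a + of_int (s * int n)" for n using assms(1) by simp
  ultimately show thesis by (rule that)
qed

section \<open>Limit sets of chart curves whose height tends to plus or minus infinity\<close>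

lemma half_plane_eq_1_iff: "half_plane P = 1 \<longleftrightarrow> P \<in> S0"
  by (cases P) (auto simp: S0_def half_plane_def complex_eq_iff)

lemma Re_half_plane_eq_0_iff: "Re (half_plane P) = 0 \<longleftrightarrow> P \<in> R0"
  by (cases P) (auto simp: R0_def half_plane_def sum_power2_eq_zero_iff)

lemma tendsto_half_plane: "(u \<longlongrightarrow> P) G \<Longrightarrow> ((\<lambda>n. half_plane (u n)) \<longlongrightarrow> half_plane P) G"
proof -
  have "continuous_on UNIV half_plane"
  proof -
    have eq: "half_plane = (\<lambda>P. of_real (sqrt ((fst P)\<^sup>2 + (fst (snd P))\<^sup>2)) + \<i> * of_real (snd (snd P)))"
      by (auto simp: half_plane_def complex_eq_iff)
    show ?thesis unfolding eq by (intro continuous_intros)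
  qed
  then show "(u \<longlongrightarrow> P) G \<Longrightarrow> ((\<lambda>n. half_plane (u n)) \<longlongrightarrow> half_plane P) G"
    by (rule continuous_on_tendsto_compose) auto
qed

lemma wcoord_tendsto_1:
  assumes "filterlim k at_top G"
  shows "((\<lambda>n. wcoord (f n) (k n)) \<longlongrightarrow> 1) G"
proof -
  have bound: "norm (wcoord w h - 1) \<le> 2 / (exp (exp h) - 1)" for w h
  proof -
    have "wcoord w h - 1 = - 2 / (zcoord w h + 1)"
      using zcoord_neq[of w h] by (simp add: wcoord_def field_simps)
    then have "norm (wcoord w h - 1) = 2 / cmod (zcoord w h + 1)" by (simp add: norm_divide)
    also have "\<dots> \<le> 2 / (exp (exp h) - 1)"
    proof (rule frac_le)
      show "exp (exp h) - 1 \<le> cmod (zcoord w h + 1)"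
        using norm_triangle_ineq2[of "zcoord w h" "-1"] by (simp add: norm_zcoord)
    qed simp_all
    finally show ?thesis .
  qed
  have lim: "((\<lambda>n. 2 / (exp (exp (k n)) - 1)) \<longlongrightarrow> 0) G"
  proof -
    have "filterlim (\<lambda>n. - 1 + exp (exp (k n))) at_top G"
      by (rule filterlim_tendsto_add_at_top[OF tendsto_const filterlim_compose[OF exp_at_top filterlim_compose[OF exp_at_top assms]]])
    from filterlim_at_top_imp_at_infinity[OF this]
    have "filterlim (\<lambda>n. exp (exp (k n)) - 1) at_infinity G"
      by (simp only: uminus_add_conv_diff)
    then show ?thesis by (rule tendsto_divide_0[OF tendsto_const])
  qed
  have "((\<lambda>n. wcoord (f n) (k n) - 1) \<longlongrightarrow> 0) G"
    by (rule Lim_null_comparison[OF always_eventually lim]) (intro allI bound)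
  then show ?thesis by (rule LIM_zero_cancel)
qed

text \<open>For large height the half-plane point tends to 1 whatever \<omega> does. Only \<theta>
  survives, and each point of the circle is reached along times with \<theta> constant modulo
  1.\<close>

lemma limit_set_S0:
  fixes \<alpha> \<omega> \<theta> :: real and k :: "real \<Rightarrow> real"
  assumes L: "L = at_top \<or> L = at_bot" and k: "filterlim k at_top L"
  shows "{q. \<exists>\<tau> :: nat \<Rightarrow> real. filterlim \<tau> L sequentially \<and>
    (\<lambda>n. chart (\<omega> + \<alpha> * \<tau> n) (\<theta> + \<tau> n) (k (\<tau> n))) \<longlonglongrightarrow> q} = S0"
proof (intro equalityI subsetI)
  fix q
  assume "q \<in> {q. \<exists>\<tau> :: nat \<Rightarrow> real. filterlim \<tau> L sequentially \<and>
    (\<lambda>n. chart (\<omega> + \<alpha> * \<tau> n) (\<theta> + \<tau> n) (k (\<tau> n))) \<longlonglongrightarrow> q}"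
  then obtain \<tau> where \<tau>: "filterlim \<tau> L sequentially"
    "(\<lambda>n. chart (\<omega> + \<alpha> * \<tau> n) (\<theta> + \<tau> n) (k (\<tau> n))) \<longlonglongrightarrow> q" by blast
  from tendsto_half_plane[OF \<tau>(2)] wcoord_tendsto_1[OF filterlim_compose[OF k \<tau>(1)]]
  have "half_plane q = 1"
    unfolding half_plane_chart by (rule LIMSEQ_unique)
  then show "q \<in> S0" by (simp add: half_plane_eq_1_iff)
next
  fix q assume "q \<in> S0"
  then obtain x y where q: "q = (x, y, 0)" "x\<^sup>2 + y\<^sup>2 = 1" by (auto simp: S0_def)
  have n1: "cmod (Complex x y) = 1" using q(2) by (simp add: cmod_def)
  then have "Complex x y \<noteq> 0" by auto
  from polar_turns[OF this] n1 obtain b where "Complex x y = cis (2 * pi * b)" by auto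
  then have b: "x = cos (2 * pi * b)" "y = sin (2 * pi * b)" by (simp_all add: complex_eq_iff)
  obtain \<tau> m where \<tau>: "filterlim \<tau> L sequentially" "\<And>n. 1 * \<tau> n = (b - \<theta>) + of_int (m n)"
    using residue_times[OF zero_less_one L] by blast
  have "\<theta> + \<tau> n = b + of_int (m n)" for n using \<tau>(2)[of n] by simp
  then have "chart (\<omega> + \<alpha> * \<tau> n) (\<theta> + \<tau> n) (k (\<tau> n)) = (Re (wcoord (\<omega> + \<alpha> * \<tau> n) (k (\<tau> n))) * x,
      Re (wcoord (\<omega> + \<alpha> * \<tau> n) (k (\<tau> n))) * y, Im (wcoord (\<omega> + \<alpha> * \<tau> n) (k (\<tau> n))))" for n
    by (simp only: chart_def cos_int_shift sin_int_shift b)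
  moreover have "(\<lambda>n. (Re (wcoord (\<omega> + \<alpha> * \<tau> n) (k (\<tau> n))) * x,
      Re (wcoord (\<omega> + \<alpha> * \<tau> n) (k (\<tau> n))) * y, Im (wcoord (\<omega> + \<alpha> * \<tau> n) (k (\<tau> n)))))
      \<longlonglongrightarrow> (Re 1 * x, Re 1 * y, Im 1)"
    by (intro tendsto_intros wcoord_tendsto_1 filterlim_compose[OF k \<tau>(1)])
  ultimately have "(\<lambda>n. chart (\<omega> + \<alpha> * \<tau> n) (\<theta> + \<tau> n) (k (\<tau> n))) \<longlonglongrightarrow> q" by (simp add: q)
  with \<tau>(1) show "q \<in> {q. \<exists>\<tau> :: nat \<Rightarrow> real. filterlim \<tau> L sequentially \<and>
    (\<lambda>n. chart (\<omega> + \<alpha> * \<tau> n) (\<theta> + \<tau> n) (k (\<tau> n))) \<longlonglongrightarrow> q}" by blast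
qed

text \<open>Here \<omega> survives and \<theta> does not, since the distance to the axis tends to 0
  along the chosen times. The half-plane point may be unbounded in general, because
  \<open>z = -1\<close> corresponds to infinity.\<close>

lemma limit_set_R0:
  fixes \<alpha> \<omega> \<theta> :: real and k :: "real \<Rightarrow> real"
  assumes "\<alpha> > 0" and L: "L = at_top \<or> L = at_bot" and k: "filterlim k at_bot L"
  shows "{q. \<exists>\<tau> :: nat \<Rightarrow> real. filterlim \<tau> L sequentially \<and>
    (\<lambda>n. chart (\<omega> + \<alpha> * \<tau> n) (\<theta> + \<tau> n) (k (\<tau> n))) \<longlonglongrightarrow> q} = R0"
proof -
  have e: "((\<lambda>h. exp (exp h)) \<longlongrightarrow> (1::real)) at_bot"
    using tendsto_exp[OF exp_at_bot] by simp
  have norms: "(\<lambda>n. exp (exp (k (\<tau> n)))) \<longlonglongrightarrow> 1" if "filterlim \<tau> L sequentially" for \<tau> :: "nat \<Rightarrow> real"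
    by (rule filterlim_compose[OF e filterlim_compose[OF k that]])
  show ?thesis
  proof (intro equalityI subsetI)
    fix q
    assume "q \<in> {q. \<exists>\<tau> :: nat \<Rightarrow> real. filterlim \<tau> L sequentially \<and>
      (\<lambda>n. chart (\<omega> + \<alpha> * \<tau> n) (\<theta> + \<tau> n) (k (\<tau> n))) \<longlonglongrightarrow> q}"
    then obtain \<tau> where \<tau>: "filterlim \<tau> L sequentially"
      "(\<lambda>n. chart (\<omega> + \<alpha> * \<tau> n) (\<theta> + \<tau> n) (k (\<tau> n))) \<longlonglongrightarrow> q" by blast
    define w where "w n = wcoord (\<omega> + \<alpha> * \<tau> n) (k (\<tau> n))" for n
    have w: "w \<longlonglongrightarrow> half_plane q"
      using tendsto_half_plane[OF \<tau>(2)] unfolding half_plane_chart w_def .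
    \<comment> \<open>Written without division, the relation passes to the limit and makes
      \<open>half_plane q\<close> equidistant from 1 and -1, that is, purely imaginary.\<close>
    have eq: "cmod (1 + w n) = exp (exp (k (\<tau> n))) * cmod (1 - w n)" for n
    proof -
      have "1 + w n = zcoord (\<omega> + \<alpha> * \<tau> n) (k (\<tau> n)) * (1 - w n)"
        using wcoord_inverse[of "\<omega> + \<alpha> * \<tau> n" "k (\<tau> n)"] wcoord_neq_1[of "\<omega> + \<alpha> * \<tau> n" "k (\<tau> n)"]
        by (simp add: w_def field_simps)
      then show ?thesis by (simp only: norm_mult norm_zcoord)
    qed
    have "(\<lambda>n. cmod (1 + w n)) \<longlonglongrightarrow> cmod (1 + half_plane q)" by (intro tendsto_intros w)
    moreover have "(\<lambda>n. exp (exp (k (\<tau> n))) * cmod (1 - w n)) \<longlonglongrightarrow> 1 * cmod (1 - half_plane q)"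
      by (intro tendsto_intros w norms \<tau>)
    ultimately have "cmod (1 + half_plane q) = 1 * cmod (1 - half_plane q)"
      unfolding eq by (rule LIMSEQ_unique)
    then have "(cmod (1 + half_plane q))\<^sup>2 = (cmod (1 - half_plane q))\<^sup>2" by simp
    then have "Re (half_plane q) = 0"
      by (simp add: cmod_power2) (simp add: power2_eq_square algebra_simps)
    then show "q \<in> R0" by (simp add: Re_half_plane_eq_0_iff)
  next
    fix q assume "q \<in> R0"
    then obtain z where q: "q = (0, 0, z)" by (auto simp: R0_def)
    \<comment> \<open>The point of the unit circle that the Moebius map attaches to height
      \<open>z\<close> on the axis; its argument gives the value \<open>b\<close> at which \<omega>
      is held.\<close>
    define c where "c = (1 + \<i> * of_real z) / (1 - \<i> * of_real z)"
    have nz: "1 - \<i> * of_real z \<noteq> 0" by (simp add: complex_eq_iff)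
    have n1: "cmod c = 1"
    proof -
      have "cmod (1 + \<i> * of_real z) = cmod (1 - \<i> * of_real z)" by (simp add: cmod_def)
      then show ?thesis using nz by (simp add: c_def norm_divide)
    qed
    then have "- c \<noteq> 0" by auto
    from polar_turns[OF this] n1 obtain b where "- c = cis (2 * pi * b)" by auto
    then have c: "c = cis (2 * pi * b - pi)" by (simp add: cis_divide[symmetric]) (metis minus_minus)
    have c1: "c + 1 \<noteq> 0" using nz by (simp add: c_def divide_simps)
    have cq: "(c - 1) / (c + 1) = \<i> * of_real z" using nz c1 by (simp add: c_def divide_simps)
    obtain \<tau> m where \<tau>: "filterlim \<tau> L sequentially" "\<And>n. \<alpha> * \<tau> n = (b - \<omega>) + of_int (m n)"
      using residue_times[OF assms(1) L] by blast
    define w where "w n = wcoord (\<omega> + \<alpha> * \<tau> n) (k (\<tau> n))" for n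
    have "zcoord (\<omega> + \<alpha> * \<tau> n) (k (\<tau> n)) = of_real (exp (exp (k (\<tau> n)))) * c" for n
    proof -
      have "\<omega> + \<alpha> * \<tau> n = b + of_int (m n)" using \<tau>(2)[of n] by simp
      then have "zcoord (\<omega> + \<alpha> * \<tau> n) (k (\<tau> n)) = zcoord b (k (\<tau> n))" by (simp only: zcoord_shift)
      then show ?thesis by (simp only: zcoord_def c)
    qed
    moreover have "(\<lambda>n. of_real (exp (exp (k (\<tau> n)))) * c) \<longlonglongrightarrow> of_real 1 * c"
      by (intro tendsto_intros norms \<tau>)
    ultimately have "(\<lambda>n. zcoord (\<omega> + \<alpha> * \<tau> n) (k (\<tau> n))) \<longlonglongrightarrow> c" by simp
    then have "w \<longlonglongrightarrow> (c - 1) / (c + 1)"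
      unfolding w_def wcoord_def by (intro tendsto_intros c1)
    then have w: "w \<longlonglongrightarrow> \<i> * of_real z" by (simp only: cq)
    have Re: "(\<lambda>n. Re (w n)) \<longlonglongrightarrow> 0" using tendsto_Re[OF w] by simp
    have "(\<lambda>n. Re (w n) * cos (2 * pi * (\<theta> + \<tau> n))) \<longlonglongrightarrow> 0" "(\<lambda>n. Re (w n) * sin (2 * pi * (\<theta> + \<tau> n))) \<longlonglongrightarrow> 0"
      by (rule Lim_null_comparison[OF _ tendsto_rabs_zero[OF Re]],
          auto simp: abs_mult intro!: always_eventually mult_left_le)+
    then have "(\<lambda>n. chart (\<omega> + \<alpha> * \<tau> n) (\<theta> + \<tau> n) (k (\<tau> n))) \<longlonglongrightarrow> (0, 0, Im (\<i> * of_real z))"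
      unfolding chart_def w_def[symmetric] by (intro tendsto_intros w)
    then have "(\<lambda>n. chart (\<omega> + \<alpha> * \<tau> n) (\<theta> + \<tau> n) (k (\<tau> n))) \<longlonglongrightarrow> q" by (simp add: q)
    with \<tau>(1) show "q \<in> {q. \<exists>\<tau> :: nat \<Rightarrow> real. filterlim \<tau> L sequentially \<and>
      (\<lambda>n. chart (\<omega> + \<alpha> * \<tau> n) (\<theta> + \<tau> n) (k (\<tau> n))) \<longlonglongrightarrow> q}" by blast
  qed
qed

context cascade
begin

lemma solution_chart:
  "solution_on V UNIV (\<lambda>t. chart (\<omega> + \<alpha> * t) (\<theta> + t) (h + cocycle t \<omega> \<theta>)) (chart \<omega> \<theta> h)"
  using chart_curve_derivative by (simp add: solution_on_def)

lemma flow_dom_chart: "flow_dom V (chart \<omega> \<theta> h) = UNIV"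
  using solution_chart[of \<omega> \<theta> h] unfolding flow_dom_def by blast

lemma flow_chart:
  "flow V t (chart \<omega> \<theta> h) = chart (\<omega> + \<alpha> * t) (\<theta> + t) (h + cocycle t \<omega> \<theta>)"
  unfolding flow_def
proof (rule the_equality)
  show "\<exists>I u. solution_on V I u (chart \<omega> \<theta> h) \<and> t \<in> I \<and>
      chart (\<omega> + \<alpha> * t) (\<theta> + t) (h + cocycle t \<omega> \<theta>) = u t"
    using solution_chart by blast
  show "q = chart (\<omega> + \<alpha> * t) (\<theta> + t) (h + cocycle t \<omega> \<theta>)"
    if "\<exists>I u. solution_on V I u (chart \<omega> \<theta> h) \<and> t \<in> I \<and> q = u t" for q
    using that solution_unique by blast
qed

lemma limit_sets_chart:
  shows "filterlim (\<lambda>t. cocycle t \<omega> \<theta>) at_top at_top \<Longrightarrow> omega_limit_set V (chart \<omega> \<theta> h) = S0"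
    and "filterlim (\<lambda>t. cocycle t \<omega> \<theta>) at_bot at_top \<Longrightarrow> omega_limit_set V (chart \<omega> \<theta> h) = R0"
    and "filterlim (\<lambda>t. cocycle t \<omega> \<theta>) at_top at_bot \<Longrightarrow> alpha_limit_set V (chart \<omega> \<theta> h) = S0"
    and "filterlim (\<lambda>t. cocycle t \<omega> \<theta>) at_bot at_bot \<Longrightarrow> alpha_limit_set V (chart \<omega> \<theta> h) = R0"
proof -
  have top: "filterlim (\<lambda>t. h + cocycle t \<omega> \<theta>) at_top L" if "filterlim (\<lambda>t. cocycle t \<omega> \<theta>) at_top L" for L
    by (rule filterlim_tendsto_add_at_top[OF tendsto_const that])
  have bot: "filterlim (\<lambda>t. h + cocycle t \<omega> \<theta>) at_bot L" if "filterlim (\<lambda>t. cocycle t \<omega> \<theta>) at_bot L" for L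
  proof -
    have "filterlim (\<lambda>t. - h + - cocycle t \<omega> \<theta>) at_top L"
      using that by (intro filterlim_tendsto_add_at_top[OF tendsto_const]) (simp only: filterlim_uminus_at_bot)
    then show ?thesis by (simp only: filterlim_uminus_at_bot minus_add_distrib)
  qed
  show "filterlim (\<lambda>t. cocycle t \<omega> \<theta>) at_top at_top \<Longrightarrow> omega_limit_set V (chart \<omega> \<theta> h) = S0"
    using limit_set_S0[OF _ top] by (simp add: omega_limit_set_def flow_dom_chart flow_chart)
  show "filterlim (\<lambda>t. cocycle t \<omega> \<theta>) at_bot at_top \<Longrightarrow> omega_limit_set V (chart \<omega> \<theta> h) = R0"
    using limit_set_R0[OF alpha_pos _ bot] by (simp add: omega_limit_set_def flow_dom_chart flow_chart)
  show "filterlim (\<lambda>t. cocycle t \<omega> \<theta>) at_top at_bot \<Longrightarrow> alpha_limit_set V (chart \<omega> \<theta> h) = S0"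
    using limit_set_S0[OF _ top] by (simp add: alpha_limit_set_def flow_dom_chart flow_chart)
  show "filterlim (\<lambda>t. cocycle t \<omega> \<theta>) at_bot at_bot \<Longrightarrow> alpha_limit_set V (chart \<omega> \<theta> h) = R0"
    using limit_set_R0[OF alpha_pos _ bot] by (simp add: alpha_limit_set_def flow_dom_chart flow_chart)
qed

lemma limit_class_near_phase:
  assumes "A \<in> {S0, R0}" "B \<in> {S0, R0}"
  obtains j :: int where "\<And>\<omega> \<theta> h. near_phase (of_int j / 4) \<omega> \<theta> \<Longrightarrow> chart \<omega> \<theta> h \<in> limit_class V A B"
proof -
  consider "A = S0" "B = S0" | "A = S0" "B = R0" | "A = R0" "B = R0" | "A = R0" "B = S0"
    using assms by blast
  then show thesis
  proof cases
    case 1 then show thesis using that[of 0] cocycle_limits_even by (simp add: limit_class_def limit_sets_chart)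
  next
    case 2 then show thesis using that[of 1] cocycle_limits_quarter by (simp add: limit_class_def limit_sets_chart)
  next
    case 3 then show thesis using that[of 2] cocycle_limits_half by (simp add: limit_class_def limit_sets_chart)
  next
    case 4 then show thesis using that[of 3] cocycle_limits_three_quarters by (simp add: limit_class_def limit_sets_chart)
  qed
qed

lemma closure_limit_class:
  assumes "A \<in> {S0, R0}" "B \<in> {S0, R0}"
  shows "closure (limit_class V A B) = UNIV"
proof -
  obtain j :: int where j: "\<And>\<omega> \<theta> h. near_phase (of_int j / 4) \<omega> \<theta> \<Longrightarrow> chart \<omega> \<theta> h \<in> limit_class V A B"
    using limit_class_near_phase[OF assms] by blast
  have "P \<in> closure (limit_class V A B)" if "P \<notin> S0 \<union> R0" for P
  proof -
    obtain \<omega> \<theta> h where P: "P = chart \<omega> \<theta> h" using chart_surj[OF \<open>P \<notin> S0 \<union> R0\<close>] .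
    have "\<exists>\<omega>'. \<bar>\<omega>' - \<omega>\<bar> < 1 / real (Suc n) \<and> near_phase (of_int j / 4) \<omega>' \<theta>" for n
      using near_phase_dense[of "1 / real (Suc n)" \<omega> j \<theta>] by (metis divide_pos_pos of_nat_0_less_iff zero_less_Suc zero_less_one)
    then obtain w where w: "\<And>n. \<bar>w n - \<omega>\<bar> < 1 / real (Suc n)" "\<And>n. near_phase (of_int j / 4) (w n) \<theta>" by metis
    have "(\<lambda>n. w n - \<omega>) \<longlonglongrightarrow> 0"
      by (rule Lim_null_comparison[OF _ LIMSEQ_Suc[OF lim_inverse_n']])
        (use w(1) in \<open>auto intro!: always_eventually less_imp_le\<close>)
    then have "w \<longlonglongrightarrow> \<omega>" by (simp add: LIM_zero_iff)
    moreover have "continuous_on UNIV (\<lambda>\<omega>. chart \<omega> \<theta> h)" by (intro continuous_chart continuous_intros)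
    ultimately have "(\<lambda>n. chart (w n) \<theta> h) \<longlonglongrightarrow> P"
      unfolding P by (intro continuous_on_tendsto_compose[of UNIV "\<lambda>\<omega>. chart \<omega> \<theta> h"]) auto
    moreover have "chart (w n) \<theta> h \<in> limit_class V A B" for n by (rule j[OF w(2)])
    ultimately show ?thesis unfolding closure_sequential by (intro exI conjI allI)
  qed
  then have "- (S0 \<union> R0) \<subseteq> closure (limit_class V A B)" by blast
  then have "closure (- (S0 \<union> R0)) \<subseteq> closure (limit_class V A B)" by (simp add: closure_minimal)
  then show ?thesis unfolding closure_regular by blast
qed

lemma transitive: "transitive_flow V"
proof -
  \<comment> \<open>Baire's theorem is applied to the parameter space of all coordinate triples,
    which is complete, and not to the regular set itself.\<close>
  define visits where "visits B = {z. \<exists>t. chart (fst z + \<alpha> * t) (fst (snd z) + t)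
      (snd (snd z) + cocycle t (fst z) (fst (snd z))) \<in> B}" for B
  have open_visits: "open (visits B)" if "open B" for B
  proof -
    have "visits B = (\<Union>t. (\<lambda>z. chart (fst z + \<alpha> * t) (fst (snd z) + t)
        (snd (snd z) + cocycle t (fst z) (fst (snd z)))) -` B)"
      by (simp add: visits_def set_eq_iff)
    moreover have "continuous_on UNIV (\<lambda>z. chart (fst z + \<alpha> * t) (fst (snd z) + t)
        (snd (snd z) + cocycle t (fst z) (fst (snd z))))" for t
    proof -
      have "continuous_on UNIV (\<lambda>z::point. (fst z, fst (snd z)))" by (intro continuous_intros)
      from continuous_on_compose2[OF continuous_cocycle[of t] this]
      have "continuous_on UNIV (\<lambda>z::point. cocycle t (fst z) (fst (snd z)))" by simp
      then show ?thesis by (intro continuous_chart continuous_intros)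
    qed
    ultimately show ?thesis using that by (simp add: open_UN open_vimage)
  qed
  have dense_visits: "closure (visits B) = UNIV" if B: "open B" "B \<noteq> {}" for B
  proof -
    have "z \<in> closure (visits B)" for z
    proof -
      obtain \<omega>1 \<theta>1 h1 where z: "z = (\<omega>1, \<theta>1, h1)" by (cases z)
      have "B \<inter> - (S0 \<union> R0) \<noteq> {}"
        using closure_regular open_Int_closure_eq_empty[OF B(1), of "- (S0 \<union> R0)"] B(2) by auto
      then obtain P where P: "P \<in> B" "P \<notin> S0 \<union> R0" by blast
      obtain \<omega>2 \<theta>2 h2 where P2: "P = chart \<omega>2 \<theta>2 h2" using chart_surj[OF P(2)] .
      have "open ((\<lambda>\<omega>. chart \<omega> \<theta>2 h2) -` B)"
        by (intro open_vimage B continuous_chart continuous_intros)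
      moreover have "\<omega>2 \<in> (\<lambda>\<omega>. chart \<omega> \<theta>2 h2) -` B" using P P2 by simp
      ultimately obtain \<eta> where \<eta>: "\<eta> > 0" "ball \<omega>2 \<eta> \<subseteq> (\<lambda>\<omega>. chart \<omega> \<theta>2 h2) -` B"
        by (meson openE)
      have "\<exists>y\<in>visits B. dist y z < \<epsilon>" if "\<epsilon> > 0" for \<epsilon>
      proof -
        \<comment> \<open>The error in the final \<omega> has two parts below \<open>\<rho>\<close>,
          from moving the starting point and from Kronecker's theorem; \<open>\<epsilon>\<close>
          bounds the displacement from \<open>z\<close>.\<close>
        define \<rho> where "\<rho> = min (\<eta> / 2) \<epsilon>"
        have \<rho>: "\<rho> > 0" "\<rho> \<le> \<eta> / 2" "\<rho> \<le> \<epsilon>" using \<eta> that by (auto simp: \<rho>_def)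
        obtain wp where wp: "\<bar>wp - \<omega>1\<bar> < \<rho>" "near_phase 0 wp \<theta>1"
          using near_phase_dense[OF \<rho>(1), of \<omega>1 0 \<theta>1] by auto
        obtain wm where wm: "\<bar>wm - \<omega>1\<bar> < \<rho>" "near_phase (1/2) wm \<theta>1"
          using near_phase_dense[OF \<rho>(1), of \<omega>1 2 \<theta>1] by auto
        have "\<forall>\<^sub>F t in at_top. cocycle t wp \<theta>1 \<ge> h2 - h1"
          using cocycle_limits_even(1)[OF wp(2)] by (simp add: filterlim_at_top)
        moreover have "\<forall>\<^sub>F t in at_top. cocycle t wm \<theta>1 \<le> h2 - h1"
          using cocycle_limits_half(1)[OF wm(2)] by (simp add: filterlim_at_bot)
        ultimately have "\<forall>\<^sub>F t in at_top. cocycle t wp \<theta>1 \<ge> h2 - h1 \<and> cocycle t wm \<theta>1 \<le> h2 - h1"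
          by (rule eventually_conj)
        then obtain T where T: "\<And>t. t \<ge> T \<Longrightarrow> cocycle t wp \<theta>1 \<ge> h2 - h1 \<and> cocycle t wm \<theta>1 \<le> h2 - h1"
          by (auto simp: eventually_at_top_linorder)
        \<comment> \<open>The integer part of the travel time is still free: it is taken large, so
          that the two cocycles straddle \<open>h2 - h1\<close>, and such that \<omega> arrives near
          its target. The fractional part makes \<theta> exact.\<close>
        obtain n :: nat and m :: int where n: "n \<ge> nat \<lceil>T - \<theta>2 + \<theta>1\<rceil>"
          and m: "\<bar>real n * \<alpha> - of_int m - (\<omega>2 - \<omega>1 - \<alpha> * (\<theta>2 - \<theta>1))\<bar> < \<rho>"
          using kronecker_large[OF alpha_irrational \<rho>(1)] by blast
        define t where "t = \<theta>2 - \<theta>1 + real n"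
        have "t \<ge> T" using n unfolding t_def by linarith
        have "connected ((\<lambda>\<omega>. cocycle t \<omega> \<theta>1) ` ball \<omega>1 \<rho>)"
        proof (rule connected_continuous_image)
          have "continuous_on (ball \<omega>1 \<rho>) (\<lambda>\<omega>. (\<omega>, \<theta>1))" by (intro continuous_intros)
          from continuous_on_compose2[OF continuous_cocycle[of t] this]
          show "continuous_on (ball \<omega>1 \<rho>) (\<lambda>\<omega>. cocycle t \<omega> \<theta>1)" by simp
        qed simp
        moreover have "cocycle t wm \<theta>1 \<in> (\<lambda>\<omega>. cocycle t \<omega> \<theta>1) ` ball \<omega>1 \<rho>"
          "cocycle t wp \<theta>1 \<in> (\<lambda>\<omega>. cocycle t \<omega> \<theta>1) ` ball \<omega>1 \<rho>"
          using wm(1) wp(1) by (auto simp: dist_real_def abs_minus_commute)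
        \<comment> \<open>Intermediate values in the initial \<omega>, at fixed \<theta> and fixed
          time, hit the required change of height exactly.\<close>
        ultimately have "h2 - h1 \<in> (\<lambda>\<omega>. cocycle t \<omega> \<theta>1) ` ball \<omega>1 \<rho>"
          using T[OF \<open>t \<ge> T\<close>] by (meson connectedD_interval)
        then obtain w where "w \<in> ball \<omega>1 \<rho>" and w2: "cocycle t w \<theta>1 = h2 - h1" by force
        then have w1: "\<bar>w - \<omega>1\<bar> < \<rho>" by (simp add: dist_real_def abs_minus_commute)
        note w = w1 w2
        have \<theta>t: "\<theta>1 + t = \<theta>2 + of_int (int n)" by (simp add: t_def)
        have "chart (w + \<alpha> * t) (\<theta>1 + t) (h1 + cocycle t w \<theta>1) = chart ((w + \<alpha> * t - of_int m) + of_int m) (\<theta>2 + of_int (int n)) h2"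
          unfolding w(2) \<theta>t by simp
        also have "\<dots> = chart (w + \<alpha> * t - of_int m) \<theta>2 h2" by (rule chart_shift)
        also have "\<dots> \<in> B"
        proof -
          have "(w + \<alpha> * t - of_int m) - \<omega>2 = (w - \<omega>1) + (real n * \<alpha> - of_int m - (\<omega>2 - \<omega>1 - \<alpha> * (\<theta>2 - \<theta>1)))"
            by (simp add: t_def algebra_simps)
          then have "\<bar>(w + \<alpha> * t - of_int m) - \<omega>2\<bar> < \<eta>" using w(1) m \<rho>(2) by linarith
          then show ?thesis using \<eta>(2) by (auto simp: dist_real_def abs_minus_commute)
        qed
        finally have "(w, \<theta>1, h1) \<in> visits B" by (auto simp: visits_def)
        moreover have "dist (w, \<theta>1, h1) z < \<epsilon>"
          using w(1) \<rho>(3) by (simp add: z dist_Pair_Pair dist_real_def)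
        ultimately show ?thesis by blast
      qed
      then show ?thesis by (simp add: closure_approachable)
    qed
    then show ?thesis by blast
  qed
  obtain \<B> :: "point set set" where \<B>: "countable \<B>" "topological_basis \<B>"
    using ex_countable_basis by blast
  have "UNIV \<subseteq> closure (\<Inter>(visits ` (\<B> - {{}})))"
  proof (rule Baire)
    show "countable (visits ` (\<B> - {{}}))" using \<B>(1) by simp
    fix T assume "T \<in> visits ` (\<B> - {{}})"
    then show "openin (top_of_set UNIV) T \<and> UNIV \<subseteq> closure T"
      using open_visits dense_visits topological_basis_open[OF \<B>(2)] by auto
  qed simp
  then have "\<Inter>(visits ` (\<B> - {{}})) \<noteq> {}" by auto
  then obtain \<omega> \<theta> h where z: "(\<omega>, \<theta>, h) \<in> \<Inter>(visits ` (\<B> - {{}}))" by (metis ex_in_conv prod_cases3)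
  have "closure (orbit V (chart \<omega> \<theta> h)) = UNIV"
  proof (rule ccontr)
    assume "closure (orbit V (chart \<omega> \<theta> h)) \<noteq> UNIV"
    then obtain P where "P \<in> - closure (orbit V (chart \<omega> \<theta> h))" by blast
    then obtain B where B: "B \<in> \<B>" "P \<in> B" "B \<subseteq> - closure (orbit V (chart \<omega> \<theta> h))"
      using topological_basisE[OF \<B>(2), of "- closure (orbit V (chart \<omega> \<theta> h))" P]
      by (metis closed_closure open_Compl)
    then have "(\<omega>, \<theta>, h) \<in> visits B" using z by blast
    then obtain t where "flow V t (chart \<omega> \<theta> h) \<in> B" by (auto simp: visits_def flow_chart)
    moreover have "flow V t (chart \<omega> \<theta> h) \<in> orbit V (chart \<omega> \<theta> h)" by (simp add: orbit_def flow_dom_chart)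
    ultimately show False using B(3) closure_subset by blast
  qed
  then show ?thesis unfolding transitive_flow_def by (rule exI)
qed

end

section \<open>Resonances and a Cantor set of good phases\<close>

text \<open>The digits in \<open>[J k, J (k + 1))\<close> have weights that are multiples of \<open>1 / q (k + 1)\<close> and so do not
  affect the later phases; \<open>block_upper\<close> keeps their effect on the \<open>k\<close>-th phase below \<open>2\<^sup>-\<^sup>k\<close>, and
  \<open>block_lower\<close> keeps the \<open>j\<close>-th weight above \<open>c / 4 ^ (j + 1)\<close>, whence the exponent \<open>1/2\<close>.\<close>

locale cantor_cascade = cascade +
  fixes J :: "nat \<Rightarrow> nat" and c :: real
  assumes q_pos: "\<And>k. q k > 0" and q_0: "q 0 \<ge> 5" and q_dvd: "\<And>k. q k dvd q (Suc k)"
    and J_0: "J 0 = 0" and J_less: "\<And>k. J k < J (Suc k)"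
    and block_upper: "\<And>k. 3 ^ (J (Suc k) - J k) * real_of_int (q k) \<le> (1/2) ^ k * real_of_int (q (Suc k))"
    and c_pos: "c > 0"
    and block_lower: "\<And>k. c * real_of_int (q (Suc k)) \<le> 3 ^ (J (Suc k) - J k - 1) * 4 ^ Suc (J k)"

text \<open>The new denominator is \<open>q * (4 * n + 1)\<close>, which keeps divisibility and the
  residue modulo 4. Kronecker's theorem for \<open>4 * q * \<alpha>\<close> places the defect within
  \<open>2^-(k+3)\<close> of \<open>3 * 2^-(k+3)\<close>, the middle of the required window, with
  \<open>n\<close> as large as desired. The block length \<open>L\<close> is the integer part of the
  base 3 logarithm of \<open>2^-k * m\<close>.\<close>

lemma cantor_cascade_step:
  fixes \<alpha> c :: real and q :: int and J k :: nat
  assumes \<alpha>: "\<alpha> \<notin> \<rat>" and q: "q > 0" "q mod 4 = 1" and c: "c > 0"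
  obtains q' p' :: int and L :: nat where
    "q' > 0" "q' mod 4 = 1" "q dvd q'" "L > 0"
    "(1/2) ^ Suc (Suc k) \<le> of_int q' * \<alpha> - of_int p'" "of_int q' * \<alpha> - of_int p' \<le> (1/2) ^ Suc k"
    "3 ^ L * real_of_int q \<le> (1/2) ^ k * real_of_int q'" "(1/2) ^ k * real_of_int q' < 3 ^ Suc L * real_of_int q"
    "9 * c * real_of_int q' \<le> (1/2) ^ Suc k * 4 ^ Suc (J + L)"
proof -
  \<comment> \<open>The new \<open>q'\<close> is of order \<open>3 ^ L\<close>, and the last
    requirement compares it with \<open>4 ^ L\<close>: once \<open>L\<close> exceeds
    \<open>L0\<close>, the surplus \<open>(4/3) ^ L\<close> pays for all constants.\<close>
  obtain L0 where L0: "54 * c * real_of_int q * 4 ^ k < (4/3) ^ L0"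
    using real_arch_pow[of "4/3::real"] by auto
  \<comment> \<open>Forces \<open>2^-k * m\<close> above \<open>3 ^ Suc L0\<close>, hence
    \<open>L > L0\<close>.\<close>
  define N where "N = nat \<lceil>2 ^ k * 3 ^ Suc L0 :: real\<rceil>"
  have irr: "4 * of_int q * \<alpha> \<notin> \<rat>"
  proof
    assume "4 * of_int q * \<alpha> \<in> \<rat>"
    then have "4 * of_int q * \<alpha> / of_int (4 * q) \<in> \<rat>" by (rule Rats_divide) simp
    then show False using \<alpha> q by simp
  qed
  obtain n :: nat and l :: int where n: "n \<ge> N" and
    l: "\<bar>real n * (4 * of_int q * \<alpha>) - of_int l - (3 * (1/2) ^ Suc (Suc (Suc k)) - of_int q * \<alpha>)\<bar> < (1/2) ^ Suc (Suc (Suc k))"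
    using kronecker_large[OF irr, of "(1/2) ^ Suc (Suc (Suc k))" N "3 * (1/2) ^ Suc (Suc (Suc k)) - of_int q * \<alpha>"] by auto
  define m where "m = 4 * int n + 1"
  define r where "r = (1/2) ^ k * real_of_int m"
  have "2 ^ k * 3 ^ Suc L0 \<le> real_of_int m"
    using n by (simp add: N_def m_def)
  then have "(1/2) ^ k * (2 ^ k * 3 ^ Suc L0) \<le> r" unfolding r_def by (intro mult_left_mono) auto
  then have r: "3 ^ Suc L0 \<le> r" by (simp add: power_one_over)
  moreover have "(1::real) \<le> 3 ^ Suc L0" by (rule one_le_power) simp
  ultimately have "r \<ge> 1" by linarith
  then obtain L where L: "3 ^ L \<le> r" "r < 3 ^ Suc L" using power_scale[of 3 r] by auto
  have "(3::real) ^ Suc L0 < 3 ^ Suc L" using r L by linarith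
  then have "L0 < L" by simp
  have defect: "of_int (q * m) * \<alpha> - of_int l = real n * (4 * of_int q * \<alpha>) - of_int l + of_int q * \<alpha>"
    by (simp add: m_def algebra_simps)
  show thesis
  proof (rule that[of "q * m" L l])
    show "q * m > 0" using q by (simp add: m_def)
    show "q * m mod 4 = 1" using q(2) by (simp add: m_def mod_mult_left_eq[of q 4, symmetric])
    show "q dvd q * m" by simp
    show "L > 0" using \<open>L0 < L\<close> by simp
    show "(1/2) ^ Suc (Suc k) \<le> of_int (q * m) * \<alpha> - of_int l" "of_int (q * m) * \<alpha> - of_int l \<le> (1/2) ^ Suc k"
      using l unfolding defect power_Suc by linarith+
    show "3 ^ L * real_of_int q \<le> (1/2) ^ k * real_of_int (q * m)"
      using mult_right_mono[OF L(1), of "real_of_int q"] q by (simp add: r_def mult_ac)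
    show upper: "(1/2) ^ k * real_of_int (q * m) < 3 ^ Suc L * real_of_int q"
      using mult_strict_right_mono[OF L(2), of "real_of_int q"] q by (simp add: r_def mult_ac)
    have "9 * c * real_of_int (q * m) = 9 * c * 2 ^ k * ((1/2) ^ k * real_of_int (q * m))"
      by (simp add: power_one_over)
    also have "\<dots> \<le> 9 * c * 2 ^ k * (3 ^ Suc L * real_of_int q)"
      using upper c by (intro mult_left_mono) auto
    also have "\<dots> = (54 * c * real_of_int q * 4 ^ k) * 3 ^ L * (1/2) ^ Suc k"
    proof -
      have "(4::real) ^ k = 2 ^ k * 2 ^ k" by (simp flip: power_mult_distrib)
      then show ?thesis by (simp add: power_one_over)
    qed
    also have "\<dots> \<le> (4/3) ^ L * 3 ^ L * (1/2) ^ Suc k"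
    proof -
      have "(4/3::real) ^ L0 \<le> (4/3) ^ L" using \<open>L0 < L\<close> by (intro power_increasing) auto
      with L0 have "54 * c * real_of_int q * 4 ^ k \<le> (4/3) ^ L" by linarith
      then show ?thesis by (intro mult_right_mono) auto
    qed
    also have "(4/3) ^ L * 3 ^ L = (4::real) ^ L" by (simp flip: power_mult_distrib)
    also have "4 ^ L * (1/2) ^ Suc k \<le> (1/2) ^ Suc k * (4::real) ^ Suc (J + L)"
    proof -
      have "(4::real) ^ L \<le> 4 ^ Suc (J + L)" by (intro power_increasing) auto
      then show ?thesis by (simp add: mult.commute)
    qed
    finally show "9 * c * real_of_int (q * m) \<le> (1/2) ^ Suc k * 4 ^ Suc (J + L)" .
  qed
qed

text \<open>Dependent choice over triples \<open>(q, p, J)\<close>. The factor 9 in the invariant is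
  the loss in the next block: \<open>q (Suc k)\<close> is less than
  \<open>9 * 2^k * 3^(length - 1) * q k\<close>, so the invariant at stage \<open>k\<close> yields
  \<open>block_lower\<close> at \<open>k\<close>.\<close>

lemma cantor_cascade_exists:
  fixes \<alpha> :: real
  assumes \<alpha>: "\<alpha> > 0" "\<alpha> \<notin> \<rat>"
  obtains q p :: "nat \<Rightarrow> int" and J :: "nat \<Rightarrow> nat" and c :: real where "cantor_cascade \<alpha> q p J c"
proof -
  have irr: "4 * \<alpha> \<notin> \<rat>"
  proof
    assume "4 * \<alpha> \<in> \<rat>"
    then have "4 * \<alpha> / 4 \<in> \<rat>" by (rule Rats_divide) simp
    then show False using \<alpha> by simp
  qed
  obtain n :: nat and p0 :: int where n: "n \<ge> 1" and p0: "\<bar>real n * (4 * \<alpha>) - of_int p0 - (3/4 - \<alpha>)\<bar> < 1/4"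
    using kronecker_large[OF irr, of "1/4" 1 "3/4 - \<alpha>"] by auto
  define q0 where "q0 = 4 * int n + 1"
  \<comment> \<open>Makes the invariant an equality at stage 0, where \<open>J = 0\<close>.\<close>
  define c where "c = 4 / (9 * real_of_int q0)"
  have q0: "q0 \<ge> 5" "q0 mod 4 = 1" using n by (simp_all add: q0_def)
  have c: "c > 0" using q0 by (simp add: c_def)
  define P where "P k s \<longleftrightarrow> (case s of (q, p, J) \<Rightarrow> q > 0 \<and> q mod 4 = 1 \<and>
      (1/2) ^ Suc k \<le> of_int q * \<alpha> - of_int p \<and> of_int q * \<alpha> - of_int p \<le> (1/2) ^ k \<and>
      9 * c * real_of_int q \<le> (1/2) ^ k * 4 ^ Suc J \<and> (k = 0 \<longrightarrow> q \<ge> 5 \<and> J = 0))"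
    for k :: nat and s :: "int \<times> int \<times> nat"
  define Q where "Q k s s' \<longleftrightarrow> (case s of (q, p, J) \<Rightarrow> case s' of (q', p', J') \<Rightarrow> q dvd q' \<and> J < J' \<and>
      3 ^ (J' - J) * real_of_int q \<le> (1/2) ^ k * real_of_int q' \<and>
      (1/2) ^ k * real_of_int q' < 3 ^ Suc (J' - J) * real_of_int q)"
    for k :: nat and s s' :: "int \<times> int \<times> nat"
  have "\<exists>f. \<forall>k. P k (f k) \<and> Q k (f k) (f (Suc k))"
  proof (rule dependent_nat_choice)
    have "of_int q0 * \<alpha> - of_int p0 = real n * (4 * \<alpha>) - of_int p0 + \<alpha>" by (simp add: q0_def algebra_simps)
    then have "1/2 \<le> of_int q0 * \<alpha> - of_int p0" "of_int q0 * \<alpha> - of_int p0 \<le> 1"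
      using p0 by linarith+
    then have "P 0 (q0, p0, 0)"
      using q0 by (simp add: P_def c_def)
    then show "\<exists>s. P 0 s" ..
    fix s k assume "P k s"
    obtain q p J where s: "s = (q, p, J)" by (cases s)
    with \<open>P k s\<close> have q: "q > 0" "q mod 4 = 1" by (auto simp: P_def)
    obtain q' p' :: int and L :: nat where step:
      "q' > 0" "q' mod 4 = 1" "q dvd q'" "L > 0"
      "(1/2) ^ Suc (Suc k) \<le> of_int q' * \<alpha> - of_int p'" "of_int q' * \<alpha> - of_int p' \<le> (1/2) ^ Suc k"
      "3 ^ L * real_of_int q \<le> (1/2) ^ k * real_of_int q'" "(1/2) ^ k * real_of_int q' < 3 ^ Suc L * real_of_int q"
      "9 * c * real_of_int q' \<le> (1/2) ^ Suc k * 4 ^ Suc (J + L)"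
      by (rule cantor_cascade_step[OF \<alpha>(2) q c, of k J]) (rule that)
    have "P (Suc k) (q', p', J + L)"
      unfolding P_def case_prod_conv by (intro conjI impI step) simp_all
    moreover have "Q k s (q', p', J + L)"
      unfolding Q_def s case_prod_conv diff_add_inverse using step(4) by (intro conjI step) simp
    ultimately have "P (Suc k) (q', p', J + L) \<and> Q k s (q', p', J + L)" ..
    then show "\<exists>s'. P (Suc k) s' \<and> Q k s s'" ..
  qed
  then obtain f where f: "\<And>k. P k (f k)" "\<And>k. Q k (f k) (f (Suc k))" by blast
  define q p J where "q k = fst (f k)" and "p k = fst (snd (f k))" and "J k = snd (snd (f k))" for k
  have fk: "f k = (q k, p k, J k)" for k by (simp add: q_def p_def J_def)
  have P: "q k > 0" "q k mod 4 = 1" "(1/2) ^ Suc k \<le> of_int (q k) * \<alpha> - of_int (p k)"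
      "of_int (q k) * \<alpha> - of_int (p k) \<le> (1/2) ^ k" "9 * c * real_of_int (q k) \<le> (1/2) ^ k * 4 ^ Suc (J k)"
      "q 0 \<ge> 5" "J 0 = 0" for k
    using f(1)[of k] f(1)[of 0] unfolding P_def fk by simp_all
  have Q: "q k dvd q (Suc k)" "J k < J (Suc k)"
      "3 ^ (J (Suc k) - J k) * real_of_int (q k) \<le> (1/2) ^ k * real_of_int (q (Suc k))"
      "(1/2) ^ k * real_of_int (q (Suc k)) < 3 ^ Suc (J (Suc k) - J k) * real_of_int (q k)" for k
    using f(2)[of k] unfolding Q_def fk by simp_all
  have lower: "c * real_of_int (q (Suc k)) \<le> 3 ^ (J (Suc k) - J k - 1) * 4 ^ Suc (J k)" for k
  proof -
    obtain L where L: "J (Suc k) - J k = Suc L" using Q(2)[of k] by (metis Suc_diff_Suc)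
    have "c * real_of_int (q (Suc k)) = c * 2 ^ k * ((1/2) ^ k * real_of_int (q (Suc k)))"
      by (simp add: power_one_over)
    also have "\<dots> \<le> c * 2 ^ k * (3 ^ Suc (Suc L) * real_of_int (q k))"
      using Q(4)[of k] c unfolding L by (intro mult_left_mono) auto
    also have "\<dots> = 2 ^ k * 3 ^ L * (9 * c * real_of_int (q k))" by simp
    also have "\<dots> \<le> 2 ^ k * 3 ^ L * ((1/2) ^ k * 4 ^ Suc (J k))"
      by (intro mult_left_mono P) auto
    also have "\<dots> = 3 ^ L * 4 ^ Suc (J k)" by (simp add: power_one_over)
    finally show ?thesis by (simp add: L)
  qed
  have "cantor_cascade \<alpha> q p J c"
    by unfold_locales (rule \<alpha> P Q c lower)+
  then show thesis by (rule that)
qed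

section \<open>Digit weights and the Cantor map\<close>

context cantor_cascade
begin

lemma J_mono: "i \<le> k \<Longrightarrow> J i \<le> J k"
  by (rule lift_Suc_mono_le[of J]) (use J_less less_imp_le in auto)

lemma J_ge: "k \<le> J k"
proof (induction k)
  case (Suc k)
  then show ?case using J_less[of k] by linarith
qed simp

lemma q_dvd_trans: "i \<le> k \<Longrightarrow> q i dvd q k"
proof (induction k)
  case (Suc k)
  then show ?case using q_dvd[of k] by (cases "i = Suc k") (auto intro: dvd_trans)
qed simp

definition block :: "nat \<Rightarrow> nat" where
  "block j = (LEAST k. j < J (Suc k))"

text \<open>Inside block \<open>k\<close> the weights are descending powers of 3 over
  \<open>q (Suc k)\<close>, the last digit having weight \<open>1 / q (Suc k)\<close>. The ratio 3,
  instead of 2, creates the gaps of the Cantor set.\<close>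

definition digit_weight :: "nat \<Rightarrow> real" where
  "digit_weight j = 3 ^ (J (Suc (block j)) - 1 - j) / real_of_int (q (Suc (block j)))"

lemma less_block_end: "j < J (Suc (block j))"
  unfolding block_def by (rule LeastI[of _ j]) (use J_ge[of "Suc j"] in simp)

lemma block_eqI:
  assumes "J k \<le> j" "j < J (Suc k)" shows "block j = k"
  unfolding block_def
proof (rule Least_equality)
  fix i assume "j < J (Suc i)"
  show "k \<le> i"
  proof (rule ccontr)
    assume "\<not> k \<le> i"
    then have "J (Suc i) \<le> J k" by (intro J_mono) simp
    then show False using \<open>j < J (Suc i)\<close> assms by simp
  qed
qed (rule assms)

lemma block_start: "J (block j) \<le> j"
proof (cases "block j")
  case 0 then show ?thesis by (simp add: J_0)
next
  case (Suc k)
  then have "\<not> j < J (Suc k)" unfolding block_def by (metis lessI not_less_Least)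
  then show ?thesis using Suc by simp
qed

lemma digit_weight_pos: "digit_weight j > 0"
  using q_pos by (simp add: digit_weight_def)

lemma digit_weight_block_start: "digit_weight (J k) \<le> (1/2) ^ k / (3 * real_of_int (q k))"
proof -
  obtain L where L: "J (Suc k) - J k = Suc L" using J_less[of k] by (metis Suc_diff_Suc)
  have "block (J k) = k" using J_less by (intro block_eqI) auto
  then have "digit_weight (J k) = 3 ^ L / real_of_int (q (Suc k))"
  proof -
    have "J (Suc k) - 1 - J k = L" using L by simp
    then show ?thesis using \<open>block (J k) = k\<close> by (simp add: digit_weight_def)
  qed
  moreover have "3 ^ L * (3 * real_of_int (q k)) \<le> (1/2) ^ k * real_of_int (q (Suc k))"
    using block_upper[of k] by (simp add: L mult_ac)
  moreover have "real_of_int (q (Suc k)) > 0" "3 * real_of_int (q k) > 0"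
    using q_pos[of k] q_pos[of "Suc k"] by simp_all
  ultimately show ?thesis
    by (simp only: pos_divide_le_eq times_divide_eq_left pos_le_divide_eq)
qed

text \<open>Inside a block this is an equality. Across a boundary the old weight is one over the
  current denominator, and \<open>digit_weight_block_start\<close> supplies the factor 3.\<close>

lemma digit_weight_Suc: "digit_weight (Suc j) \<le> digit_weight j / 3"
proof (cases "Suc j < J (Suc (block j))")
  case True
  then have b: "block (Suc j) = block j"
    using block_start[of j] by (intro block_eqI) auto
  obtain i where "J (Suc (block j)) - 1 - j = Suc i" "J (Suc (block j)) - 1 - Suc j = i"
    using True by (metis Suc_diff_Suc diff_Suc_eq_diff_pred less_diff_conv plus_1_eq_Suc add.commute diff_commute)
  then show ?thesis by (simp add: digit_weight_def b)
next
  case False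
  then have e: "Suc j = J (Suc (block j))" using less_block_end[of j] by simp
  let ?k = "Suc (block j)"
  have "digit_weight (Suc j) \<le> (1/2) ^ ?k / (3 * real_of_int (q ?k))"
    unfolding e by (rule digit_weight_block_start)
  also have "\<dots> \<le> 1 / (3 * real_of_int (q ?k))"
    using q_pos[of ?k] by (intro divide_right_mono power_le_one) auto
  also have "\<dots> = digit_weight j / 3"
    by (simp add: digit_weight_def flip: e)
  finally show ?thesis .
qed

text \<open>At the first digit of a block this is \<open>block_lower\<close>; from there the weight
  drops by 3 per digit and the bound by 4.\<close>

lemma digit_weight_lower: "digit_weight j \<ge> c / 4 ^ Suc j"
proof -
  define k where "k = block j"
  have jk: "J k \<le> j" "j < J (Suc k)" using block_start less_block_end by (auto simp: k_def)
  define a b where "a = J (Suc k) - 1 - j" and "b = j - J k"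
  have e: "J (Suc k) - J k - 1 = a + b" "Suc j = Suc (J k) + b" using jk by (auto simp: a_def b_def)
  have "c * real_of_int (q (Suc k)) \<le> 3 ^ (a + b) * 4 ^ Suc (J k)"
    using block_lower[of k] by (simp only: e)
  also have "\<dots> = 3 ^ a * 4 ^ Suc (J k) * 3 ^ b" by (simp add: power_add)
  also have "\<dots> \<le> 3 ^ a * 4 ^ Suc (J k) * 4 ^ b" by (intro mult_left_mono power_mono) auto
  also have "\<dots> = 3 ^ a * 4 ^ Suc j" by (simp only: e power_add)
  finally have "c / 4 ^ Suc j \<le> 3 ^ a / real_of_int (q (Suc k))"
    using q_pos[of "Suc k"] by (simp add: divide_simps mult_ac)
  then show ?thesis by (simp add: digit_weight_def a_def k_def)
qed

lemma digit_weight_integral: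
  assumes "j < J k" obtains i :: int where "real_of_int (q k) * digit_weight j = of_int i"
proof -
  have "Suc (block j) \<le> k"
    using assms block_start[of j] J_mono[of k "block j"] by (cases "Suc (block j) \<le> k") auto
  from q_dvd_trans[OF this] obtain i where "q k = q (Suc (block j)) * i" by (elim dvdE)
  then have "real_of_int (q k) * digit_weight j = of_int (i * 3 ^ (J (Suc (block j)) - 1 - j))"
    using q_pos[of "Suc (block j)"] by (simp add: digit_weight_def)
  then show thesis by (rule that)
qed

lemma digit_weight_geometric: "digit_weight (j + n) \<le> digit_weight n * (1/3) ^ j"
proof (induction j)
  case (Suc j)
  then show ?case using digit_weight_Suc[of "j + n"] by simp
qed simp

text \<open>Coefficients in [-1, 1] cover both digits and differences of digits; 3/2 is the sum of
  the geometric series with ratio 1/3.\<close>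

lemma digit_sum_bounds:
  assumes "\<And>j. \<bar>a j\<bar> \<le> 1"
  shows "summable (\<lambda>j. a j * digit_weight (j + n))"
    and "\<bar>\<Sum>j. a j * digit_weight (j + n)\<bar> \<le> 3/2 * digit_weight n"
proof -
  have bound: "norm (a j * digit_weight (j + n)) \<le> digit_weight n * (1/3) ^ j" for j
  proof -
    have "\<bar>a j * digit_weight (j + n)\<bar> \<le> 1 * digit_weight (j + n)"
      unfolding abs_mult using digit_weight_pos[of "j + n"] assms[of j] by (intro mult_mono) auto
    then show ?thesis using digit_weight_geometric[of j n] by simp
  qed
  have geo: "(\<lambda>j. digit_weight n * (1/3) ^ j) sums (digit_weight n * (1 / (1 - 1/3)))"
    by (intro sums_mult geometric_sums) simp
  show "summable (\<lambda>j. a j * digit_weight (j + n))"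
    by (rule summable_comparison_test'[OF sums_summable[OF geo] bound])
  have "norm (\<Sum>j. a j * digit_weight (j + n)) \<le> (\<Sum>j. digit_weight n * (1/3) ^ j)"
    by (rule norm_suminf_le[OF bound sums_summable[OF geo]])
  then show "\<bar>\<Sum>j. a j * digit_weight (j + n)\<bar> \<le> 3/2 * digit_weight n"
    using sums_unique[OF geo] by simp
qed

definition digit :: "nat \<Rightarrow> real \<Rightarrow> int" where
  "digit j s = \<lfloor>2 ^ Suc j * s\<rfloor> - 2 * \<lfloor>2 ^ j * s\<rfloor>"

text \<open>The binary digits of \<open>s\<close> are read again with the sparse weights; the
  inverse is the Hoelder map from the Cantor set onto the interval.\<close>

definition cantor_point :: "real \<Rightarrow> real" where
  "cantor_point s = (\<Sum>j. of_int (digit j s) * digit_weight j)"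

lemma digit_cases: "digit j s = 0 \<or> digit j s = 1"
proof -
  have "2 ^ Suc j * s = 2 * (2 ^ j * s)" by simp
  then show ?thesis unfolding digit_def by linarith
qed

lemma abs_digit_le: "\<bar>real_of_int (digit j s)\<bar> \<le> 1"
  using digit_cases[of j s] by auto

lemma digit_diff: "\<bar>real_of_int (digit j s) - real_of_int (digit j t)\<bar> \<le> 1"
  using digit_cases[of j s] digit_cases[of j t] by auto

lemma cantor_point_split:
  "cantor_point s = (\<Sum>j<n. of_int (digit j s) * digit_weight j) + (\<Sum>j. of_int (digit (j + n) s) * digit_weight (j + n))"
proof -
  have "summable (\<lambda>j. of_int (digit j s) * digit_weight j)"
    using digit_sum_bounds(1)[of "\<lambda>j. of_int (digit j s)" 0] abs_digit_le by simp
  from suminf_split_initial_segment[OF this, of n] show ?thesis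
    by (simp add: cantor_point_def)
qed

lemma near_phase_cantor_point: "near_phase (of_int i / 4) (of_int i / 4 + cantor_point s) 0"
  unfolding near_phase_def
proof (rule exI[of _ 1], rule allI)
  fix k
  have "\<exists>l::int. real_of_int (q k) * (\<Sum>j<J k. of_int (digit j s) * digit_weight j) = of_int l"
  proof -
    have "\<exists>l::int. real_of_int (q k) * digit_weight j = of_int l" if "j < J k" for j
      using digit_weight_integral[OF that] by metis
    then obtain l :: "nat \<Rightarrow> int" where l: "\<And>j. j < J k \<Longrightarrow> real_of_int (q k) * digit_weight j = of_int (l j)" by metis
    have "real_of_int (q k) * (\<Sum>j<J k. of_int (digit j s) * digit_weight j)
        = (\<Sum>j<J k. of_int (digit j s) * (real_of_int (q k) * digit_weight j))"
      by (simp add: sum_distrib_left mult_ac)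
    also have "\<dots> = of_int (\<Sum>j<J k. digit j s * l j)" by (simp add: l)
    finally show ?thesis by blast
  qed
  then obtain l :: int where l: "real_of_int (q k) * (\<Sum>j<J k. of_int (digit j s) * digit_weight j) = of_int l" by blast
  define T where "T = (\<Sum>j. of_int (digit (j + J k) s) * digit_weight (j + J k))"
  have T: "\<bar>real_of_int (q k) * T\<bar> \<le> (1/2) ^ k"
  proof -
    have "\<bar>T\<bar> \<le> 3/2 * digit_weight (J k)"
      unfolding T_def by (intro digit_sum_bounds abs_digit_le)
    also have "\<dots> \<le> 3/2 * ((1/2) ^ k / (3 * real_of_int (q k)))"
      by (intro mult_left_mono digit_weight_block_start) simp
    finally have "real_of_int (q k) * \<bar>T\<bar> \<le> real_of_int (q k) * (3/2 * ((1/2) ^ k / (3 * real_of_int (q k))))"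
      using q_pos[of k] by (intro mult_left_mono) auto
    also have "\<dots> = (1/2) ^ k / 2" using q_pos[of k] by simp
    also have "\<dots> \<le> (1/2) ^ k" by simp
    finally show ?thesis using q_pos[of k] by (simp add: abs_mult)
  qed
  have "q k = 4 * (q k div 4) + 1" using q_mod_4[of k] by (metis mult_div_mod_eq)
  then have q4: "real_of_int (q k) = 4 * of_int (q k div 4) + 1" by (metis of_int_1 of_int_add of_int_mult of_int_numeral)
  have e: "real_of_int (q k) * (of_int i / 4) = of_int i / 4 + of_int (i * (q k div 4))"
    unfolding q4 by (simp add: field_simps)
  have "phase k (of_int i / 4 + cantor_point s) 0 - of_int i / 4 - of_int (i * (q k div 4) + l) = real_of_int (q k) * T"
    unfolding phase_def cantor_point_split[of s "J k"] T_def[symmetric] distrib_left l e by simp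
  then show "\<exists>m. \<bar>phase k (of_int i / 4 + cantor_point s) 0 - of_int i / 4 - of_int m\<bar> \<le> 1 * (1/2) ^ k"
    using T by (metis mult_1)
qed

text \<open>Two such values and a drift of 1/4 differ by less than half a turn, as
  \<open>chart_separation\<close> requires; \<open>q 0 \<ge> 5\<close> is there for this
  bound.\<close>

lemma cantor_point_bounds: "\<bar>cantor_point s\<bar> \<le> 1/10"
proof -
  have "\<bar>cantor_point s\<bar> \<le> 3/2 * digit_weight 0"
    using digit_sum_bounds(2)[of "\<lambda>j. of_int (digit j s)" 0] abs_digit_le by (simp add: cantor_point_def)
  also have "digit_weight 0 \<le> 1 / (3 * real_of_int (q 0))"
    using digit_weight_block_start[of 0] by (simp add: J_0)
  also have "\<dots> \<le> 1 / (3 * 5)" using q_0 by (intro divide_left_mono) auto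
  finally show ?thesis by simp
qed

lemma floor_eq_of_digits:
  assumes "0 \<le> s" "s < 1" "0 \<le> t" "t < 1" "\<And>j. j < n \<Longrightarrow> digit j s = digit j t"
  shows "\<lfloor>2 ^ n * s\<rfloor> = \<lfloor>2 ^ n * t\<rfloor>"
  using assms(5)
proof (induction n)
  case 0
  have "\<lfloor>s\<rfloor> = 0" "\<lfloor>t\<rfloor> = 0" using assms by (simp_all only: floor_eq_iff) auto
  then show ?case by simp
next
  case (Suc n)
  then have "\<lfloor>2 ^ n * s\<rfloor> = \<lfloor>2 ^ n * t\<rfloor>" "digit n s = digit n t" by simp_all
  then show ?case by (simp add: digit_def)
qed

lemma close_of_digits:
  assumes "0 \<le> s" "s < 1" "0 \<le> t" "t < 1" "\<And>j. j < n \<Longrightarrow> digit j s = digit j t"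
  shows "\<bar>s - t\<bar> \<le> (1/2) ^ n"
proof -
  have "\<bar>2 ^ n * s - 2 ^ n * t\<bar> \<le> 1" 
  proof -
    have "\<lfloor>2 ^ n * s\<rfloor> = \<lfloor>2 ^ n * t\<rfloor>" by (rule floor_eq_of_digits[OF assms])
    then show ?thesis by linarith
  qed
  then have "2 ^ n * \<bar>s - t\<bar> \<le> 1" by (simp add: abs_mult flip: right_diff_distrib)
  then show ?thesis by (simp add: power_one_over field_simps)
qed

text \<open>At the first differing digit \<open>n\<close> the tail can undo at most half of
  \<open>digit_weight n\<close>, so the images differ by at least
  \<open>c / (2 * 4 ^ Suc n)\<close>, while the arguments differ by at most
  \<open>(1/2) ^ n\<close>, whose square is \<open>1 / 4 ^ n\<close>.\<close>

lemma cantor_point_separation: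
  assumes "0 \<le> s" "s < 1" "0 \<le> t" "t < 1"
  shows "(s - t)\<^sup>2 \<le> 8 / c * \<bar>cantor_point s - cantor_point t\<bar>"
proof (cases "\<exists>j. digit j s \<noteq> digit j t")
  case False
  then have "\<bar>s - t\<bar> \<le> (1/2) ^ n" for n using close_of_digits[OF assms] by blast
  then have "\<bar>s - t\<bar> \<le> 0"
    by (intro LIMSEQ_le_const[OF LIMSEQ_power_zero[of "1/2::real"]]) auto
  then show ?thesis using c_pos by simp
next
  case True
  define n where "n = (LEAST j. digit j s \<noteq> digit j t)"
  have n: "digit n s \<noteq> digit n t" using True unfolding n_def by (rule LeastI_ex)
  have less: "digit j s = digit j t" if "j < n" for j using not_less_Least[of j "\<lambda>j. digit j s \<noteq> digit j t"] that n_def by auto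
  define d where "d j = real_of_int (digit (j + Suc n) s) - real_of_int (digit (j + Suc n) t)" for j
  have "cantor_point s - cantor_point t
      = (real_of_int (digit n s) - real_of_int (digit n t)) * digit_weight n + (\<Sum>j. d j * digit_weight (j + Suc n))"
  proof -
    have "(\<Sum>j<n. of_int (digit j s) * digit_weight j) = (\<Sum>j<n. of_int (digit j t) * digit_weight j)"
      using less by simp
    moreover have "(\<Sum>j. d j * digit_weight (j + Suc n)) = (\<Sum>j. of_int (digit (j + Suc n) s) * digit_weight (j + Suc n))
        - (\<Sum>j. of_int (digit (j + Suc n) t) * digit_weight (j + Suc n))"
      unfolding d_def left_diff_distrib by (intro suminf_diff[symmetric] digit_sum_bounds(1) abs_digit_le)
    ultimately show ?thesis
      unfolding cantor_point_split[of _ "Suc n"] by (simp add: algebra_simps)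
  qed
  moreover have "\<bar>(real_of_int (digit n s) - real_of_int (digit n t)) * digit_weight n\<bar> = digit_weight n"
    using n digit_cases[of n s] digit_cases[of n t] digit_weight_pos[of n] by (auto simp: abs_mult)
  moreover have "\<bar>\<Sum>j. d j * digit_weight (j + Suc n)\<bar> \<le> 3/2 * digit_weight (Suc n)"
    unfolding d_def by (intro digit_sum_bounds(2) digit_diff)
  moreover have "3/2 * digit_weight (Suc n) \<le> digit_weight n / 2" using digit_weight_Suc[of n] by simp
  ultimately have "\<bar>cantor_point s - cantor_point t\<bar> \<ge> digit_weight n / 2" by linarith
  then have "\<bar>cantor_point s - cantor_point t\<bar> \<ge> c / 4 ^ Suc n / 2" using divide_right_mono[OF digit_weight_lower[of n], of 2] by linarith
  then have "8 / c * (c / 4 ^ Suc n / 2) \<le> 8 / c * \<bar>cantor_point s - cantor_point t\<bar>"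
    using c_pos by (intro mult_left_mono) auto
  moreover have "8 / c * (c / 4 ^ Suc n / 2) = 1 / 4 ^ n" using c_pos by simp
  moreover have "(s - t)\<^sup>2 \<le> 1 / 4 ^ n"
  proof -
    have "\<bar>s - t\<bar>\<^sup>2 \<le> ((1/2) ^ n)\<^sup>2"
      by (intro power_mono close_of_digits[OF assms] less) auto
    also have "((1/2::real) ^ n)\<^sup>2 = ((1/2)\<^sup>2) ^ n" by (metis mult.commute power_mult)
    also have "\<dots> = 1 / 4 ^ n" by (simp add: power2_eq_square power_one_over)
    finally show ?thesis by simp
  qed
  ultimately show ?thesis by linarith
qed

end

section \<open>Hausdorff dimension\<close>

lemma exp_diff_ge: "x - y \<le> exp x - exp y" if "0 \<le> y" "y \<le> x" for x y :: real
proof -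
  have "x - y \<le> exp (x - y) - 1" using exp_ge_add_one_self[of "x - y"] by linarith
  then have "1 * (x - y) \<le> exp y * (exp (x - y) - 1)"
    using that by (intro mult_mono) (auto simp: one_le_exp_iff)
  also have "\<dots> = exp x - exp y" by (simp add: right_diff_distrib flip: exp_add)
  finally show ?thesis by simp
qed

lemma exp_exp_separation:
  fixes h h' :: real
  assumes "0 \<le> h" "0 \<le> h'" shows "\<bar>h - h'\<bar> \<le> \<bar>exp (exp h) - exp (exp h')\<bar>"
proof -
  have "y - x \<le> exp (exp y) - exp (exp x)" if "0 \<le> x" "x \<le> y" for x y :: real
  proof -
    have "y - x \<le> exp y - exp x" by (rule exp_diff_ge[OF that])
    also have "\<dots> \<le> exp (exp y) - exp (exp x)" using that by (intro exp_diff_ge) auto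
    finally show ?thesis .
  qed
  from this[of h h'] this[of h' h] show ?thesis using assms by linarith
qed

text \<open>The chord is twice the sine of half the angle, and Jordan's inequality applies up to
  half a turn; beyond that the chord shrinks again.\<close>

lemma chord_lower:
  assumes "\<bar>s - t\<bar> \<le> 1/2"
  shows "4 * \<bar>s - t\<bar> \<le> cmod (cis (2 * pi * s - b) - cis (2 * pi * t - b))"
proof -
  have "cis (2 * pi * s - b) - cis (2 * pi * t - b) = cis (2 * pi * t - b) * (exp (\<i> * of_real (2 * pi * (s - t))) - 1)"
    by (simp add: right_diff_distrib cis_conv_exp flip: exp_add)
  then have "cmod (cis (2 * pi * s - b) - cis (2 * pi * t - b)) = cmod (exp (\<i> * of_real (2 * pi * (s - t))) - 1)"
    by (simp only: norm_mult norm_cis mult_1)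
  also have "\<dots> = 2 * \<bar>sin (2 * pi * (s - t) / 2)\<bar>" by (rule dist_exp_i_1)
  also have "\<dots> = 2 * \<bar>sin (2 * pi * (\<bar>s - t\<bar> / 2))\<bar>"
  proof -
    have "\<bar>sin (2 * pi * x / 2)\<bar> = \<bar>sin (2 * pi * (\<bar>x\<bar> / 2))\<bar>" for x
      by (cases "0 \<le> x") simp_all
    then show ?thesis by simp
  qed
  finally have "cmod (cis (2 * pi * s - b) - cis (2 * pi * t - b)) = 2 * \<bar>sin (2 * pi * (\<bar>s - t\<bar> / 2))\<bar>" .
  moreover have "4 * (\<bar>s - t\<bar> / 2) \<le> sin (2 * pi * (\<bar>s - t\<bar> / 2))"
    using assms by (intro sin_ge_linear) auto
  ultimately show ?thesis by linarith
qed

lemma half_plane_lipschitz: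
  "cmod (half_plane P - half_plane P') \<le> dist P P'" "cmod (horiz P - horiz P') \<le> dist P P'"
proof -
  obtain x y z x' y' z' where P: "P = (x, y, z)" "P' = (x', y', z')" by (cases P, cases P')
  have d: "(dist P P')\<^sup>2 = (x - x')\<^sup>2 + (y - y')\<^sup>2 + (z - z')\<^sup>2"
    by (simp add: P dist_Pair_Pair dist_real_def)
  have horiz: "(cmod (horiz P - horiz P'))\<^sup>2 = (x - x')\<^sup>2 + (y - y')\<^sup>2"
    by (simp add: P horiz_def cmod_power2)
  have "(cmod (half_plane P - half_plane P'))\<^sup>2 = (cmod (horiz P) - cmod (horiz P'))\<^sup>2 + (z - z')\<^sup>2"
    unfolding norm_horiz by (simp add: P half_plane_def cmod_power2)
  also have "(cmod (horiz P) - cmod (horiz P'))\<^sup>2 \<le> (cmod (horiz P - horiz P'))\<^sup>2"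
    using norm_triangle_ineq3[of "horiz P" "horiz P'"] by (metis abs_ge_zero power2_abs power_mono)
  finally have "(cmod (half_plane P - half_plane P'))\<^sup>2 \<le> (dist P P')\<^sup>2" using horiz d by linarith
  then show "cmod (half_plane P - half_plane P') \<le> dist P P'" by (rule power2_le_imp_le) simp
  have "(cmod (horiz P - horiz P'))\<^sup>2 \<le> (dist P P')\<^sup>2" using horiz d by simp
  then show "cmod (horiz P - horiz P') \<le> dist P P'" by (rule power2_le_imp_le) simp
qed

lemma unit_vector_separation:
  fixes u u' :: complex
  assumes "cmod u = 1" "cmod u' = 1" "0 \<le> r'"
  shows "r * cmod (u - u') \<le> 2 * cmod (of_real r * u - of_real r' * u')"
proof -
  have "of_real r * (u - u') = (of_real r * u - of_real r' * u') + of_real (r' - r) * u'"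
    by (simp add: algebra_simps)
  then have "cmod (of_real r * (u - u')) \<le> cmod (of_real r * u - of_real r' * u') + cmod (of_real (r' - r) * u')"
    by (metis norm_triangle_ineq)
  then have 1: "\<bar>r\<bar> * cmod (u - u') \<le> cmod (of_real r * u - of_real r' * u') + \<bar>r' - r\<bar>"
    using assms by (simp add: norm_mult del: of_real_diff)
  show ?thesis
  proof (cases "0 \<le> r")
    case True
    have "\<bar>cmod (of_real r * u) - cmod (of_real r' * u')\<bar> \<le> cmod (of_real r * u - of_real r' * u')"
      by (rule norm_triangle_ineq3)
    then have "\<bar>r - r'\<bar> \<le> cmod (of_real r * u - of_real r' * u')"
      using assms True by (simp add: norm_mult)
    then show ?thesis using 1 True by simp
  next
    case False
    then have "r * cmod (u - u') \<le> 0" by (simp add: mult_nonpos_nonneg)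
    then show ?thesis by (meson norm_ge_zero mult_nonneg_nonneg order_trans zero_le_numeral)
  qed
qed

text \<open>For \<open>h\<close> in [0, 1] the modulus of \<open>zcoord + 1\<close> is at most the
  base of this square. Two such factors occur in the inverse Moebius map, and in the lower bound for
  the distance to the axis.\<close>

definition chart_const :: real where
  "chart_const = (exp (exp 1) + 1)\<^sup>2"

text \<open>Projecting to the half plane does not increase distances, and the inverse Moebius map is
  Lipschitz where \<open>zcoord\<close> is bounded; modulus and argument then give \<open>h\<close>
  and \<omega>. The angle \<theta> is read off the horizontal part, whose length stays away from
  0.\<close>

lemma chart_separation:
  fixes \<omega> \<omega>' \<theta> \<theta>' h h' :: real
  assumes "0 \<le> h" "h \<le> 1" "0 \<le> h'" "h' \<le> 1" "\<bar>\<omega> - \<omega>'\<bar> \<le> 1/2" "\<bar>\<theta> - \<theta>'\<bar> \<le> 1/2"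
  defines "d \<equiv> dist (chart \<omega> \<theta> h) (chart \<omega>' \<theta>' h')"
  shows "\<bar>\<omega> - \<omega>'\<bar> \<le> chart_const * d" "\<bar>\<theta> - \<theta>'\<bar> \<le> chart_const * d" "\<bar>h - h'\<bar> \<le> chart_const * d"
proof -
  define M where "M = exp (exp (1::real)) + 1"
  have M: "M > 0" "chart_const = M\<^sup>2" by (simp_all add: M_def chart_const_def add_pos_pos)
  have d0: "d \<ge> 0" by (simp add: d_def)
  define Z Z' where "Z = zcoord \<omega> h" and "Z' = zcoord \<omega>' h'"
  have norms: "cmod Z = exp (exp h)" "cmod Z' = exp (exp h')" by (simp_all add: Z_def Z'_def norm_zcoord)
  have nz: "Z + 1 \<noteq> 0" "Z' + 1 \<noteq> 0" by (simp_all add: Z_def Z'_def zcoord_neq)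
  have le: "cmod (Z + 1) \<le> M" "cmod (Z' + 1) \<le> M"
    using norm_triangle_ineq[of Z 1] norm_triangle_ineq[of Z' 1] assms by (auto simp: norms M_def intro: order_trans)
  have hp: "cmod (wcoord \<omega> h - wcoord \<omega>' h') \<le> d"
    using half_plane_lipschitz(1)[of "chart \<omega> \<theta> h" "chart \<omega>' \<theta>' h'"] by (simp add: half_plane_chart d_def)
  have "Z - Z' = (wcoord \<omega> h - wcoord \<omega>' h') * (Z + 1) * (Z' + 1) / 2"
  proof -
    have "wcoord \<omega> h = 1 - 2 / (Z + 1)" "wcoord \<omega>' h' = 1 - 2 / (Z' + 1)"
      using nz unfolding wcoord_def Z_def[symmetric] Z'_def[symmetric] by (simp_all add: field_simps)
    moreover have "((1 - 2 / a) - (1 - 2 / b)) * a * b / 2 = a - b" if "a \<noteq> 0" "b \<noteq> 0" for a b :: complex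
      using that by (simp add: field_simps)
    ultimately show ?thesis using nz by simp
  qed
  then have "cmod (Z - Z') = cmod (wcoord \<omega> h - wcoord \<omega>' h') * cmod (Z + 1) * cmod (Z' + 1) / 2"
    by (simp only: norm_mult norm_divide norm_numeral)
  also have "\<dots> \<le> d * M * M / 2"
    using hp le d0 M by (intro divide_right_mono mult_mono) auto
  finally have ZZ: "cmod (Z - Z') \<le> M\<^sup>2 * d / 2" by (simp add: power2_eq_square mult_ac)
  have Md: "0 \<le> M\<^sup>2 * d" using d0 by simp
  have "\<bar>h - h'\<bar> \<le> \<bar>cmod Z - cmod Z'\<bar>" unfolding norms using assms by (intro exp_exp_separation)
  also have "\<dots> \<le> cmod (Z - Z')" by (rule norm_triangle_ineq3)
  finally show "\<bar>h - h'\<bar> \<le> chart_const * d" using ZZ Md unfolding M(2) by linarith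
  have "4 * \<bar>\<omega> - \<omega>'\<bar> \<le> cmod (cis (2 * pi * \<omega> - pi) - cis (2 * pi * \<omega>' - pi))"
    by (rule chord_lower[OF assms(5)])
  also have "\<dots> \<le> exp (exp h) * cmod (cis (2 * pi * \<omega> - pi) - cis (2 * pi * \<omega>' - pi))"
    by (simp add: mult_le_cancel_right1)
  also have "\<dots> \<le> 2 * cmod (Z - Z')"
    unfolding Z_def Z'_def zcoord_def by (rule unit_vector_separation) simp_all
  finally have \<omega>_le: "4 * \<bar>\<omega> - \<omega>'\<bar> \<le> 2 * cmod (Z - Z')" .
  have "a \<le> c" if "4 * a \<le> 2 * b" "b \<le> c / 2" "0 \<le> c" for a b c :: real
    using that by linarith
  from this[OF \<omega>_le ZZ Md] show "\<bar>\<omega> - \<omega>'\<bar> \<le> chart_const * d" by (simp only: M(2))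
  define \<rho> \<rho>' where "\<rho> = Re (wcoord \<omega> h)" and "\<rho>' = Re (wcoord \<omega>' h')"
  have "1 / M\<^sup>2 \<le> \<rho>"
  proof -
    have "exp h \<ge> 1" using assms(1) by simp
    then have "exp (exp h) \<ge> 2" using exp_ge_add_one_self[of "exp h"] by linarith
    then have "2\<^sup>2 \<le> (exp (exp h))\<^sup>2" by (intro power_mono) auto
    then have "1 / M\<^sup>2 \<le> ((exp (exp h))\<^sup>2 - 1) / (cmod (Z + 1))\<^sup>2"
      using le nz by (intro frac_le power_mono) auto
    then show ?thesis by (simp add: \<rho>_def Re_wcoord Z_def)
  qed
  then have "1 \<le> M\<^sup>2 * \<rho>" using M(1) by (simp add: field_simps)
  have "4 * \<bar>\<theta> - \<theta>'\<bar> \<le> cmod (cis (2 * pi * \<theta>) - cis (2 * pi * \<theta>'))"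
    using chord_lower[OF assms(6), of 0] by simp
  also have "\<dots> \<le> M\<^sup>2 * \<rho> * cmod (cis (2 * pi * \<theta>) - cis (2 * pi * \<theta>'))"
    using \<open>1 \<le> M\<^sup>2 * \<rho>\<close> mult_right_mono[of 1 "M\<^sup>2 * \<rho>" "cmod (cis (2 * pi * \<theta>) - cis (2 * pi * \<theta>'))"] by simp
  also have "\<dots> \<le> M\<^sup>2 * (2 * d)"
  proof -
    have "\<rho> * cmod (cis (2 * pi * \<theta>) - cis (2 * pi * \<theta>'))
        \<le> 2 * cmod (of_real \<rho> * cis (2 * pi * \<theta>) - of_real \<rho>' * cis (2 * pi * \<theta>'))"
      using Re_wcoord_pos[of \<omega>' h'] by (intro unit_vector_separation) (simp_all add: \<rho>'_def)
    also have "\<dots> \<le> 2 * d"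
      using half_plane_lipschitz(2)[of "chart \<omega> \<theta> h" "chart \<omega>' \<theta>' h'"]
      by (simp add: horiz_chart \<rho>_def \<rho>'_def d_def)
    finally show ?thesis by (simp add: mult.assoc mult_left_mono)
  qed
  finally have \<theta>_le: "4 * \<bar>\<theta> - \<theta>'\<bar> \<le> 2 * (M\<^sup>2 * d)" by (simp only: mult.left_commute)
  have "a \<le> c" if "4 * a \<le> 2 * c" "0 \<le> c" for a c :: real
    using that by linarith
  from this[OF \<theta>_le Md] show "\<bar>\<theta> - \<theta>'\<bar> \<le> chart_const * d" by (simp only: M(2))
qed

section \<open>From coverings to Lebesgue measure\<close>

lemma emeasure_lborel_triple:
  fixes A B C :: "real set"
  assumes "A \<in> sets borel" "B \<in> sets borel" "C \<in> sets borel"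
  shows "emeasure lborel (A \<times> B \<times> C) = emeasure lborel A * (emeasure lborel B * emeasure lborel C)"
proof -
  have "B \<times> C \<in> sets borel" using assms by (simp add: borel_Times)
  then have "emeasure lborel (A \<times> B \<times> C) = emeasure lborel A * emeasure lborel (B \<times> C)"
    using assms by (subst lborel_prod[symmetric]) (simp add: lborel.emeasure_pair_measure_Times)
  also have "emeasure lborel (B \<times> C) = emeasure lborel B * emeasure lborel C"
    using assms by (subst lborel_prod[symmetric]) (simp add: lborel.emeasure_pair_measure_Times)
  finally show ?thesis .
qed

text \<open>A set of diameter \<open>d\<close> pulls back to a subset of a box with sides of order \<open>d\<^sup>1\<^sup>/\<^sup>2\<close>, \<open>d\<close>, \<open>d\<close>,
  so covers of \<open>A\<close> turn into covers of a set of positive Lebesgue measure.\<close>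

lemma hausdorff_dim_ge_5_2:
  fixes G :: "real \<times> real \<times> real \<Rightarrow> 'a::metric_space" and K \<eta> :: real
  defines "D \<equiv> {0..<1} \<times> {0..\<eta>} \<times> {0..1}"
  assumes \<eta>: "\<eta> > 0" and K: "K > 0" and sub: "G ` D \<subseteq> A"
    and sep: "\<And>P P'. P \<in> D \<Longrightarrow> P' \<in> D \<Longrightarrow>
      (fst P - fst P')\<^sup>2 \<le> K * dist (G P) (G P') \<and> \<bar>fst (snd P) - fst (snd P')\<bar> \<le> K * dist (G P) (G P') \<and>
      \<bar>snd (snd P) - snd (snd P')\<bar> \<le> K * dist (G P) (G P')"
  shows "hausdorff_dim A \<ge> 5 / 2"
proof -
  \<comment> \<open>The volume of a box with one side \<open>2 * sqrt (K * d)\<close> and two sides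
    \<open>2 * K * d\<close> is \<open>C * d powr (5/2)\<close>.\<close>
  define C where "C = 8 * sqrt K * K\<^sup>2"
  have C: "C > 0" using K by (simp add: C_def)
  have measure_D: "emeasure lborel D = ennreal \<eta>"
    unfolding D_def using \<eta> by (subst emeasure_lborel_triple) auto
  \<comment> \<open>Scale 1 suffices since the measure is a supremum over scales, and for diameters
    at most 1 a smaller exponent only enlarges the sum.\<close>
  have lower: "ennreal (\<eta> / C) \<le> hausdorff_content s 1 A" if s: "0 < s" "s \<le> 5/2" for s
    unfolding hausdorff_content_def
  proof (rule Inf_greatest)
    fix S assume "S \<in> {\<Sum>i. ennreal (diameter (U i) powr s) |U :: nat \<Rightarrow> 'a set.
            A \<subseteq> (\<Union>i. U i) \<and> (\<forall>i. bounded (U i) \<and> diameter (U i) \<le> 1)}"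
    then obtain U :: "nat \<Rightarrow> 'a set" where S: "S = (\<Sum>i. ennreal (diameter (U i) powr s))"
      and cover: "A \<subseteq> (\<Union>i. U i)" and U: "\<And>i. bounded (U i)" "\<And>i. diameter (U i) \<le> 1" by auto
    \<comment> \<open>\<open>G\<close> is not assumed measurable, so the pullback is replaced by a
      box around it.\<close>
    have "\<exists>B. B \<in> sets lborel \<and> D \<inter> G -` U i \<subseteq> B \<and> emeasure lborel B \<le> ennreal (C * diameter (U i) powr s)" for i
    proof (cases "D \<inter> G -` U i = {}")
      case True
      then show ?thesis by (intro exI[of _ "{}"]) simp
    next
      case False
      then obtain P where P: "P \<in> D" "G P \<in> U i" by blast
      obtain x y z where xyz: "P = (x, y, z)" by (cases P)
      define d where "d = diameter (U i)"
      have d: "0 \<le> d" "d \<le> 1" using U[of i] by (auto simp: d_def diameter_ge_0)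
      define r where "r = sqrt (K * d)"
      have r: "r \<ge> 0" using d K by (simp add: r_def)
      let ?B = "{x - r..x + r} \<times> {y - K * d..y + K * d} \<times> {z - K * d..z + K * d}"
      have "D \<inter> G -` U i \<subseteq> ?B"
      proof
        fix P' assume P': "P' \<in> D \<inter> G -` U i"
        obtain x' y' z' where xyz': "P' = (x', y', z')" by (cases P')
        have "dist (G P) (G P') \<le> d"
          unfolding d_def using P P' U by (intro diameter_bounded_bound) auto
        then have "K * dist (G P) (G P') \<le> K * d" using K by simp
        then have "(x - x')\<^sup>2 \<le> K * d" "\<bar>y - y'\<bar> \<le> K * d" "\<bar>z - z'\<bar> \<le> K * d"
          using sep[of P P'] P P' by (auto simp: xyz xyz')
        moreover from this(1) have "\<bar>x - x'\<bar> \<le> r" unfolding r_def by (rule real_le_rsqrt[of "\<bar>x - x'\<bar>", simplified])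
        ultimately show "P' \<in> ?B" by (auto simp: xyz')
      qed
      moreover have "emeasure lborel ?B \<le> ennreal (C * d powr s)"
      proof -
        have "emeasure lborel ?B = ennreal (2 * r) * (ennreal (2 * (K * d)) * ennreal (2 * (K * d)))"
          using r d K by (subst emeasure_lborel_triple) auto
        also have "\<dots> = ennreal (2 * r * (2 * (K * d) * (2 * (K * d))))"
        proof -
          have "ennreal a * (ennreal b * ennreal b) = ennreal (a * (b * b))" if "0 \<le> a" "0 \<le> b" for a b
            using that by (simp add: ennreal_mult)
          then show ?thesis using r d K by simp
        qed
        also have "2 * r * (2 * (K * d) * (2 * (K * d))) = C * (sqrt d * d\<^sup>2)"
          by (simp add: C_def r_def real_sqrt_mult power2_eq_square)
        also have "sqrt d * d\<^sup>2 = d powr (5/2)"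
        proof (cases "d = 0")
          case False
          have "d powr (5/2) = d powr (1/2) * d powr 2" by (subst powr_add[symmetric]) simp
          then show ?thesis using d False by (simp add: powr_half_sqrt)
        qed simp
        also have "ennreal (C * d powr (5/2)) \<le> ennreal (C * d powr s)"
          using C d s by (intro ennreal_leI mult_left_mono powr_mono') auto
        finally show ?thesis .
      qed
      ultimately show ?thesis by (intro exI[of _ ?B]) (simp add: d_def borel_Times)
    qed
    then obtain B where B: "\<And>i. B i \<in> sets lborel" "\<And>i. D \<inter> G -` U i \<subseteq> B i"
      "\<And>i. emeasure lborel (B i) \<le> ennreal (C * diameter (U i) powr s)" by metis
    have "D \<subseteq> (\<Union>i. B i)"
    proof
      fix P assume "P \<in> D"
      then obtain i where "G P \<in> U i" using sub cover by blast
      then show "P \<in> (\<Union>i. B i)" using B(2)[of i] \<open>P \<in> D\<close> by blast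
    qed
    then have "ennreal \<eta> \<le> emeasure lborel (\<Union>i. B i)"
      unfolding measure_D[symmetric] using B(1) by (intro emeasure_mono) auto
    also have "\<dots> \<le> (\<Sum>i. emeasure lborel (B i))"
      using B(1) by (intro emeasure_subadditive_countably) auto
    also have "\<dots> \<le> (\<Sum>i. ennreal C * ennreal (diameter (U i) powr s))"
      using B(3) C by (intro suminf_le) (auto simp: ennreal_mult)
    also have "\<dots> = ennreal C * S" unfolding S by (rule ennreal_suminf_cmult)
    finally have "ennreal \<eta> \<le> ennreal C * S" .
    then show "ennreal (\<eta> / C) \<le> S"
    proof -
      have "ennreal (\<eta> / C) = ennreal (1 / C) * ennreal \<eta>" using C \<eta> by (simp flip: ennreal_mult)
      also have "\<dots> \<le> ennreal (1 / C) * (ennreal C * S)" using \<open>ennreal \<eta> \<le> ennreal C * S\<close> by (intro mult_left_mono) auto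
      also have "\<dots> = S" using C by (simp flip: mult.assoc ennreal_mult)
      finally show ?thesis .
    qed
  qed
  show ?thesis
    unfolding hausdorff_dim_def
  proof (rule INF_greatest)
    fix s assume s: "s \<in> {s. 0 < s \<and> hausdorff_measure s A = 0}"
    have "5/2 < s"
    proof (rule ccontr)
      assume "\<not> 5/2 < s"
      then have "ennreal (\<eta> / C) \<le> hausdorff_content s 1 A" using s by (intro lower) auto
      also have "\<dots> \<le> hausdorff_measure s A" unfolding hausdorff_measure_def by (intro SUP_upper) auto
      also have "\<dots> = 0" using s by simp
      finally show False using \<eta> C by simp
    qed
    have "(5 / 2 :: ennreal) = ennreal (5/2)" by (simp add: divide_ennreal[symmetric])
    then show "5 / 2 \<le> ennreal s" using \<open>5/2 < s\<close> by (simp add: ennreal_leI)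
  qed
qed

context cantor_cascade
begin

text \<open>The parameters are the Cantor digit variable, the flow time of the base and the height.
  The base flow preserves \<open>near_phase\<close>, and the height is unrestricted, so the last two
  range over full intervals.\<close>

lemma hausdorff_dim_limit_class:
  assumes "A \<in> {S0, R0}" "B \<in> {S0, R0}"
  shows "hausdorff_dim (limit_class V A B) \<ge> 5 / 2"
proof -
  obtain j :: int where j: "\<And>\<omega> \<theta> h. near_phase (of_int j / 4) \<omega> \<theta> \<Longrightarrow> chart \<omega> \<theta> h \<in> limit_class V A B"
    using limit_class_near_phase[OF assms] by blast
  define w where "w s u = of_int j / 4 + cantor_point s + \<alpha> * u" for s u
  \<comment> \<open>Keeps both the time \<open>u\<close> and the drift \<open>\<alpha> * u\<close>
    below a quarter turn.\<close>
  define \<eta> where "\<eta> = min (1/4) (1 / (4 * \<alpha>))"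
  have \<eta>: "\<eta> > 0" "\<eta> \<le> 1/4" "\<alpha> * \<eta> \<le> 1/4"
  proof -
    have "\<alpha> * \<eta> \<le> \<alpha> * (1 / (4 * \<alpha>))" unfolding \<eta>_def using alpha_pos by (intro mult_left_mono) auto
    then show "\<alpha> * \<eta> \<le> 1/4" using alpha_pos by simp
  qed (use alpha_pos in \<open>auto simp: \<eta>_def\<close>)
  \<comment> \<open>The Cantor coordinate is \<omega> minus the drift, which costs
    \<open>1 + \<alpha>\<close>; \<open>8 / c\<close> comes from
    \<open>cantor_point_separation\<close>.\<close>
  define K where "K = chart_const + 8 / c * ((1 + \<alpha>) * chart_const)"
  have cc: "chart_const > 0" unfolding chart_const_def by (intro zero_less_power add_pos_pos) simp_all
  have K: "K > 0" "chart_const \<le> K" "8 / c * ((1 + \<alpha>) * chart_const) \<le> K"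
    using cc c_pos alpha_pos by (auto simp: K_def intro!: add_pos_nonneg)
  show ?thesis
  proof (rule hausdorff_dim_ge_5_2[where G = "\<lambda>P. chart (w (fst P) (fst (snd P))) (fst (snd P)) (snd (snd P))" and K = K and \<eta> = \<eta>])
    show "(\<lambda>P. chart (w (fst P) (fst (snd P))) (fst (snd P)) (snd (snd P))) ` ({0..<1} \<times> {0..\<eta>} \<times> {0..1}) \<subseteq> limit_class V A B"
    proof (rule image_subsetI)
      fix P :: point
      have "near_phase (of_int j / 4) (of_int j / 4 + cantor_point (fst P) + \<alpha> * fst (snd P)) (0 + fst (snd P))"
        by (intro near_phase_flow near_phase_cantor_point)
      then show "chart (w (fst P) (fst (snd P))) (fst (snd P)) (snd (snd P)) \<in> limit_class V A B"
        by (intro j) (simp add: w_def)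
    qed
    fix P P' :: point
    assume "P \<in> {0..<1} \<times> {0..\<eta>} \<times> {0..1}" "P' \<in> {0..<1} \<times> {0..\<eta>} \<times> {0..1}"
    then obtain s u h s' u' h' where P: "P = (s, u, h)" "P' = (s', u', h')"
      and s: "0 \<le> s" "s < 1" "0 \<le> s'" "s' < 1" and u: "0 \<le> u" "u \<le> \<eta>" "0 \<le> u'" "u' \<le> \<eta>"
      and h: "0 \<le> h" "h \<le> 1" "0 \<le> h'" "h' \<le> 1" by auto
    define d where "d = dist (chart (w s u) u h) (chart (w s' u') u' h')"
    have d: "d \<ge> 0" by (simp add: d_def)
    have uu: "\<bar>u - u'\<bar> \<le> \<eta>" using u by linarith
    have auu: "\<bar>\<alpha> * (u - u')\<bar> = \<alpha> * \<bar>u - u'\<bar>" using alpha_pos by (simp add: abs_mult)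
    also have "\<dots> \<le> 1/4" using mult_left_mono[OF uu, of \<alpha>] alpha_pos \<eta>(3) by linarith
    finally have "\<bar>\<alpha> * (u - u')\<bar> \<le> 1/4" .
    then have "\<bar>w s u - w s' u'\<bar> \<le> 1/2"
      using cantor_point_bounds[of s] cantor_point_bounds[of s'] unfolding w_def right_diff_distrib by linarith
    note sep = chart_separation[OF h this, of u u', folded d_def]
    have sep: "\<bar>w s u - w s' u'\<bar> \<le> chart_const * d" "\<bar>u - u'\<bar> \<le> chart_const * d" "\<bar>h - h'\<bar> \<le> chart_const * d"
      using sep uu \<eta>(2) by auto
    have "\<bar>cantor_point s - cantor_point s'\<bar> \<le> \<bar>w s u - w s' u'\<bar> + \<alpha> * \<bar>u - u'\<bar>"
      using auu unfolding w_def right_diff_distrib by linarith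
    also have "\<dots> \<le> chart_const * d + \<alpha> * (chart_const * d)"
      using sep alpha_pos by (intro add_mono mult_left_mono) auto
    finally have "8 / c * \<bar>cantor_point s - cantor_point s'\<bar> \<le> 8 / c * (chart_const * d + \<alpha> * (chart_const * d))"
      using c_pos by (intro mult_left_mono) auto
    also have "\<dots> = 8 / c * ((1 + \<alpha>) * chart_const) * d"
      by (simp only: distrib_right mult_1 mult.assoc)
    also have "\<dots> \<le> K * d" using K(3) d by (rule mult_right_mono)
    finally have "(s - s')\<^sup>2 \<le> K * d" using cantor_point_separation[OF s] by linarith
    moreover have "chart_const * d \<le> K * d" using K(2) d by (rule mult_right_mono)
    ultimately show "(fst P - fst P')\<^sup>2 \<le> K * dist (chart (w (fst P) (fst (snd P))) (fst (snd P)) (snd (snd P)))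
          (chart (w (fst P') (fst (snd P'))) (fst (snd P')) (snd (snd P'))) \<and>
        \<bar>fst (snd P) - fst (snd P')\<bar> \<le> K * dist (chart (w (fst P) (fst (snd P))) (fst (snd P)) (snd (snd P)))
          (chart (w (fst P') (fst (snd P'))) (fst (snd P')) (snd (snd P'))) \<and>
        \<bar>snd (snd P) - snd (snd P')\<bar> \<le> K * dist (chart (w (fst P) (fst (snd P))) (fst (snd P)) (snd (snd P)))
          (chart (w (fst P') (fst (snd P'))) (fst (snd P')) (snd (snd P')))"
      using sep by (simp add: P flip: d_def)
  qed (use \<eta> K in auto)
qed

end

text \<open>One and the same function serves all claims, for every positive irrational; the
  almost-everywhere clause then only discards the countable set of rationals.\<close>

lemma psi_exists_of_irrational:
  fixes \<alpha> :: real
  assumes "\<alpha> > 0" "\<alpha> \<notin> \<rat>"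
  shows "\<exists>\<psi> :: circle \<times> circle \<Rightarrow> real. continuous_on UNIV \<psi> \<and>
         transitive_flow (vector_field \<alpha> \<psi>) \<and>
         (\<forall>A\<in>{S0, R0}. \<forall>B\<in>{S0, R0}.
            closure (limit_class (vector_field \<alpha> \<psi>) A B) = UNIV \<and>
            hausdorff_dim (limit_class (vector_field \<alpha> \<psi>) A B) \<ge> 5 / 2)"
proof -
  obtain q p J c where "cantor_cascade \<alpha> q p J c" using cantor_cascade_exists[OF assms] by blast
  then interpret cantor_cascade \<alpha> q p J c .
  show ?thesis
    by (intro exI[of _ psi] conjI ballI continuous_psi transitive closure_limit_class
        hausdorff_dim_limit_class)
qed

theorem theorem13:
  "(\<forall>\<alpha>::real. \<alpha> > 0 \<and> \<alpha> \<notin> \<rat> \<longrightarrow>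
      (\<exists>\<psi> :: circle \<times> circle \<Rightarrow> real. continuous_on UNIV \<psi> \<and>
         transitive_flow (vector_field \<alpha> \<psi>) \<and>
         (\<forall>A\<in>{S0, R0}. \<forall>B\<in>{S0, R0}.
            closure (limit_class (vector_field \<alpha> \<psi>) A B) = UNIV))) \<and>
   (AE \<alpha> in lborel. \<alpha> > 0 \<longrightarrow>
      (\<exists>\<psi> :: circle \<times> circle \<Rightarrow> real. continuous_on UNIV \<psi> \<and>
         transitive_flow (vector_field \<alpha> \<psi>) \<and>
         (\<forall>A\<in>{S0, R0}. \<forall>B\<in>{S0, R0}.
            closure (limit_class (vector_field \<alpha> \<psi>) A B) = UNIV \<and>
            hausdorff_dim (limit_class (vector_field \<alpha> \<psi>) A B) \<ge> 5 / 2)))"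
proof (intro conjI allI impI)
  fix \<alpha> :: real
  assume "\<alpha> > 0 \<and> \<alpha> \<notin> \<rat>"
  then show "\<exists>\<psi> :: circle \<times> circle \<Rightarrow> real. continuous_on UNIV \<psi> \<and>
         transitive_flow (vector_field \<alpha> \<psi>) \<and>
         (\<forall>A\<in>{S0, R0}. \<forall>B\<in>{S0, R0}.
            closure (limit_class (vector_field \<alpha> \<psi>) A B) = UNIV)"
    using psi_exists_of_irrational[of \<alpha>] by blast
next
  have "(\<rat> :: real set) \<in> null_sets lborel"
    by (intro countable_imp_null_set_lborel countable_rat)
  from AE_not_in[OF this]
  show "AE \<alpha> in lborel. \<alpha> > 0 \<longrightarrow>
      (\<exists>\<psi> :: circle \<times> circle \<Rightarrow> real. continuous_on UNIV \<psi> \<and>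
         transitive_flow (vector_field \<alpha> \<psi>) \<and>
         (\<forall>A\<in>{S0, R0}. \<forall>B\<in>{S0, R0}.
            closure (limit_class (vector_field \<alpha> \<psi>) A B) = UNIV \<and>
            hausdorff_dim (limit_class (vector_field \<alpha> \<psi>) A B) \<ge> 5 / 2))"
    by eventually_elim (use psi_exists_of_irrational in blast)
qed

end
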